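(* There exists a simplicial $\mathrm{Aut}(A_n)$-invariant projective fan $\Sigma^{\mathrm{simp}}_{A_n}$ in $(\mathbb{Z}A_n)_{\mathbb{R}}=\mathbb{Z}A_n\otimes\mathbb{R}$ with the following construction: the $\mathrm{Aut}(A_n)$-orbit representatives of the maximal cones are $$\{\mathrm{Cone}(\gamma_C): C\in \mathrm{MP}(i),\ i=1,\dots,\lceil n/2\rceil\},$$ where $\mathrm{MP}(i)$ is the set of minimal staircase paths from $(i,i+1)$ to $(1,n+1)$ and, for a minimal staircase path $C=\{(a_r,b_r):r=1,\dots,n\}\in\mathrm{MP}(i)$, $\gamma_C=\{s_{[a_r,i],[i+1,b_r]}: r=1,\dots,n\}$.
   Context: Let $n\ge 1$ be an integer. $A_n=\{\mathbf{e}_i-\mathbf{e}_j:1\le i\ne j\le n+1\}$ is the root system of type $A_n$, with root lattice $\mathbb{Z}A_n\subset\mathbb{Z}^{n+1}$ (the vectors with coordinate sum $0$). $\mathrm{Aut}(A_n)$ is the group of linear automorphisms of $\mathbb{R}A_n$ preserving $A_n$; it is generated by $S_{n+1}$ (permuting the $\mathbf{e}_i$) and $-\mathrm{id}$. A set of $\mathrm{Aut}(A_n)$-orbit representatives of the maximal cones is a set of maximal cones containing one cone from each $\mathrm{Aut}(A_n)$-orbit of maximal cones. For integers $a\le b$, $[a,b]=\{m\in\mathbb{Z}:a\le m\le b\}$. For disjoint nonempty $I,J\subseteq[1,n+1]$, $$s_{I,J}=\frac{|J|\sum_{i\in I}\mathbf{e}_i-|I|\sum_{j\in J}\mathbf{e}_j}{\gcd(|I|,|J|)}\in\mathbb{Z}A_n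 .$$ For $1\le i\le n$, a minimal staircase path from $(i,i+1)$ to $(1,n+1)$ is a sequence $((a_r,b_r))_{r=1}^n$ with $(a_1,b_1)=(i,i+1)$, $(a_n,b_n)=(1,n+1)$ and, for each $r\ge 2$, $(a_r,b_r)=(a_{r-1}-1,b_{r-1})$ or $(a_r,b_r)=(a_{r-1},b_{r-1}+1)$. $\mathrm{Cone}(S)$ denotes the set of non-negative real linear combinations of the vectors in $S$. A fan (with respect to the lattice $\mathbb{Z}A_n$) is simplicial if each of its cones is generated by linearly independent vectors; it is $\mathrm{Aut}(A_n)$-invariant if $\mathrm{Aut}(A_n)$ permutes its cones; it is projective if it is complete and its toric variety has a torus-invariant ample Cartier divisor. *)

theory Defs
  imports "HOL-Analysis.Analysis"
begin

section \<open>Cones and fans\<close>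

definition Cone :: "'a::real_vector set \<Rightarrow> 'a set" where
  "Cone S = {\<Sum>v\<in>F. c v *\<^sub>R v | F c. finite F \<and> F \<subseteq> S \<and> (\<forall>v\<in>F. 0 \<le> c v)}"

definition rational_polyhedral_cone :: "'a::real_vector set \<Rightarrow> 'a set \<Rightarrow> bool" where
  "rational_polyhedral_cone N \<sigma> \<longleftrightarrow> (\<exists>S. finite S \<and> S \<subseteq> N \<and> \<sigma> = Cone S)"

definition strongly_convex_cone :: "'a::real_vector set \<Rightarrow> bool" where
  "strongly_convex_cone \<sigma> \<longleftrightarrow> \<sigma> \<inter> uminus ` \<sigma> = {0}"

text \<open>The library's \<open>face_of\<close> also admits the empty set, which is not a face of a cone.\<close>

definition fan :: "'a::real_vector set \<Rightarrow> 'a set set \<Rightarrow> bool" where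
  "fan N \<Sigma> \<longleftrightarrow>
     finite \<Sigma> \<and>
     (\<forall>\<sigma>\<in>\<Sigma>. rational_polyhedral_cone N \<sigma> \<and> strongly_convex_cone \<sigma>) \<and>
     (\<forall>\<sigma>\<in>\<Sigma>. \<forall>\<tau>. \<tau> face_of \<sigma> \<and> \<tau> \<noteq> {} \<longrightarrow> \<tau> \<in> \<Sigma>) \<and>
     (\<forall>\<sigma>\<in>\<Sigma>. \<forall>\<tau>\<in>\<Sigma>. (\<sigma> \<inter> \<tau>) face_of \<sigma> \<and> (\<sigma> \<inter> \<tau>) face_of \<tau>)"

definition complete_fan :: "'a::real_vector set \<Rightarrow> 'a set set \<Rightarrow> bool" where
  "complete_fan N \<Sigma> \<longleftrightarrow> fan N \<Sigma> \<and> \<Union>\<Sigma> = span N"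

definition simplicial :: "'a::real_vector set set \<Rightarrow> bool" where
  "simplicial \<Sigma> \<longleftrightarrow> (\<forall>\<sigma>\<in>\<Sigma>. \<exists>B. finite B \<and> independent B \<and> \<sigma> = Cone B)"

definition maximal_cones :: "'a set set \<Rightarrow> 'a set set" where
  "maximal_cones \<Sigma> = {\<sigma>\<in>\<Sigma>. \<forall>\<tau>\<in>\<Sigma>. \<sigma> \<subseteq> \<tau> \<longrightarrow> \<tau> = \<sigma>}"

definition invariant_fan :: "('a \<Rightarrow> 'a) set \<Rightarrow> 'a set set \<Rightarrow> bool" where
  "invariant_fan G \<Sigma> \<longleftrightarrow> (\<forall>g\<in>G. (\<lambda>\<sigma>. g ` \<sigma>) ` \<Sigma> = \<Sigma>)"

text \<open>An orbit may contain more than one representative.\<close>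

definition orbit_representatives :: "('a \<Rightarrow> 'a) set \<Rightarrow> 'a set set \<Rightarrow> 'a set set \<Rightarrow> bool" where
  "orbit_representatives G \<Sigma> R \<longleftrightarrow>
     R \<subseteq> maximal_cones \<Sigma> \<and> (\<forall>\<sigma>\<in>maximal_cones \<Sigma>. \<exists>\<rho>\<in>R. \<exists>g\<in>G. g ` \<rho> = \<sigma>)"


section \<open>Complex varieties as spaces with functions\<close>

text \<open>
  A variety is described, through its closed points, by a set of affine charts \<open>(U, A)\<close>:
  \<open>U\<close> is a set of points and \<open>A\<close> the coordinate ring of \<open>U\<close>, a set of functions of which only the
  values on \<open>U\<close> matter. The underlying set of points is the union of the charts.
  A set is open if it meets every chart in a Zariski open set, i.e. in a union of sets
  \<open>h \<noteq> 0\<close> with \<open>h \<in> A\<close>; a function is regular if it is locally a quotient of elements of a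
  coordinate ring.
\<close>

type_synonym 'p variety = "('p set \<times> ('p \<Rightarrow> complex) set) set"

definition points :: "'p variety \<Rightarrow> 'p set" where
  "points X = (\<Union>(U, A)\<in>X. U)"

definition zopen :: "'p variety \<Rightarrow> 'p set \<Rightarrow> bool" where
  "zopen X W \<longleftrightarrow> W \<subseteq> points X \<and>
     (\<forall>(U, A)\<in>X. \<forall>x\<in>W \<inter> U. \<exists>h\<in>A. h x \<noteq> 0 \<and> {y\<in>U. h y \<noteq> 0} \<subseteq> W)"

definition regular_on :: "'p variety \<Rightarrow> 'p set \<Rightarrow> ('p \<Rightarrow> complex) \<Rightarrow> bool" where
  "regular_on X W f \<longleftrightarrow>
     (\<forall>x\<in>W. \<exists>(U, A)\<in>X. x \<in> U \<and>
        (\<exists>g\<in>A. \<exists>h\<in>A. h x \<noteq> 0 \<and> (\<forall>y\<in>W \<inter> U. h y \<noteq> 0 \<longrightarrow> f y = g y / h y)))"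

text \<open>Polynomial functions on \<open>\<complex>\<^sup>N\<close>, whose points are the sequences vanishing from index \<open>N\<close> on.\<close>

inductive_set poly_functions :: "nat \<Rightarrow> ((nat \<Rightarrow> complex) \<Rightarrow> complex) set" for N where
  const: "(\<lambda>_. c) \<in> poly_functions N"
| coordinate: "j < N \<Longrightarrow> (\<lambda>y. y j) \<in> poly_functions N"
| add: "p \<in> poly_functions N \<Longrightarrow> q \<in> poly_functions N \<Longrightarrow> (\<lambda>y. p y + q y) \<in> poly_functions N"
| mult: "p \<in> poly_functions N \<Longrightarrow> q \<in> poly_functions N \<Longrightarrow> (\<lambda>y. p y * q y) \<in> poly_functions N"

definition algebraic_set :: "nat \<Rightarrow> (nat \<Rightarrow> complex) set \<Rightarrow> bool" where
  "algebraic_set N Y \<longleftrightarrow>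
     (\<exists>P \<subseteq> poly_functions N. Y = {y. (\<forall>j\<ge>N. y j = 0) \<and> (\<forall>p\<in>P. p y = 0)})"

definition affine_variety :: "nat \<Rightarrow> (nat \<Rightarrow> complex) set \<Rightarrow> (nat \<Rightarrow> complex) variety" where
  "affine_variety N Y = {(Y, poly_functions N)}"

text \<open>The open subvariety \<open>W\<close> of \<open>X\<close> is isomorphic, as a space with functions, to a Zariski closed
  subset of some \<open>\<complex>\<^sup>N\<close>.\<close>

definition affine_open :: "'p variety \<Rightarrow> 'p set \<Rightarrow> bool" where
  "affine_open X W \<longleftrightarrow> zopen X W \<and>
     (\<exists>N Y F. algebraic_set N Y \<and> bij_betw F W Y \<and>
        (\<forall>V\<subseteq>W. zopen X V \<longleftrightarrow> zopen (affine_variety N Y) (F ` V)) \<and>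
        (\<forall>V\<subseteq>W. zopen X V \<longrightarrow>
           (\<forall>f. regular_on (affine_variety N Y) (F ` V) f \<longleftrightarrow> regular_on X V (f \<circ> F))))"


section \<open>Cartier divisors and ampleness\<close>

text \<open>
  In this section \<open>X\<close> is meant to be irreducible. A rational function is then represented by a
  function that is regular on some nonempty open set, two such representing the same rational
  function if they agree on a nonempty open set.
\<close>

definition rational_fun :: "'p variety \<Rightarrow> ('p \<Rightarrow> complex) \<Rightarrow> bool" where
  "rational_fun X f \<longleftrightarrow> (\<exists>W. zopen X W \<and> W \<noteq> {} \<and> regular_on X W f)"

definition rat_eq :: "'p variety \<Rightarrow> ('p \<Rightarrow> complex) \<Rightarrow> ('p \<Rightarrow> complex) \<Rightarrow> bool" where
  "rat_eq X f g \<longleftrightarrow> (\<exists>W. zopen X W \<and> W \<noteq> {} \<and> (\<forall>x\<in>W. f x = g x))"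

text \<open>A Cartier divisor, given by local equations: pairs \<open>(V, f)\<close> of an open set and a nonzero
  rational function, whose quotients are units on the overlaps.\<close>

type_synonym 'p divisor = "('p set \<times> ('p \<Rightarrow> complex)) set"

definition cartier_divisor :: "'p variety \<Rightarrow> 'p divisor \<Rightarrow> bool" where
  "cartier_divisor X D \<longleftrightarrow>
     (\<forall>(V, f)\<in>D. zopen X V \<and> rational_fun X f \<and> \<not> rat_eq X f (\<lambda>_. 0)) \<and>
     (\<Union>(V, f)\<in>D. V) = points X \<and>
     (\<forall>(V, f)\<in>D. \<forall>(V', f')\<in>D.
        \<exists>u. regular_on X (V \<inter> V') u \<and> (\<forall>x\<in>V \<inter> V'. u x \<noteq> 0) \<and> rat_eq X f (\<lambda>x. u x * f' x))"

text \<open>Two systems of local equations define the same divisor iff they are mutually compatible.\<close>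

definition divisor_eq :: "'p variety \<Rightarrow> 'p divisor \<Rightarrow> 'p divisor \<Rightarrow> bool" where
  "divisor_eq X D D' \<longleftrightarrow> cartier_divisor X D \<and> cartier_divisor X D' \<and> cartier_divisor X (D \<union> D')"

definition pullback_divisor :: "'p variety \<Rightarrow> ('p \<Rightarrow> 'p) \<Rightarrow> 'p divisor \<Rightarrow> 'p divisor" where
  "pullback_divisor X h D = (\<lambda>(V, f). (points X \<inter> h -` V, f \<circ> h)) ` D"

definition multiple_divisor :: "nat \<Rightarrow> 'p divisor \<Rightarrow> 'p divisor" where
  "multiple_divisor k D = (\<lambda>(V, f). (V, \<lambda>x. f x ^ k)) ` D"

text \<open>Global sections of \<open>\<O>(D)\<close>, the sheaf generated on \<open>V\<close> by \<open>1 / f\<close> for \<open>(V, f) \<in> D\<close>, and the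
  locus where a section generates \<open>\<O>(D)\<close>.\<close>

definition sections :: "'p variety \<Rightarrow> 'p divisor \<Rightarrow> ('p \<Rightarrow> complex) set" where
  "sections X D = {s. rational_fun X s \<and>
     (\<forall>(V, f)\<in>D. \<exists>g. regular_on X V g \<and> rat_eq X g (\<lambda>x. s x * f x))}"

definition nonvanishing_locus :: "'p variety \<Rightarrow> 'p divisor \<Rightarrow> ('p \<Rightarrow> complex) \<Rightarrow> 'p set" where
  "nonvanishing_locus X D s =
     {x. \<exists>(V, f)\<in>D. x \<in> V \<and> (\<exists>g. regular_on X V g \<and> rat_eq X g (\<lambda>x. s x * f x) \<and> g x \<noteq> 0)}"

text \<open>Ampleness as in EGA and the Stacks project: the affine sets of the form \<open>X\<^sub>s\<close>, for global
  sections \<open>s\<close> of positive powers of \<open>\<O>(D)\<close>, cover \<open>X\<close>.\<close>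

definition ample :: "'p variety \<Rightarrow> 'p divisor \<Rightarrow> bool" where
  "ample X D \<longleftrightarrow> (\<forall>x\<in>points X. \<exists>k\<ge>1. \<exists>s\<in>sections X (multiple_divisor k D).
     x \<in> nonvanishing_locus X (multiple_divisor k D) s \<and>
     affine_open X (nonvanishing_locus X (multiple_divisor k D) s))"


section \<open>The complex toric variety of a fan\<close>

text \<open>The dual lattice \<open>M = Hom(N, \<int>)\<close>, identified with a subset of \<open>N \<otimes> \<real>\<close> by the inner product.\<close>

definition dual_lattice :: "'a::real_inner set \<Rightarrow> 'a set" where
  "dual_lattice N = {m\<in>span N. \<forall>v\<in>N. m \<bullet> v \<in> \<int>}"

definition dual_monoid :: "'a::real_inner set \<Rightarrow> 'a set \<Rightarrow> 'a set" where
  "dual_monoid N \<sigma> = {m\<in>dual_lattice N. \<forall>v\<in>\<sigma>. 0 \<le> m \<bullet> v}"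

definition monoid_homs :: "'a::monoid_add set \<Rightarrow> ('a \<Rightarrow> complex) set" where
  "monoid_homs S =
     {\<gamma>\<in>extensional S. \<gamma> 0 = 1 \<and> (\<forall>m\<in>S. \<forall>m'\<in>S. \<gamma> (m + m') = \<gamma> m * \<gamma> m')}"

text \<open>
  The closed points of the affine toric variety of \<open>\<sigma>\<close> are the monoid homomorphisms from
  \<open>dual_monoid N \<sigma>\<close> to the multiplicative monoid of \<open>\<complex>\<close>. The affine toric varieties of \<open>\<sigma>\<close> and \<open>\<tau>\<close>
  are glued along that of \<open>\<sigma> \<inter> \<tau>\<close>, so a point of the toric variety is a class of pairs
  \<open>(\<sigma>, \<gamma>)\<close>.
\<close>

definition glue :: "'a::real_inner set \<Rightarrow> 'a set set \<Rightarrow> (('a set \<times> ('a \<Rightarrow> complex)) \<times> ('a set \<times> ('a \<Rightarrow> complex))) set" where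
  "glue N \<Sigma> = {((\<sigma>, \<gamma>), (\<tau>, \<delta>)). \<sigma> \<in> \<Sigma> \<and> \<tau> \<in> \<Sigma> \<and>
     \<gamma> \<in> monoid_homs (dual_monoid N \<sigma>) \<and> \<delta> \<in> monoid_homs (dual_monoid N \<tau>) \<and>
     (\<exists>\<epsilon>\<in>monoid_homs (dual_monoid N (\<sigma> \<inter> \<tau>)).
        (\<forall>m\<in>dual_monoid N \<sigma>. \<gamma> m = \<epsilon> m) \<and> (\<forall>m\<in>dual_monoid N \<tau>. \<delta> m = \<epsilon> m))}"

type_synonym 'a toric_point = "('a set \<times> ('a \<Rightarrow> complex)) set"

definition toric_points :: "'a::real_inner set \<Rightarrow> 'a set set \<Rightarrow> 'a toric_point set" where
  "toric_points N \<Sigma> = (SIGMA \<sigma>:\<Sigma>. monoid_homs (dual_monoid N \<sigma>)) // glue N \<Sigma>"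

definition toric_chart :: "'a::real_inner set \<Rightarrow> 'a set set \<Rightarrow> 'a set \<Rightarrow> 'a toric_point set" where
  "toric_chart N \<Sigma> \<sigma> = {p\<in>toric_points N \<Sigma>. \<exists>\<gamma>. (\<sigma>, \<gamma>) \<in> p}"

definition toric_character :: "'a set \<Rightarrow> 'a \<Rightarrow> 'a toric_point \<Rightarrow> complex" where
  "toric_character \<sigma> m p = (THE \<gamma>. (\<sigma>, \<gamma>) \<in> p) m"

definition toric_coordinate_ring :: "'a::real_inner set \<Rightarrow> 'a set \<Rightarrow> ('a toric_point \<Rightarrow> complex) set" where
  "toric_coordinate_ring N \<sigma> =
     {\<lambda>p. \<Sum>m\<in>F. c m * toric_character \<sigma> m p | F c. finite F \<and> F \<subseteq> dual_monoid N \<sigma>}"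

definition toric_variety :: "'a::real_inner set \<Rightarrow> 'a set set \<Rightarrow> 'a toric_point variety" where
  "toric_variety N \<Sigma> = (\<lambda>\<sigma>. (toric_chart N \<Sigma> \<sigma>, toric_coordinate_ring N \<sigma>)) ` \<Sigma>"

definition torus :: "'a::real_inner set \<Rightarrow> ('a \<Rightarrow> complex) set" where
  "torus N = monoid_homs (dual_lattice N)"

definition torus_action :: "'a::real_inner set \<Rightarrow> ('a \<Rightarrow> complex) \<Rightarrow> 'a toric_point \<Rightarrow> 'a toric_point" where
  "torus_action N t p = (\<lambda>(\<sigma>, \<gamma>). (\<sigma>, \<lambda>m\<in>dual_monoid N \<sigma>. t m * \<gamma> m)) ` p"

definition torus_invariant_divisor :: "'a::real_inner set \<Rightarrow> 'a set set \<Rightarrow> 'a toric_point divisor \<Rightarrow> bool" where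
  "torus_invariant_divisor N \<Sigma> D \<longleftrightarrow>
     (\<forall>t\<in>torus N. divisor_eq (toric_variety N \<Sigma>) D
        (pullback_divisor (toric_variety N \<Sigma>) (torus_action N t) D))"

definition projective_fan :: "'a::real_inner set \<Rightarrow> 'a set set \<Rightarrow> bool" where
  "projective_fan N \<Sigma> \<longleftrightarrow> complete_fan N \<Sigma> \<and>
     (\<exists>D. cartier_divisor (toric_variety N \<Sigma>) D \<and> torus_invariant_divisor N \<Sigma> D \<and>
          ample (toric_variety N \<Sigma>) D)"


section \<open>The root system of type A\<close>

text \<open>Below, \<open>e 1, \<dots>, e (n + 1)\<close> is the standard basis of a Euclidean space of dimension \<open>n + 1\<close>.\<close>

definition roots :: "(nat \<Rightarrow> 'a::real_vector) \<Rightarrow> nat \<Rightarrow> 'a set" where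
  "roots e n = {e i - e j | i j. i \<in> {1..n+1} \<and> j \<in> {1..n+1} \<and> i \<noteq> j}"

definition root_lattice :: "(nat \<Rightarrow> 'a::real_vector) \<Rightarrow> nat \<Rightarrow> 'a set" where
  "root_lattice e n = range (\<lambda>c :: 'a \<Rightarrow> int. \<Sum>v\<in>roots e n. of_int (c v) *\<^sub>R v)"

definition root_automorphisms :: "'a::real_vector set \<Rightarrow> ('a \<Rightarrow> 'a) set" where
  "root_automorphisms \<Phi> = {g. bij_betw g (span \<Phi>) (span \<Phi>) \<and>
     (\<forall>x\<in>span \<Phi>. \<forall>y\<in>span \<Phi>. g (x + y) = g x + g y) \<and>
     (\<forall>c. \<forall>x\<in>span \<Phi>. g (c *\<^sub>R x) = c *\<^sub>R g x) \<and>
     g ` \<Phi> = \<Phi>}"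

definition s_vec :: "(nat \<Rightarrow> 'a::real_vector) \<Rightarrow> nat set \<Rightarrow> nat set \<Rightarrow> 'a" where
  "s_vec e I J =
     (real (card J) *\<^sub>R (\<Sum>i\<in>I. e i) - real (card I) *\<^sub>R (\<Sum>j\<in>J. e j)) /\<^sub>R real (gcd (card I) (card J))"

definition minimal_paths :: "nat \<Rightarrow> nat \<Rightarrow> (nat \<Rightarrow> nat \<times> nat) set" where
  "minimal_paths n i = {C\<in>extensional {1..n}.
     C 1 = (i, i + 1) \<and> C n = (1, n + 1) \<and>
     (\<forall>r\<in>{2..n}.
        (fst (C r) + 1 = fst (C (r - 1)) \<and> snd (C r) = snd (C (r - 1))) \<or>
        (fst (C r) = fst (C (r - 1)) \<and> snd (C r) = snd (C (r - 1)) + 1))}"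

definition path_generators :: "(nat \<Rightarrow> 'a::real_vector) \<Rightarrow> nat \<Rightarrow> nat \<Rightarrow> (nat \<Rightarrow> nat \<times> nat) \<Rightarrow> 'a set" where
  "path_generators e n i C = {s_vec e {fst (C r)..i} {i+1..snd (C r)} | r. r \<in> {1..n}}"

end

theory Submission
  imports Defs
begin

text \<open>
The fan is the barycentric subdivision of the face fan of the root polytope, the convex hull of the
roots. A proper face of this polytope is the hull of the roots \<open>e i - e j\<close> with \<open>i \<in> I\<close> and \<open>j \<in> J\<close>,
for disjoint nonempty \<open>I\<close> and \<open>J\<close>, and \<open>s_vec e I J\<close> is a positive multiple of its barycentre. A
maximal cone is therefore spanned by the barycentres of a complete flag of faces, that is, of a chain
of pairs \<open>(I, J)\<close> that grows by one index at a time until all indices are used. The order in which the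
indices enter turns such a flag into a permutation of the indices and a minimal staircase path, and
\<open>- id\<close> exchanges the roles of \<open>I\<close> and \<open>J\<close>; this gives the list of representatives
(\<open>complete_flag_path\<close>, \<open>orbit_representatives_paths\<close>). An arbitrary automorphism of the root system
permutes the faces, because these are cut out by linear functionals, and hence the flags
(\<open>aut_flag\<close>, \<open>invariant_cones\<close>).

The values \<open>C - |I| |J|\<close> at the barycentres extend linearly over each cone, and the linear extension on
the cone of a flag \<open>F\<close> is a point \<open>m\<close> of the dual lattice (\<open>flag_interpolation\<close>). The decisive fact is an
inequality: for large \<open>C\<close>, the functional \<open>m\<close> lies strictly below the prescribed value at each
barycentre outside \<open>F\<close> (\<open>complete_flag_gap\<close>). Moreover every vector lies in the cone of some flag:
subtract the largest multiple of the barycentre belonging to its positive and negative coordinates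
that changes no sign, and repeat (\<open>flag_cover\<close>). Together these facts say that the cone of \<open>F\<close> is the
set of vectors on which \<open>m\<close> is maximal among all these functionals. So the cones are the normal cones of
a finite set of points of the dual lattice, and the fan axioms, completeness and simpliciality follow
(\<open>simplicial_normal_fan\<close>).

For the toric variety, the characters \<open>\<chi>\<^sup>m\<close>, each on the chart of its maximal cone, are local equations
of a torus-invariant Cartier divisor. If \<open>m\<close> and \<open>m\<^sub>0\<close> belong to the maximal cones \<open>\<sigma>\<close> and \<open>\<sigma>\<^sub>0\<close>, then
\<open>m - m\<^sub>0\<close> is nonnegative on \<open>\<sigma>\<close> and vanishes precisely on \<open>\<sigma> \<inter> \<sigma>\<^sub>0\<close>. Hence the character of
\<open>- m\<^sub>0\<close> is a global section whose nonvanishing locus is the chart of \<open>\<sigma>\<^sub>0\<close> (\<open>support_section_locus\<close>). This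
chart is affine because the dual monoid of \<open>\<sigma>\<^sub>0\<close> is finitely generated (\<open>gordan\<close>, \<open>chart_affine_open\<close>),
and the charts of the maximal cones cover the variety, so the divisor is ample. Computing the locus
requires that a regular function on a chart is determined by its values on any nonempty open set,
which rests on the density of the torus (\<open>torus_dense\<close>, \<open>regular_identity\<close>).
\<close>

section \<open>Dual monoids and their homomorphisms\<close>

lemma dual_lattice_add:
  "m \<in> dual_lattice N \<Longrightarrow> m' \<in> dual_lattice N \<Longrightarrow> m + m' \<in> dual_lattice N"
  by (auto simp: dual_lattice_def span_add inner_add_left)

lemma dual_lattice_uminus: "m \<in> dual_lattice N \<Longrightarrow> - m \<in> dual_lattice N"
  by (auto simp: dual_lattice_def span_neg inner_minus_left)

lemma dual_lattice_zero: "0 \<in> dual_lattice N"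
  by (auto simp: dual_lattice_def span_zero)

lemma dual_lattice_diff:
  "m \<in> dual_lattice N \<Longrightarrow> m' \<in> dual_lattice N \<Longrightarrow> m - m' \<in> dual_lattice N"
  using dual_lattice_add[of m N "- m'"] dual_lattice_uminus[of m' N] by simp

lemma dual_monoid_add:
  "m \<in> dual_monoid N \<sigma> \<Longrightarrow> m' \<in> dual_monoid N \<sigma> \<Longrightarrow> m + m' \<in> dual_monoid N \<sigma>"
  by (auto simp: dual_monoid_def dual_lattice_add inner_add_left)

lemma dual_monoid_zero: "0 \<in> dual_monoid N \<sigma>"
  by (auto simp: dual_monoid_def dual_lattice_zero)

lemma dual_monoid_scale: "m \<in> dual_monoid N \<sigma> \<Longrightarrow> real k *\<^sub>R m \<in> dual_monoid N \<sigma>"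
  by (induction k) (auto simp: dual_monoid_zero scaleR_add_left dual_monoid_add)

lemma dual_monoid_antimono: "\<tau> \<subseteq> \<sigma> \<Longrightarrow> dual_monoid N \<sigma> \<subseteq> dual_monoid N \<tau>"
  by (auto simp: dual_monoid_def)

lemma dual_monoid_origin: "dual_monoid N {0} = dual_lattice N"
  by (auto simp: dual_monoid_def)

lemma dual_monoid_subset: "dual_monoid N \<sigma> \<subseteq> dual_lattice N"
  by (auto simp: dual_monoid_def)

lemma monoid_homs_zero: "\<gamma> \<in> monoid_homs S \<Longrightarrow> \<gamma> 0 = 1"
  by (auto simp: monoid_homs_def)

lemma monoid_homs_add:
  "\<gamma> \<in> monoid_homs S \<Longrightarrow> m \<in> S \<Longrightarrow> m' \<in> S \<Longrightarrow> \<gamma> (m + m') = \<gamma> m * \<gamma> m'"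
  by (auto simp: monoid_homs_def)

lemma monoid_homs_eqI:
  "\<gamma> \<in> monoid_homs S \<Longrightarrow> \<delta> \<in> monoid_homs S \<Longrightarrow> (\<And>m. m \<in> S \<Longrightarrow> \<gamma> m = \<delta> m) \<Longrightarrow> \<gamma> = \<delta>"
  by (auto simp: monoid_homs_def intro: extensionalityI)

lemma monoid_homs_scale:
  assumes "\<gamma> \<in> monoid_homs (dual_monoid N \<sigma>)" "m \<in> dual_monoid N \<sigma>"
  shows "\<gamma> (real k *\<^sub>R m) = \<gamma> m ^ k"
proof (induction k)
  case 0
  then show ?case using assms by (simp add: monoid_homs_zero)
next
  case (Suc k)
  have "real (Suc k) *\<^sub>R m = m + real k *\<^sub>R m" by (simp add: scaleR_add_left)
  then show ?case
    using Suc assms monoid_homs_add[OF assms(1) assms(2), of "real k *\<^sub>R m"]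
    by (simp add: dual_monoid_scale)
qed

lemma monoid_homs_unit:
  fixes m :: "'a::group_add"
  assumes "\<gamma> \<in> monoid_homs S" "m \<in> S" "- m \<in> S"
  shows "\<gamma> m \<noteq> 0"
proof -
  have "\<gamma> m * \<gamma> (- m) = 1"
    using monoid_homs_add[OF assms] monoid_homs_zero[OF assms(1)] by (metis add.right_inverse)
  then show ?thesis by auto
qed

lemma monoid_homs_restrict:
  assumes "\<tau> \<subseteq> \<sigma>" "\<delta> \<in> monoid_homs (dual_monoid N \<tau>)"
  shows "restrict \<delta> (dual_monoid N \<sigma>) \<in> monoid_homs (dual_monoid N \<sigma>)"
  using assms dual_monoid_antimono[OF assms(1), of N]
  by (auto simp: monoid_homs_def dual_monoid_zero dual_monoid_add subset_iff)

text \<open>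
The dual description of the face \<open>\<tau>\<close> of \<open>\<sigma>\<close> on which \<open>m\<close> vanishes: the dual monoid of \<open>\<tau>\<close> arises from that
of \<open>\<sigma>\<close> by inverting \<open>m\<close>, so that the chart of \<open>\<tau>\<close> will be the locus \<open>\<chi>\<^sup>m \<noteq> 0\<close> in the chart of \<open>\<sigma>\<close>.
\<close>

definition cuts_out :: "'a::real_inner set \<Rightarrow> 'a set \<Rightarrow> 'a set \<Rightarrow> 'a \<Rightarrow> bool" where
  "cuts_out N \<sigma> \<tau> m \<longleftrightarrow> m \<in> dual_monoid N \<sigma> \<and> \<tau> \<subseteq> \<sigma> \<and> (\<forall>x\<in>\<tau>. m \<bullet> x = 0) \<and>
     (\<forall>m'\<in>dual_monoid N \<tau>. \<exists>k. m' + real k *\<^sub>R m \<in> dual_monoid N \<sigma>)"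

lemma cuts_out_uminus: "cuts_out N \<sigma> \<tau> m \<Longrightarrow> m \<in> dual_monoid N \<tau> \<and> - m \<in> dual_monoid N \<tau>"
  by (auto simp: cuts_out_def dual_monoid_def dual_lattice_uminus)

lemma cuts_out_larger:
  assumes "cuts_out N \<sigma> \<tau> m" "m' + real k *\<^sub>R m \<in> dual_monoid N \<sigma>" "k \<le> l"
  shows "m' + real l *\<^sub>R m \<in> dual_monoid N \<sigma>"
proof -
  have "m' + real l *\<^sub>R m = (m' + real k *\<^sub>R m) + real (l - k) *\<^sub>R m"
    using assms(3) by (simp add: of_nat_diff scaleR_diff_left)
  then show ?thesis
    using assms dual_monoid_add[OF assms(2) dual_monoid_scale[of m N \<sigma> "l - k"]]
    by (simp only: cuts_out_def)
qed

lemma cuts_out_finite: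
  assumes "cuts_out N \<sigma> \<tau> m" "finite F" "F \<subseteq> dual_monoid N \<tau>"
  shows "\<exists>k. \<forall>m'\<in>F. \<forall>l\<ge>k. m' + real l *\<^sub>R m \<in> dual_monoid N \<sigma>"
  using assms(2,3)
proof (induction F rule: finite_induct)
  case (insert m' F)
  then obtain k where k: "\<forall>m'\<in>F. \<forall>l\<ge>k. m' + real l *\<^sub>R m \<in> dual_monoid N \<sigma>" by auto
  obtain k' where k': "m' + real k' *\<^sub>R m \<in> dual_monoid N \<sigma>"
    using assms(1) insert.prems by (auto simp: cuts_out_def)
  have "\<forall>l\<ge>max k k'. m' + real l *\<^sub>R m \<in> dual_monoid N \<sigma>"
    using cuts_out_larger[OF assms(1) k'] by auto
  then show ?case using k by (intro exI[of _ "max k k'"]) auto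
qed auto

lemma hom_extension_eq:
  assumes "cuts_out N \<sigma> \<tau> m" "\<delta> \<in> monoid_homs (dual_monoid N \<tau>)"
    "m' \<in> dual_monoid N \<tau>"
  shows "\<delta> (m' + real k *\<^sub>R m) = \<delta> m' * \<delta> m ^ k"
  using assms cuts_out_uminus[OF assms(1)]
  by (simp add: monoid_homs_add[OF assms(2)] dual_monoid_scale monoid_homs_scale[OF assms(2)])

lemma hom_extension_unique:
  assumes c: "cuts_out N \<sigma> \<tau> m"
    and d: "\<delta> \<in> monoid_homs (dual_monoid N \<tau>)" "\<delta>' \<in> monoid_homs (dual_monoid N \<tau>)"
    and eq: "\<And>m'. m' \<in> dual_monoid N \<sigma> \<Longrightarrow> \<delta> m' = \<delta>' m'"
  shows "\<delta> = \<delta>'"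
proof (rule monoid_homs_eqI[OF d])
  fix m' assume m': "m' \<in> dual_monoid N \<tau>"
  then obtain k where k: "m' + real k *\<^sub>R m \<in> dual_monoid N \<sigma>"
    using c by (auto simp: cuts_out_def)
  have "\<delta> m' * \<delta> m ^ k = \<delta>' m' * \<delta>' m ^ k"
    using eq[OF k] hom_extension_eq[OF c d(1) m', of k] hom_extension_eq[OF c d(2) m', of k] by simp
  moreover have "\<delta> m = \<delta>' m" using eq c by (auto simp: cuts_out_def)
  moreover have "\<delta> m \<noteq> 0"
    using monoid_homs_unit[OF d(1)] cuts_out_uminus[OF c] by auto
  ultimately show "\<delta> m' = \<delta>' m'" by simp
qed

text \<open>
The value at \<open>m'\<close> has to be \<open>\<gamma> (m' + k m) / \<gamma> m ^ k\<close>, where \<open>k\<close> moves \<open>m'\<close> into the dual monoid of \<open>\<sigma>\<close>;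
two choices of \<open>k\<close> differ by a power of \<open>\<gamma> m\<close>, which cancels.
\<close>

lemma hom_extension_exists:
  assumes c: "cuts_out N \<sigma> \<tau> m"
    and g: "\<gamma> \<in> monoid_homs (dual_monoid N \<sigma>)" and nz: "\<gamma> m \<noteq> 0"
  shows "\<exists>\<delta>\<in>monoid_homs (dual_monoid N \<tau>). \<forall>m'\<in>dual_monoid N \<sigma>. \<gamma> m' = \<delta> m'"
proof -
  have mS: "m \<in> dual_monoid N \<sigma>" and sub: "\<tau> \<subseteq> \<sigma>" using c by (auto simp: cuts_out_def)
  define k where "k m' = (SOME k. m' + real k *\<^sub>R m \<in> dual_monoid N \<sigma>)" for m'
  have k: "m' + real (k m') *\<^sub>R m \<in> dual_monoid N \<sigma>" if "m' \<in> dual_monoid N \<tau>" for m'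
    using c that someI_ex[of "\<lambda>k. m' + real k *\<^sub>R m \<in> dual_monoid N \<sigma>"]
    unfolding k_def cuts_out_def by blast
  define \<delta> where "\<delta> = (\<lambda>m'\<in>dual_monoid N \<tau>. \<gamma> (m' + real (k m') *\<^sub>R m) / \<gamma> m ^ k m')"
  have eq: "\<delta> m' = \<gamma> (m' + real l *\<^sub>R m) / \<gamma> m ^ l"
    if m': "m' \<in> dual_monoid N \<tau>" and l: "m' + real l *\<^sub>R m \<in> dual_monoid N \<sigma>" for m' l
  proof -
    have shift: "\<gamma> (m' + real (i + j) *\<^sub>R m) = \<gamma> (m' + real i *\<^sub>R m) * \<gamma> m ^ j"
      if "m' + real i *\<^sub>R m \<in> dual_monoid N \<sigma>" for i j
    proof -
      have "m' + real (i + j) *\<^sub>R m = (m' + real i *\<^sub>R m) + real j *\<^sub>R m"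
        by (simp add: scaleR_add_left)
      then show ?thesis
        using monoid_homs_add[OF g that dual_monoid_scale[OF mS]] monoid_homs_scale[OF g mS] by metis
    qed
    have "\<gamma> (m' + real (k m') *\<^sub>R m) * \<gamma> m ^ l = \<gamma> (m' + real l *\<^sub>R m) * \<gamma> m ^ k m'"
      using shift[OF k[OF m'], of l] shift[OF l, of "k m'"] by (simp add: add.commute)
    then show ?thesis using nz m' by (simp add: \<delta>_def field_simps)
  qed
  have "\<delta> \<in> monoid_homs (dual_monoid N \<tau>)"
    unfolding monoid_homs_def
  proof (intro CollectI conjI ballI)
    show "\<delta> \<in> extensional (dual_monoid N \<tau>)" by (simp add: \<delta>_def)
    show "\<delta> 0 = 1" using eq[of 0 0] monoid_homs_zero[OF g] by (simp add: dual_monoid_zero)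
    fix m1 m2 assume m: "m1 \<in> dual_monoid N \<tau>" "m2 \<in> dual_monoid N \<tau>"
    have s: "m1 + m2 + real (k m1 + k m2) *\<^sub>R m = (m1 + real (k m1) *\<^sub>R m) + (m2 + real (k m2) *\<^sub>R m)"
      by (simp add: scaleR_add_left)
    have i: "m1 + m2 + real (k m1 + k m2) *\<^sub>R m \<in> dual_monoid N \<sigma>"
      unfolding s using m k by (blast intro: dual_monoid_add)
    have "\<delta> (m1 + m2) = \<gamma> ((m1 + real (k m1) *\<^sub>R m) + (m2 + real (k m2) *\<^sub>R m)) / \<gamma> m ^ (k m1 + k m2)"
      using eq[OF dual_monoid_add[OF m] i] unfolding s .
    then show "\<delta> (m1 + m2) = \<delta> m1 * \<delta> m2"
      unfolding monoid_homs_add[OF g k[OF m(1)] k[OF m(2)]] eq[OF m(1) k[OF m(1)]] eq[OF m(2) k[OF m(2)]]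
      by (simp add: power_add)
  qed
  moreover have "\<gamma> m' = \<delta> m'" if "m' \<in> dual_monoid N \<sigma>" for m'
    using eq[of m' 0] that dual_monoid_antimono[OF sub, of N] by auto
  ultimately show ?thesis by blast
qed

section \<open>Gluing the charts of a toric variety\<close>

text \<open>
The part of the fan axioms, seen from the dual side, that the gluing of charts depends on. The
decomposition of the dual monoid of an intersection is what makes gluing transitive.
\<close>

locale toric_fan =
  fixes N :: "'a::real_inner set" and \<Sigma> :: "'a set set"
  assumes origin_cone: "{0} \<in> \<Sigma>"
    and origin_in: "\<sigma> \<in> \<Sigma> \<Longrightarrow> 0 \<in> \<sigma>"
    and inter_cone: "\<sigma> \<in> \<Sigma> \<Longrightarrow> \<tau> \<in> \<Sigma> \<Longrightarrow> \<sigma> \<inter> \<tau> \<in> \<Sigma>"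
    and subcone_cut_out: "\<sigma> \<in> \<Sigma> \<Longrightarrow> \<tau> \<in> \<Sigma> \<Longrightarrow> \<tau> \<subseteq> \<sigma> \<Longrightarrow> \<exists>m. cuts_out N \<sigma> \<tau> m"
    and dual_monoid_inter: "\<sigma> \<in> \<Sigma> \<Longrightarrow> \<tau> \<in> \<Sigma> \<Longrightarrow> \<rho> \<in> \<Sigma> \<Longrightarrow> \<tau> \<subseteq> \<sigma> \<Longrightarrow> \<rho> \<subseteq> \<sigma> \<Longrightarrow> m \<in> dual_monoid N (\<tau> \<inter> \<rho>)
      \<Longrightarrow> \<exists>m1\<in>dual_monoid N \<tau>. \<exists>m2\<in>dual_monoid N \<rho>. m = m1 + m2"
begin

abbreviation "S \<sigma> \<equiv> dual_monoid N \<sigma>"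
abbreviation "M \<equiv> dual_lattice N"
abbreviation "X \<equiv> toric_variety N \<Sigma>"
abbreviation "U \<equiv> toric_chart N \<Sigma>"
abbreviation "ch \<equiv> toric_character"
abbreviation "pairs \<equiv> SIGMA \<sigma>:\<Sigma>. monoid_homs (S \<sigma>)"

lemma glue_face:
  assumes "\<sigma> \<in> \<Sigma>" "\<tau> \<in> \<Sigma>" "\<tau> \<subseteq> \<sigma>" "\<delta> \<in> monoid_homs (S \<tau>)" "\<gamma> \<in> monoid_homs (S \<sigma>)"
    "\<And>m. m \<in> S \<sigma> \<Longrightarrow> \<gamma> m = \<delta> m"
  shows "((\<sigma>, \<gamma>), (\<tau>, \<delta>)) \<in> glue N \<Sigma>"
proof -
  have "\<sigma> \<inter> \<tau> = \<tau>" using assms by auto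
  then show ?thesis using assms by (auto simp: glue_def intro!: bexI[of _ \<delta>])
qed

lemma glue_same: "((\<sigma>, \<gamma>), (\<sigma>, \<delta>)) \<in> glue N \<Sigma> \<Longrightarrow> \<gamma> = \<delta>"
  by (auto simp: glue_def intro!: monoid_homs_eqI[of \<gamma> "S \<sigma>"])

lemma glue_refl: "\<sigma> \<in> \<Sigma> \<Longrightarrow> \<gamma> \<in> monoid_homs (S \<sigma>) \<Longrightarrow> ((\<sigma>, \<gamma>), (\<sigma>, \<gamma>)) \<in> glue N \<Sigma>"
  by (rule glue_face) auto

lemma glue_sym: "(a, b) \<in> glue N \<Sigma> \<Longrightarrow> (b, a) \<in> glue N \<Sigma>"
  by (cases a; cases b) (auto simp: glue_def Int_commute)

text \<open>
The middle homomorphism is nonzero at the elements that cut out the two intersections with its cone.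
It is then nonzero at an element that cuts out the triple intersection, because that element divides
a product of powers of the other two. So it extends to the triple intersection, and the extension
restricts to the two given ones by uniqueness.
\<close>

lemma glue_trans:
  assumes ab: "(a, b) \<in> glue N \<Sigma>" and bc: "(b, c) \<in> glue N \<Sigma>"
  shows "(a, c) \<in> glue N \<Sigma>"
proof -
  obtain \<sigma> \<gamma> \<tau> \<delta> \<rho> \<eta> where abc: "a = (\<sigma>, \<gamma>)" "b = (\<tau>, \<delta>)" "c = (\<rho>, \<eta>)"
    by (metis prod.exhaust)
  obtain \<epsilon> \<epsilon>' where S: "\<sigma> \<in> \<Sigma>" "\<tau> \<in> \<Sigma>" "\<rho> \<in> \<Sigma>"
    and h: "\<gamma> \<in> monoid_homs (S \<sigma>)" "\<delta> \<in> monoid_homs (S \<tau>)" "\<eta> \<in> monoid_homs (S \<rho>)"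
    and e: "\<epsilon> \<in> monoid_homs (S (\<sigma> \<inter> \<tau>))" "\<And>m. m \<in> S \<sigma> \<Longrightarrow> \<gamma> m = \<epsilon> m" "\<And>m. m \<in> S \<tau> \<Longrightarrow> \<delta> m = \<epsilon> m"
    and e': "\<epsilon>' \<in> monoid_homs (S (\<tau> \<inter> \<rho>))" "\<And>m. m \<in> S \<tau> \<Longrightarrow> \<delta> m = \<epsilon>' m" "\<And>m. m \<in> S \<rho> \<Longrightarrow> \<eta> m = \<epsilon>' m"
    using ab bc unfolding abc glue_def by auto
  have st: "\<sigma> \<inter> \<tau> \<in> \<Sigma>" "\<tau> \<inter> \<rho> \<in> \<Sigma>" using S inter_cone by auto
  obtain m1 where c1: "cuts_out N \<tau> (\<sigma> \<inter> \<tau>) m1" using subcone_cut_out[OF S(2) st(1)] by auto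
  obtain m2 where c2: "cuts_out N \<tau> (\<tau> \<inter> \<rho>) m2" using subcone_cut_out[OF S(2) st(2)] by auto
  define \<kappa> where "\<kappa> = \<sigma> \<inter> \<tau> \<inter> (\<tau> \<inter> \<rho>)"
  have k: "\<kappa> \<in> \<Sigma>" "\<kappa> \<subseteq> \<tau>" "\<kappa> \<subseteq> \<sigma> \<inter> \<tau>" "\<kappa> \<subseteq> \<tau> \<inter> \<rho>" "\<kappa> \<subseteq> \<sigma> \<inter> \<rho>"
    using st inter_cone by (auto simp: \<kappa>_def)
  obtain m where c: "cuts_out N \<tau> \<kappa> m" using subcone_cut_out[OF S(2) k(1,2)] by auto
  then have mS: "m \<in> S \<tau>" by (auto simp: cuts_out_def)
  obtain n1 n2 where n: "n1 \<in> S (\<sigma> \<inter> \<tau>)" "n2 \<in> S (\<tau> \<inter> \<rho>)" "- m = n1 + n2"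
    using dual_monoid_inter[OF S(2) st(1) st(2), of "- m"] cuts_out_uminus[OF c]
    by (auto simp: \<kappa>_def)
  obtain k1 k2 where kk: "n1 + real k1 *\<^sub>R m1 \<in> S \<tau>" "n2 + real k2 *\<^sub>R m2 \<in> S \<tau>"
    using c1 c2 n unfolding cuts_out_def by meson
  have m12: "m1 \<in> S \<tau>" "m2 \<in> S \<tau>" using c1 c2 by (auto simp: cuts_out_def)
  have nz: "\<delta> m1 \<noteq> 0" "\<delta> m2 \<noteq> 0"
    using e(3)[OF m12(1)] e'(2)[OF m12(2)] monoid_homs_unit[OF e(1), of m1]
      monoid_homs_unit[OF e'(1), of m2] cuts_out_uminus[OF c1] cuts_out_uminus[OF c2] by auto
  \<comment> \<open>A translate of \<open>- m\<close> by multiples of \<open>m1\<close> and \<open>m2\<close> lies in \<open>S \<tau>\<close>, so \<open>\<delta> m\<close> divides a unit.\<close>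
  have "m + ((n1 + real k1 *\<^sub>R m1) + (n2 + real k2 *\<^sub>R m2)) = real k1 *\<^sub>R m1 + real k2 *\<^sub>R m2"
  proof -
    have "m + (n1 + n2) = 0" using n(3) by (metis add.right_inverse)
    moreover have "m + ((n1 + real k1 *\<^sub>R m1) + (n2 + real k2 *\<^sub>R m2))
        = (m + (n1 + n2)) + (real k1 *\<^sub>R m1 + real k2 *\<^sub>R m2)" by (simp add: ac_simps)
    ultimately show ?thesis by (simp only: add_0_left)
  qed
  moreover have "\<delta> (m + ((n1 + real k1 *\<^sub>R m1) + (n2 + real k2 *\<^sub>R m2)))
      = \<delta> m * \<delta> ((n1 + real k1 *\<^sub>R m1) + (n2 + real k2 *\<^sub>R m2))"
    by (rule monoid_homs_add[OF h(2) mS dual_monoid_add[OF kk]])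
  moreover have "\<delta> (real k1 *\<^sub>R m1 + real k2 *\<^sub>R m2) = \<delta> m1 ^ k1 * \<delta> m2 ^ k2"
    using monoid_homs_add[OF h(2) dual_monoid_scale[OF m12(1)] dual_monoid_scale[OF m12(2)]]
    by (simp only: monoid_homs_scale[OF h(2) m12(1)] monoid_homs_scale[OF h(2) m12(2)])
  ultimately have "\<delta> m * \<delta> ((n1 + real k1 *\<^sub>R m1) + (n2 + real k2 *\<^sub>R m2)) = \<delta> m1 ^ k1 * \<delta> m2 ^ k2"
    by (simp only:)
  then have "\<delta> m \<noteq> 0" using nz by auto
  from hom_extension_exists[OF c h(2) this] obtain \<phi> where
    p: "\<phi> \<in> monoid_homs (S \<kappa>)" "\<And>m'. m' \<in> S \<tau> \<Longrightarrow> \<delta> m' = \<phi> m'" by auto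
  have r1: "restrict \<phi> (S (\<sigma> \<inter> \<tau>)) = \<epsilon>"
    using p(2) e(3) dual_monoid_antimono[of "\<sigma> \<inter> \<tau>" \<tau> N]
    by (intro hom_extension_unique[OF c1 monoid_homs_restrict[OF k(3) p(1)] e(1)]) auto
  have r2: "restrict \<phi> (S (\<tau> \<inter> \<rho>)) = \<epsilon>'"
    using p(2) e'(2) dual_monoid_antimono[of "\<tau> \<inter> \<rho>" \<tau> N]
    by (intro hom_extension_unique[OF c2 monoid_homs_restrict[OF k(4) p(1)] e'(1)]) auto
  have "\<gamma> m' = \<phi> m'" if "m' \<in> S \<sigma>" for m'
    using e(2)[OF that] r1 that dual_monoid_antimono[of "\<sigma> \<inter> \<tau>" \<sigma> N] by (auto simp: fun_eq_iff restrict_def split: if_splits)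
  moreover have "\<eta> m' = \<phi> m'" if "m' \<in> S \<rho>" for m'
    using e'(3)[OF that] r2 that dual_monoid_antimono[of "\<tau> \<inter> \<rho>" \<rho> N] by (auto simp: fun_eq_iff restrict_def split: if_splits)
  moreover have "S \<sigma> \<subseteq> S (\<sigma> \<inter> \<rho>)" "S \<rho> \<subseteq> S (\<sigma> \<inter> \<rho>)" by (auto intro!: dual_monoid_antimono)
  ultimately show ?thesis
    using S h monoid_homs_restrict[OF k(5) p(1)] unfolding abc glue_def
    by (auto intro!: bexI[of _ "restrict \<phi> (S (\<sigma> \<inter> \<rho>))"])
qed

lemma glue_equiv: "equiv pairs (glue N \<Sigma>)"
proof (rule equivI)
  show "glue N \<Sigma> \<subseteq> pairs \<times> pairs" by (auto simp: glue_def)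
  show "refl_on pairs (glue N \<Sigma>)"
    by (rule refl_onI) (auto intro: glue_refl)
  show "sym (glue N \<Sigma>)" using glue_sym by (auto intro: symI)
  show "trans (glue N \<Sigma>)" using glue_trans by (rule transI)
qed

definition point_class :: "'a set \<Rightarrow> ('a \<Rightarrow> complex) \<Rightarrow> 'a toric_point" where
  "point_class \<sigma> \<gamma> = glue N \<Sigma> `` {(\<sigma>, \<gamma>)}"

text \<open>
The coordinates of a point in the chart of \<open>\<sigma>\<close>.
\<close>

definition local_hom :: "'a set \<Rightarrow> 'a toric_point \<Rightarrow> 'a \<Rightarrow> complex" where
  "local_hom \<sigma> p = (THE \<gamma>. (\<sigma>, \<gamma>) \<in> p)"

lemma character_local_hom: "ch \<sigma> m p = local_hom \<sigma> p m"
  by (simp add: toric_character_def local_hom_def)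

lemma class_point: "\<sigma> \<in> \<Sigma> \<Longrightarrow> \<gamma> \<in> monoid_homs (S \<sigma>) \<Longrightarrow> point_class \<sigma> \<gamma> \<in> toric_points N \<Sigma>"
  unfolding point_class_def toric_points_def by (rule quotientI) auto

lemma class_self: "\<sigma> \<in> \<Sigma> \<Longrightarrow> \<gamma> \<in> monoid_homs (S \<sigma>) \<Longrightarrow> (\<sigma>, \<gamma>) \<in> point_class \<sigma> \<gamma>"
  unfolding point_class_def by (auto intro: glue_refl)

lemma point_eq_class:
  assumes "p \<in> toric_points N \<Sigma>" "(\<sigma>, \<gamma>) \<in> p"
  shows "\<sigma> \<in> \<Sigma>" "\<gamma> \<in> monoid_homs (S \<sigma>)" "p = point_class \<sigma> \<gamma>"
proof -
  obtain a where a: "a \<in> pairs" "p = glue N \<Sigma> `` {a}"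
    using assms(1) unfolding toric_points_def by (auto elim: quotientE)
  then have "(a, (\<sigma>, \<gamma>)) \<in> glue N \<Sigma>" using assms(2) by auto
  then show "p = point_class \<sigma> \<gamma>" unfolding point_class_def a(2) by (rule equiv_class_eq[OF glue_equiv])
  show "\<sigma> \<in> \<Sigma>" "\<gamma> \<in> monoid_homs (S \<sigma>)"
    using \<open>(a, (\<sigma>, \<gamma>)) \<in> glue N \<Sigma>\<close> by (auto simp: glue_def)
qed

lemma chart_iff:
  "p \<in> U \<sigma> \<longleftrightarrow> \<sigma> \<in> \<Sigma> \<and> local_hom \<sigma> p \<in> monoid_homs (S \<sigma>) \<and> p = point_class \<sigma> (local_hom \<sigma> p)"
proof
  assume "p \<in> U \<sigma>"
  then obtain \<gamma> where g: "p \<in> toric_points N \<Sigma>" "(\<sigma>, \<gamma>) \<in> p" by (auto simp: toric_chart_def)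
  note c = point_eq_class[OF g]
  have "local_hom \<sigma> p = \<gamma>"
    unfolding local_hom_def
  proof (rule the_equality)
    show "(\<sigma>, \<gamma>) \<in> p" by (rule g(2))
    fix \<delta> assume "(\<sigma>, \<delta>) \<in> p"
    then show "\<delta> = \<gamma>" using c(3) glue_same[of \<sigma> \<gamma> \<delta>] by (auto simp: point_class_def)
  qed
  then show "\<sigma> \<in> \<Sigma> \<and> local_hom \<sigma> p \<in> monoid_homs (S \<sigma>) \<and> p = point_class \<sigma> (local_hom \<sigma> p)"
    using c by auto
next
  assume a: "\<sigma> \<in> \<Sigma> \<and> local_hom \<sigma> p \<in> monoid_homs (S \<sigma>) \<and> p = point_class \<sigma> (local_hom \<sigma> p)"
  then show "p \<in> U \<sigma>"
    using class_point[of \<sigma> "local_hom \<sigma> p"] class_self[of \<sigma> "local_hom \<sigma> p"]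
    unfolding toric_chart_def by auto
qed

lemma chart_cone: "p \<in> U \<sigma> \<Longrightarrow> \<sigma> \<in> \<Sigma>"
  and local_hom_hom: "p \<in> U \<sigma> \<Longrightarrow> local_hom \<sigma> p \<in> monoid_homs (S \<sigma>)"
  and class_local_hom: "p \<in> U \<sigma> \<Longrightarrow> point_class \<sigma> (local_hom \<sigma> p) = p"
  by (drule chart_iff[THEN iffD1], elim conjE, (assumption | erule sym))+

lemma class_eq: "((\<sigma>, \<gamma>), (\<tau>, \<delta>)) \<in> glue N \<Sigma> \<Longrightarrow> point_class \<sigma> \<gamma> = point_class \<tau> \<delta>"
  unfolding point_class_def by (rule equiv_class_eq[OF glue_equiv])

lemma local_hom_class: "\<sigma> \<in> \<Sigma> \<Longrightarrow> \<gamma> \<in> monoid_homs (S \<sigma>) \<Longrightarrow> local_hom \<sigma> (point_class \<sigma> \<gamma>) = \<gamma>"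
  unfolding local_hom_def
  by (rule the_equality) (auto simp: point_class_def intro: glue_refl dest: glue_same)

lemma class_chart: "\<sigma> \<in> \<Sigma> \<Longrightarrow> \<gamma> \<in> monoid_homs (S \<sigma>) \<Longrightarrow> point_class \<sigma> \<gamma> \<in> U \<sigma>"
  by (simp add: chart_iff local_hom_class)

lemma local_hom_mem: "p \<in> U \<sigma> \<Longrightarrow> (\<sigma>, local_hom \<sigma> p) \<in> p"
  using class_self[OF chart_cone local_hom_hom] class_local_hom by fastforce

lemma points_toric_variety: "points X = toric_points N \<Sigma>"
proof -
  have "p \<in> toric_points N \<Sigma> \<Longrightarrow> \<exists>\<sigma>\<in>\<Sigma>. p \<in> U \<sigma>" for p
    unfolding toric_points_def
    by (erule quotientE) (auto intro: class_chart[unfolded point_class_def])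
  then show ?thesis unfolding points_def toric_variety_def
    by (auto simp: toric_chart_def)
qed

lemma chart_points: "U \<sigma> \<subseteq> points X"
  unfolding points_toric_variety by (auto simp: toric_chart_def)

lemma glue_local_homs:
  assumes "p \<in> U \<sigma>" "p \<in> U \<tau>"
  shows "((\<sigma>, local_hom \<sigma> p), (\<tau>, local_hom \<tau> p)) \<in> glue N \<Sigma>"
  using local_hom_mem[OF assms(2)] class_local_hom[OF assms(1)]
  unfolding point_class_def by (metis Image_singleton_iff)

lemma character_consistent:
  assumes "p \<in> U \<sigma>" "p \<in> U \<tau>" "m \<in> S \<sigma>" "m \<in> S \<tau>"
  shows "ch \<sigma> m p = ch \<tau> m p"
  using glue_local_homs[OF assms(1,2)] assms(3,4) by (auto simp: character_local_hom glue_def)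

lemma chart_mono:
  assumes "\<sigma> \<in> \<Sigma>" "\<tau> \<in> \<Sigma>" "\<tau> \<subseteq> \<sigma>"
  shows "U \<tau> \<subseteq> U \<sigma>"
proof
  fix p assume p: "p \<in> U \<tau>"
  let ?d = "local_hom \<tau> p"
  note d = local_hom_hom[OF p] class_local_hom[OF p]
  let ?g = "restrict ?d (S \<sigma>)"
  have g: "?g \<in> monoid_homs (S \<sigma>)" by (rule monoid_homs_restrict[OF assms(3) d(1)])
  have "((\<sigma>, ?g), (\<tau>, ?d)) \<in> glue N \<Sigma>" by (rule glue_face[OF assms d(1) g]) simp
  then have "point_class \<sigma> ?g = point_class \<tau> ?d" by (rule class_eq)
  then show "p \<in> U \<sigma>" using class_chart[OF assms(1) g] d(2) by simp
qed

lemma chart_inter: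
  assumes "\<sigma> \<in> \<Sigma>" "\<tau> \<in> \<Sigma>"
  shows "U \<sigma> \<inter> U \<tau> = U (\<sigma> \<inter> \<tau>)"
proof
  show "U (\<sigma> \<inter> \<tau>) \<subseteq> U \<sigma> \<inter> U \<tau>"
    using assms chart_mono[OF assms(1) inter_cone[OF assms]] chart_mono[OF assms(2) inter_cone[OF assms]]
    by auto
  show "U \<sigma> \<inter> U \<tau> \<subseteq> U (\<sigma> \<inter> \<tau>)"
  proof
    fix p assume p: "p \<in> U \<sigma> \<inter> U \<tau>"
    then obtain \<epsilon> where e: "\<epsilon> \<in> monoid_homs (S (\<sigma> \<inter> \<tau>))"
      "\<And>m. m \<in> S \<sigma> \<Longrightarrow> local_hom \<sigma> p m = \<epsilon> m"
      using glue_local_homs[of p \<sigma> \<tau>] by (auto simp: glue_def)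
    have g: "local_hom \<sigma> p \<in> monoid_homs (S \<sigma>)" "point_class \<sigma> (local_hom \<sigma> p) = p"
      using p local_hom_hom class_local_hom by blast+
    have "((\<sigma>, local_hom \<sigma> p), (\<sigma> \<inter> \<tau>, \<epsilon>)) \<in> glue N \<Sigma>"
      using e by (intro glue_face[OF assms(1) inter_cone[OF assms] _ e(1) g(1)]) auto
    then have "p = point_class (\<sigma> \<inter> \<tau>) \<epsilon>" using g(2) class_eq by metis
    then show "p \<in> U (\<sigma> \<inter> \<tau>)" using class_chart[OF inter_cone[OF assms] e(1)] by simp
  qed
qed

lemma character_zero: "p \<in> U \<sigma> \<Longrightarrow> ch \<sigma> 0 p = 1"
  unfolding character_local_hom by (rule monoid_homs_zero[OF local_hom_hom])

lemma character_add:
  "p \<in> U \<sigma> \<Longrightarrow> m \<in> S \<sigma> \<Longrightarrow> m' \<in> S \<sigma> \<Longrightarrow> ch \<sigma> (m + m') p = ch \<sigma> m p * ch \<sigma> m' p"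
  unfolding character_local_hom by (rule monoid_homs_add[OF local_hom_hom])

lemma character_scale:
  "p \<in> U \<sigma> \<Longrightarrow> m \<in> S \<sigma> \<Longrightarrow> ch \<sigma> (real k *\<^sub>R m) p = ch \<sigma> m p ^ k"
  unfolding character_local_hom by (rule monoid_homs_scale[OF local_hom_hom])

lemma character_unit: "p \<in> U \<sigma> \<Longrightarrow> m \<in> S \<sigma> \<Longrightarrow> - m \<in> S \<sigma> \<Longrightarrow> ch \<sigma> m p \<noteq> 0"
  unfolding character_local_hom by (rule monoid_homs_unit[OF local_hom_hom])

text \<open>
The homomorphism of a point extends to the dual monoid of \<open>\<tau>\<close> exactly if \<open>m\<close> can be inverted.
\<close>

lemma chart_principal:
  assumes "\<sigma> \<in> \<Sigma>" "\<tau> \<in> \<Sigma>" "cuts_out N \<sigma> \<tau> m" "p \<in> U \<sigma>"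
  shows "p \<in> U \<tau> \<longleftrightarrow> ch \<sigma> m p \<noteq> 0"
proof
  have m: "m \<in> S \<sigma>" "\<tau> \<subseteq> \<sigma>" using assms(3) by (auto simp: cuts_out_def)
  note mt = cuts_out_uminus[OF assms(3)]
  show "p \<in> U \<tau> \<Longrightarrow> ch \<sigma> m p \<noteq> 0"
    using character_consistent[OF assms(4) _ m(1)] character_unit mt by metis
  assume nz: "ch \<sigma> m p \<noteq> 0"
  note g = local_hom_hom[OF assms(4)] class_local_hom[OF assms(4)]
  obtain \<delta> where d: "\<delta> \<in> monoid_homs (S \<tau>)" "\<And>m'. m' \<in> S \<sigma> \<Longrightarrow> local_hom \<sigma> p m' = \<delta> m'"
    using hom_extension_exists[OF assms(3) g(1)] nz by (auto simp: character_local_hom)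
  have "((\<sigma>, local_hom \<sigma> p), (\<tau>, \<delta>)) \<in> glue N \<Sigma>"
    using d by (intro glue_face[OF assms(1,2) m(2) d(1) g(1)]) auto
  then have "p = point_class \<tau> \<delta>" using g(2) class_eq by metis
  then show "p \<in> U \<tau>" using class_chart[OF assms(2) d(1)] by simp
qed

end

section \<open>Laurent polynomials and density of the torus\<close>

text \<open>
Finitely many hyperplanes do not cover the space: if \<open>v\<close> avoids those of \<open>D\<close>, then \<open>v + r d\<close> avoids the
one orthogonal to \<open>d\<close> as well, for all but finitely many \<open>r\<close>.
\<close>

lemma generic_vector:
  fixes D :: "'a::real_inner set"
  assumes "finite D" "0 \<notin> D"
  shows "\<exists>v. \<forall>d\<in>D. d \<bullet> v \<noteq> 0"
  using assms
proof (induction D rule: finite_induct)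
  case (insert d D)
  then obtain v where v: "\<forall>x\<in>D. x \<bullet> v \<noteq> 0" by auto
  have "finite ((\<lambda>x. - (x \<bullet> v) / (x \<bullet> d)) ` insert d D)" using insert.hyps by simp
  then obtain r where r: "r \<notin> (\<lambda>x. - (x \<bullet> v) / (x \<bullet> d)) ` insert d D" "r \<noteq> 0"
    using ex_new_if_finite[OF infinite_UNIV_char_0, of "insert 0 ((\<lambda>x. - (x \<bullet> v) / (x \<bullet> d)) ` insert d D)"]
    by auto
  have "x \<bullet> (v + r *\<^sub>R d) \<noteq> 0" if "x \<in> insert d D" for x
  proof (cases "x \<bullet> d = 0")
    case True
    then have "x \<in> D" using that insert.prems by auto
    then show ?thesis using v True by (simp add: inner_add_right)
  next
    case False
    have "r \<noteq> - (x \<bullet> v) / (x \<bullet> d)" using r that by blast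
    then show ?thesis using False by (simp add: inner_add_right field_simps)
  qed
  then show ?case by blast
qed auto

text \<open>
The term with the largest exponent dominates.
\<close>

lemma exp_sum_eventually_nonzero:
  fixes c :: "'m \<Rightarrow> complex" and a :: "'m \<Rightarrow> real"
  assumes "finite F" "inj_on a F" "\<exists>m\<in>F. c m \<noteq> 0"
  shows "\<forall>\<^sub>F s in at_top. (\<Sum>m\<in>F. c m * exp (of_real (s * a m))) \<noteq> 0"
proof -
  define G where "G = {m\<in>F. c m \<noteq> 0}"
  have G: "finite G" "G \<noteq> {}" using assms by (auto simp: G_def)
  obtain m0 where m0: "m0 \<in> G" "\<And>m. m \<in> G \<Longrightarrow> a m \<le> a m0"
  proof -
    have "Max (a ` G) \<in> a ` G" using G by auto
    then obtain m0 where m0: "m0 \<in> G" "Max (a ` G) = a m0" by auto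
    have "a m \<le> a m0" if "m \<in> G" for m using Max_ge[of "a ` G" "a m"] G that m0 by auto
    then show ?thesis using that m0 by blast
  qed
  have less: "a m < a m0" if "m \<in> G" "m \<noteq> m0" for m
    using m0 that assms(2) by (force simp: G_def inj_on_def order.order_iff_strict)
  have lim: "((\<lambda>s. \<Sum>m\<in>G. c m * of_real (exp (s * (a m - a m0)))) \<longlongrightarrow>
      (\<Sum>m\<in>G. if m = m0 then c m0 else 0)) at_top"
  proof (rule tendsto_sum)
    fix m assume m: "m \<in> G"
    show "((\<lambda>s. c m * of_real (exp (s * (a m - a m0)))) \<longlongrightarrow> (if m = m0 then c m0 else 0)) at_top"
    proof (cases "m = m0")
      case False
      have "filterlim (\<lambda>s. s * (a m - a m0)) at_bot at_top"
        using less[OF m False]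
        by (subst mult.commute, intro filterlim_tendsto_neg_mult_at_bot[OF tendsto_const]) (auto intro: filterlim_ident)
      then have "((\<lambda>s. exp (s * (a m - a m0))) \<longlongrightarrow> 0) at_top"
        by (rule filterlim_compose[OF exp_at_bot])
      then have "((\<lambda>s. c m * of_real (exp (s * (a m - a m0)))) \<longlongrightarrow> c m * of_real 0) at_top"
        by (intro tendsto_intros)
      then show ?thesis using False by simp
    qed auto
  qed
  have "(\<Sum>m\<in>G. if m = m0 then c m0 else 0) \<noteq> 0"
    using G m0 by (simp add: G_def)
  from tendsto_imp_eventually_ne[OF lim this]
  show ?thesis
  proof (rule eventually_mono)
    fix s :: real
    assume nz: "(\<Sum>m\<in>G. c m * of_real (exp (s * (a m - a m0)))) \<noteq> 0"
    have "(\<Sum>m\<in>F. c m * exp (of_real (s * a m))) = (\<Sum>m\<in>G. c m * exp (of_real (s * a m)))"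
      using assms(1) by (intro sum.mono_neutral_right) (auto simp: G_def)
    also have "\<dots> = (\<Sum>m\<in>G. c m * of_real (exp (s * (a m - a m0)))) * of_real (exp (s * a m0))"
      unfolding sum_distrib_right
    proof (rule sum.cong[OF refl])
      fix m
      have e: "exp (s * a m) = exp (s * (a m - a m0)) * exp (s * a m0)"
        unfolding exp_add[symmetric] by (simp add: algebra_simps)
      show "c m * exp (of_real (s * a m)) = c m * of_real (exp (s * (a m - a m0))) * of_real (exp (s * a m0))"
        unfolding exp_of_real e by simp
    qed
    finally show "(\<Sum>m\<in>F. c m * exp (of_real (s * a m))) \<noteq> 0" using nz by simp
  qed
qed

context toric_fan begin

text \<open>
The regular functions on the chart of \<open>\<sigma>\<close>, up to their values off the chart. Products of characters
are characters on the chart only, so the functions in \<open>toric_coordinate_ring N \<sigma>\<close> need not be closed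
under multiplication.
\<close>

definition laurent :: "'a set \<Rightarrow> ('a toric_point \<Rightarrow> complex) \<Rightarrow> bool" where
  "laurent \<sigma> f \<longleftrightarrow> (\<exists>F c. finite F \<and> F \<subseteq> S \<sigma> \<and> (\<forall>p\<in>U \<sigma>. f p = (\<Sum>m\<in>F. c m * ch \<sigma> m p)))"

lemma laurent_cong: "laurent \<sigma> f \<Longrightarrow> (\<And>p. p \<in> U \<sigma> \<Longrightarrow> g p = f p) \<Longrightarrow> laurent \<sigma> g"
  unfolding laurent_def by fastforce

lemma laurent_monomial: "m \<in> S \<sigma> \<Longrightarrow> laurent \<sigma> (\<lambda>p. c * ch \<sigma> m p)"
  unfolding laurent_def by (intro exI[of _ "{m}"] exI[of _ "\<lambda>_. c"]) auto

lemma laurent_character: "m \<in> S \<sigma> \<Longrightarrow> laurent \<sigma> (ch \<sigma> m)"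
  using laurent_monomial[of m \<sigma> 1] by simp

lemma laurent_const: "laurent \<sigma> (\<lambda>_. c)"
  by (rule laurent_cong[OF laurent_monomial[OF dual_monoid_zero, of _ c]]) (simp add: character_zero)

lemma laurent_add:
  assumes "laurent \<sigma> f" "laurent \<sigma> g"
  shows "laurent \<sigma> (\<lambda>p. f p + g p)"
proof -
  obtain F c where f: "finite F" "F \<subseteq> S \<sigma>" "\<And>p. p \<in> U \<sigma> \<Longrightarrow> f p = (\<Sum>m\<in>F. c m * ch \<sigma> m p)"
    using assms(1) by (auto simp: laurent_def)
  obtain G d where g: "finite G" "G \<subseteq> S \<sigma>" "\<And>p. p \<in> U \<sigma> \<Longrightarrow> g p = (\<Sum>m\<in>G. d m * ch \<sigma> m p)"
    using assms(2) by (auto simp: laurent_def)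
  define b where "b m = (if m \<in> F then c m else 0) + (if m \<in> G then d m else 0)" for m
  have "f p + g p = (\<Sum>m\<in>F \<union> G. b m * ch \<sigma> m p)" if "p \<in> U \<sigma>" for p
  proof -
    have "(\<Sum>m\<in>F. c m * ch \<sigma> m p) = (\<Sum>m\<in>F \<union> G. (if m \<in> F then c m else 0) * ch \<sigma> m p)"
      using f(1) g(1) by (intro sum.mono_neutral_cong_left) auto
    moreover have "(\<Sum>m\<in>G. d m * ch \<sigma> m p) = (\<Sum>m\<in>F \<union> G. (if m \<in> G then d m else 0) * ch \<sigma> m p)"
      using f(1) g(1) by (intro sum.mono_neutral_cong_left) auto
    ultimately show ?thesis
      using that by (simp add: f(3) g(3) b_def distrib_right sum.distrib)
  qed
  then show ?thesis
    unfolding laurent_def using f(1,2) g(1,2) by (intro exI[of _ "F \<union> G"] exI[of _ b]) auto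
qed

lemma laurent_sum:
  "finite I \<Longrightarrow> (\<And>i. i \<in> I \<Longrightarrow> laurent \<sigma> (f i)) \<Longrightarrow> laurent \<sigma> (\<lambda>p. \<Sum>i\<in>I. f i p)"
  by (induction I rule: finite_induct) (auto intro: laurent_add laurent_const)

lemma laurent_mult:
  assumes "laurent \<sigma> f" "laurent \<sigma> g"
  shows "laurent \<sigma> (\<lambda>p. f p * g p)"
proof -
  obtain F c where f: "finite F" "F \<subseteq> S \<sigma>" "\<And>p. p \<in> U \<sigma> \<Longrightarrow> f p = (\<Sum>m\<in>F. c m * ch \<sigma> m p)"
    using assms(1) by (auto simp: laurent_def)
  obtain G d where g: "finite G" "G \<subseteq> S \<sigma>" "\<And>p. p \<in> U \<sigma> \<Longrightarrow> g p = (\<Sum>m\<in>G. d m * ch \<sigma> m p)"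
    using assms(2) by (auto simp: laurent_def)
  have "laurent \<sigma> (\<lambda>p. \<Sum>m\<in>F. \<Sum>m'\<in>G. (c m * ch \<sigma> m p) * (d m' * ch \<sigma> m' p))"
  proof (intro laurent_sum f(1) g(1))
    fix m m' assume m: "m \<in> F" "m' \<in> G"
    then have mm: "m \<in> S \<sigma>" "m' \<in> S \<sigma>" using f g by auto
    show "laurent \<sigma> (\<lambda>p. (c m * ch \<sigma> m p) * (d m' * ch \<sigma> m' p))"
      by (rule laurent_cong[OF laurent_monomial[OF dual_monoid_add[OF mm], of "c m * d m'"]])
        (simp add: character_add[OF _ mm])
  qed
  then show ?thesis
    by (rule laurent_cong) (simp add: f(3) g(3) sum_product)
qed

lemma coordinate_ring_laurent: "f \<in> toric_coordinate_ring N \<sigma> \<Longrightarrow> laurent \<sigma> f"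
  unfolding toric_coordinate_ring_def laurent_def by auto

lemma laurent_coordinate_ring:
  "laurent \<sigma> f \<Longrightarrow> \<exists>g\<in>toric_coordinate_ring N \<sigma>. \<forall>p\<in>U \<sigma>. g p = f p"
  unfolding toric_coordinate_ring_def laurent_def by fastforce

lemma zopen_iff:
  "zopen X W \<longleftrightarrow> W \<subseteq> points X \<and>
     (\<forall>\<sigma>\<in>\<Sigma>. \<forall>x\<in>W \<inter> U \<sigma>. \<exists>h. laurent \<sigma> h \<and> h x \<noteq> 0 \<and> {y\<in>U \<sigma>. h y \<noteq> 0} \<subseteq> W)"
proof -
  have "(\<exists>h\<in>toric_coordinate_ring N \<sigma>. h x \<noteq> 0 \<and> {y\<in>U \<sigma>. h y \<noteq> 0} \<subseteq> W) \<longleftrightarrow>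
      (\<exists>h. laurent \<sigma> h \<and> h x \<noteq> 0 \<and> {y\<in>U \<sigma>. h y \<noteq> 0} \<subseteq> W)" if "x \<in> U \<sigma>" for \<sigma> x
  proof
    assume "\<exists>h. laurent \<sigma> h \<and> h x \<noteq> 0 \<and> {y\<in>U \<sigma>. h y \<noteq> 0} \<subseteq> W"
    then obtain h where h: "laurent \<sigma> h" "h x \<noteq> 0" "{y\<in>U \<sigma>. h y \<noteq> 0} \<subseteq> W" by auto
    obtain g where "g \<in> toric_coordinate_ring N \<sigma>" "\<forall>p\<in>U \<sigma>. g p = h p"
      using laurent_coordinate_ring[OF h(1)] by auto
    then show "\<exists>h\<in>toric_coordinate_ring N \<sigma>. h x \<noteq> 0 \<and> {y\<in>U \<sigma>. h y \<noteq> 0} \<subseteq> W"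
      using h that by (intro bexI[of _ g]) auto
  qed (auto dest: coordinate_ring_laurent)
  then show ?thesis unfolding zopen_def toric_variety_def by auto
qed

lemma regular_on_iff:
  "regular_on X W f \<longleftrightarrow> (\<forall>x\<in>W. \<exists>\<sigma>\<in>\<Sigma>. x \<in> U \<sigma> \<and>
     (\<exists>g h. laurent \<sigma> g \<and> laurent \<sigma> h \<and> h x \<noteq> 0 \<and> (\<forall>y\<in>W \<inter> U \<sigma>. h y \<noteq> 0 \<longrightarrow> f y = g y / h y)))"
proof -
  have "(\<exists>g\<in>toric_coordinate_ring N \<sigma>. \<exists>h\<in>toric_coordinate_ring N \<sigma>. h x \<noteq> 0 \<and>
        (\<forall>y\<in>W \<inter> U \<sigma>. h y \<noteq> 0 \<longrightarrow> f y = g y / h y)) \<longleftrightarrow>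
      (\<exists>g h. laurent \<sigma> g \<and> laurent \<sigma> h \<and> h x \<noteq> 0 \<and> (\<forall>y\<in>W \<inter> U \<sigma>. h y \<noteq> 0 \<longrightarrow> f y = g y / h y))"
    if "x \<in> U \<sigma>" for \<sigma> x
  proof
    assume "\<exists>g h. laurent \<sigma> g \<and> laurent \<sigma> h \<and> h x \<noteq> 0 \<and> (\<forall>y\<in>W \<inter> U \<sigma>. h y \<noteq> 0 \<longrightarrow> f y = g y / h y)"
    then obtain g h where h: "laurent \<sigma> g" "laurent \<sigma> h" "h x \<noteq> 0"
      "\<forall>y\<in>W \<inter> U \<sigma>. h y \<noteq> 0 \<longrightarrow> f y = g y / h y" by auto
    obtain g' where "g' \<in> toric_coordinate_ring N \<sigma>" "\<forall>p\<in>U \<sigma>. g' p = g p"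
      using laurent_coordinate_ring[OF h(1)] by auto
    moreover obtain h' where "h' \<in> toric_coordinate_ring N \<sigma>" "\<forall>p\<in>U \<sigma>. h' p = h p"
      using laurent_coordinate_ring[OF h(2)] by auto
    ultimately show "\<exists>g\<in>toric_coordinate_ring N \<sigma>. \<exists>h\<in>toric_coordinate_ring N \<sigma>. h x \<noteq> 0 \<and>
        (\<forall>y\<in>W \<inter> U \<sigma>. h y \<noteq> 0 \<longrightarrow> f y = g y / h y)"
      using h that by (intro bexI[of _ g'] bexI[of _ h']) auto
  next
    assume "\<exists>g\<in>toric_coordinate_ring N \<sigma>. \<exists>h\<in>toric_coordinate_ring N \<sigma>. h x \<noteq> 0 \<and>
        (\<forall>y\<in>W \<inter> U \<sigma>. h y \<noteq> 0 \<longrightarrow> f y = g y / h y)"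
    then show "\<exists>g h. laurent \<sigma> g \<and> laurent \<sigma> h \<and> h x \<noteq> 0 \<and> (\<forall>y\<in>W \<inter> U \<sigma>. h y \<noteq> 0 \<longrightarrow> f y = g y / h y)"
      by (meson coordinate_ring_laurent)
  qed
  then show ?thesis unfolding regular_on_def toric_variety_def by (simp add: conj_commute cong: conj_cong)
qed

lemma laurent_mono:
  assumes "\<sigma> \<in> \<Sigma>" "\<tau> \<in> \<Sigma>" "\<tau> \<subseteq> \<sigma>" "laurent \<sigma> f"
  shows "laurent \<tau> f"
proof -
  obtain F c where f: "finite F" "F \<subseteq> S \<sigma>" "\<And>p. p \<in> U \<sigma> \<Longrightarrow> f p = (\<Sum>m\<in>F. c m * ch \<sigma> m p)"
    using assms(4) by (auto simp: laurent_def)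
  have sub: "S \<sigma> \<subseteq> S \<tau>" by (rule dual_monoid_antimono[OF assms(3)])
  have "f p = (\<Sum>m\<in>F. c m * ch \<tau> m p)" if "p \<in> U \<tau>" for p
  proof -
    have "p \<in> U \<sigma>" using that chart_mono[OF assms(1-3)] by auto
    moreover from this have "ch \<sigma> m p = ch \<tau> m p" if "m \<in> F" for m
      using that \<open>p \<in> U \<tau>\<close> f(2) sub by (intro character_consistent) auto
    ultimately show ?thesis by (simp add: f(3))
  qed
  then show ?thesis unfolding laurent_def using f(1,2) sub by blast
qed

lemma laurent_clear_denominator:
  assumes "\<sigma> \<in> \<Sigma>" "\<tau> \<in> \<Sigma>" "cuts_out N \<sigma> \<tau> m" "laurent \<tau> f"
  shows "\<exists>k. \<forall>l\<ge>k. \<exists>g. laurent \<sigma> g \<and> (\<forall>p\<in>U \<tau>. g p = f p * ch \<sigma> m p ^ l)"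
proof -
  obtain F c where f: "finite F" "F \<subseteq> S \<tau>" "\<And>p. p \<in> U \<tau> \<Longrightarrow> f p = (\<Sum>m\<in>F. c m * ch \<tau> m p)"
    using assms(4) by (auto simp: laurent_def)
  have m: "m \<in> S \<sigma>" "m \<in> S \<tau>" "\<tau> \<subseteq> \<sigma>"
    using assms(3) cuts_out_uminus[OF assms(3)] by (auto simp: cuts_out_def)
  obtain k where k: "\<And>m' l. m' \<in> F \<Longrightarrow> l \<ge> k \<Longrightarrow> m' + real l *\<^sub>R m \<in> S \<sigma>"
    using cuts_out_finite[OF assms(3) f(1,2)] by auto
  have "\<exists>g. laurent \<sigma> g \<and> (\<forall>p\<in>U \<tau>. g p = f p * ch \<sigma> m p ^ l)" if l: "l \<ge> k" for l
  proof (intro exI conjI ballI)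
    show "laurent \<sigma> (\<lambda>p. \<Sum>m'\<in>F. c m' * ch \<sigma> (m' + real l *\<^sub>R m) p)"
      using k l f(1) by (intro laurent_sum laurent_monomial) auto
    fix p assume p: "p \<in> U \<tau>"
    then have p': "p \<in> U \<sigma>" using chart_mono[OF assms(1,2) m(3)] by auto
    have "ch \<sigma> (m' + real l *\<^sub>R m) p = ch \<tau> m' p * ch \<sigma> m p ^ l" if "m' \<in> F" for m'
    proof -
      have "m' \<in> S \<tau>" "real l *\<^sub>R m \<in> S \<tau>" using that f(2) m dual_monoid_scale by auto
      then show ?thesis
        using character_consistent[OF p' p k[OF that l]] dual_monoid_antimono[OF m(3), of N] k[OF that l]
          character_add[OF p \<open>m' \<in> S \<tau>\<close> \<open>real l *\<^sub>R m \<in> S \<tau>\<close>] character_scale[OF p m(2)]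
          character_consistent[OF p' p m(1,2)] by auto
    qed
    then show "(\<Sum>m'\<in>F. c m' * ch \<sigma> (m' + real l *\<^sub>R m) p) = f p * ch \<sigma> m p ^ l"
      by (simp add: f(3)[OF p] sum_distrib_right mult.assoc)
  qed
  then show ?thesis by blast
qed

text \<open>
A high power of the character that cuts out \<open>\<tau>\<close> clears the denominators of \<open>g\<close> and \<open>h\<close>; one further
factor makes the new denominator vanish off the chart of \<open>\<tau>\<close>.
\<close>

lemma laurent_extend_fraction:
  assumes "\<sigma> \<in> \<Sigma>" "\<tau> \<in> \<Sigma>" "\<tau> \<subseteq> \<sigma>" "laurent \<tau> g" "laurent \<tau> h"
  obtains g' h' u where "laurent \<sigma> g'" "laurent \<sigma> h'" "\<And>p. p \<in> U \<tau> \<Longrightarrow> u p \<noteq> 0"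
    "\<And>p. p \<in> U \<tau> \<Longrightarrow> g' p = g p * u p" "\<And>p. p \<in> U \<tau> \<Longrightarrow> h' p = h p * u p"
    "\<And>p. p \<in> U \<sigma> \<Longrightarrow> p \<notin> U \<tau> \<Longrightarrow> h' p = (0::complex)"
proof -
  obtain m where m: "cuts_out N \<sigma> \<tau> m" using subcone_cut_out[OF assms(1-3)] by auto
  have mS: "m \<in> S \<sigma>" using m by (auto simp: cuts_out_def)
  obtain k where k: "\<And>l. l \<ge> k \<Longrightarrow> \<exists>g'. laurent \<sigma> g' \<and> (\<forall>p\<in>U \<tau>. g' p = g p * ch \<sigma> m p ^ l)"
    using laurent_clear_denominator[OF assms(1,2) m assms(4)] by auto
  obtain k' where k': "\<And>l. l \<ge> k' \<Longrightarrow> \<exists>g'. laurent \<sigma> g' \<and> (\<forall>p\<in>U \<tau>. g' p = h p * ch \<sigma> m p ^ l)"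
    using laurent_clear_denominator[OF assms(1,2) m assms(5)] by auto
  obtain g' where g': "laurent \<sigma> g'" "\<And>p. p \<in> U \<tau> \<Longrightarrow> g' p = g p * ch \<sigma> m p ^ max k k'"
    using k[of "max k k'"] by auto
  obtain h' where h': "laurent \<sigma> h'" "\<And>p. p \<in> U \<tau> \<Longrightarrow> h' p = h p * ch \<sigma> m p ^ max k k'"
    using k'[of "max k k'"] by auto
  note ch = chart_principal[OF assms(1,2) m]
  have sub: "p \<in> U \<sigma>" if "p \<in> U \<tau>" for p using that chart_mono[OF assms(1-3)] by auto
  show ?thesis
  proof (rule that[of "\<lambda>p. g' p * ch \<sigma> m p" "\<lambda>p. h' p * ch \<sigma> m p" "\<lambda>p. ch \<sigma> m p ^ max k k' * ch \<sigma> m p"])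
    show "laurent \<sigma> (\<lambda>p. g' p * ch \<sigma> m p)" "laurent \<sigma> (\<lambda>p. h' p * ch \<sigma> m p)"
      by (intro laurent_mult laurent_character mS g'(1) h'(1))+
  qed (use g'(2) h'(2) ch sub in auto)
qed

text \<open>
The intersection with another chart is principal in both charts, so openness in one of them implies
openness in the other.
\<close>

lemma zopen_in_chart:
  assumes "\<sigma> \<in> \<Sigma>" "V \<subseteq> U \<sigma>"
  shows "zopen X V \<longleftrightarrow> (\<forall>x\<in>V. \<exists>h. laurent \<sigma> h \<and> h x \<noteq> 0 \<and> {y\<in>U \<sigma>. h y \<noteq> 0} \<subseteq> V)"
proof
  assume "zopen X V"
  then show "\<forall>x\<in>V. \<exists>h. laurent \<sigma> h \<and> h x \<noteq> 0 \<and> {y\<in>U \<sigma>. h y \<noteq> 0} \<subseteq> V"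
    unfolding zopen_iff using assms by blast
next
  assume r: "\<forall>x\<in>V. \<exists>h. laurent \<sigma> h \<and> h x \<noteq> 0 \<and> {y\<in>U \<sigma>. h y \<noteq> 0} \<subseteq> V"
  show "zopen X V"
    unfolding zopen_iff
  proof (intro conjI ballI)
    show "V \<subseteq> points X" using assms(2) chart_points by blast
    fix \<tau> x assume t: "\<tau> \<in> \<Sigma>" and x: "x \<in> V \<inter> U \<tau>"
    note st = inter_cone[OF assms(1) t]
    obtain h where h: "laurent \<sigma> h" "h x \<noteq> 0" "{y\<in>U \<sigma>. h y \<noteq> 0} \<subseteq> V" using r x by auto
    have "laurent (\<sigma> \<inter> \<tau>) h" by (rule laurent_mono[OF assms(1) st Int_lower1 h(1)])
    then obtain g' h' u where h': "laurent \<tau> g'" "laurent \<tau> h'" "\<And>p. p \<in> U (\<sigma> \<inter> \<tau>) \<Longrightarrow> u p \<noteq> 0"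
      "\<And>p. p \<in> U (\<sigma> \<inter> \<tau>) \<Longrightarrow> g' p = h p * u p" "\<And>p. p \<in> U (\<sigma> \<inter> \<tau>) \<Longrightarrow> h' p = h p * u p"
      "\<And>p. p \<in> U \<tau> \<Longrightarrow> p \<notin> U (\<sigma> \<inter> \<tau>) \<Longrightarrow> h' p = 0"
      by (rule laurent_extend_fraction[OF t st Int_lower2 _ \<open>laurent (\<sigma> \<inter> \<tau>) h\<close>]) (rule that)
    have "x \<in> U (\<sigma> \<inter> \<tau>)" using x assms chart_inter[OF assms(1) t] by auto
    moreover have "{y \<in> U \<tau>. h' y \<noteq> 0} \<subseteq> V"
      using h'(5,6) h(3) chart_inter[OF assms(1) t] by fastforce
    ultimately show "\<exists>h. laurent \<tau> h \<and> h x \<noteq> 0 \<and> {y\<in>U \<tau>. h y \<noteq> 0} \<subseteq> V"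
      using h' h by (intro exI[of _ h']) auto
  qed
qed

lemma regular_in_chart:
  assumes "\<sigma> \<in> \<Sigma>" "V \<subseteq> U \<sigma>"
  shows "regular_on X V f \<longleftrightarrow> (\<forall>x\<in>V. \<exists>g h. laurent \<sigma> g \<and> laurent \<sigma> h \<and> h x \<noteq> 0 \<and>
    (\<forall>y\<in>V. h y \<noteq> 0 \<longrightarrow> f y = g y / h y))"
proof
  assume r: "regular_on X V f"
  show "\<forall>x\<in>V. \<exists>g h. laurent \<sigma> g \<and> laurent \<sigma> h \<and> h x \<noteq> 0 \<and> (\<forall>y\<in>V. h y \<noteq> 0 \<longrightarrow> f y = g y / h y)"
  proof
    fix x assume x: "x \<in> V"
    then obtain \<tau> g h where t: "\<tau> \<in> \<Sigma>" "x \<in> U \<tau>" and gh: "laurent \<tau> g" "laurent \<tau> h" "h x \<noteq> 0"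
      "\<And>y. y \<in> V \<inter> U \<tau> \<Longrightarrow> h y \<noteq> 0 \<Longrightarrow> f y = g y / h y"
      using bspec[OF r[unfolded regular_on_iff] x] by blast
    note st = inter_cone[OF assms(1) t(1)]
    have "laurent (\<sigma> \<inter> \<tau>) g" "laurent (\<sigma> \<inter> \<tau>) h"
      by (rule laurent_mono[OF t(1) st Int_lower2 gh(1)], rule laurent_mono[OF t(1) st Int_lower2 gh(2)])
    then obtain g' h' u where gh': "laurent \<sigma> g'" "laurent \<sigma> h'" "\<And>p. p \<in> U (\<sigma> \<inter> \<tau>) \<Longrightarrow> u p \<noteq> 0"
      "\<And>p. p \<in> U (\<sigma> \<inter> \<tau>) \<Longrightarrow> g' p = g p * u p" "\<And>p. p \<in> U (\<sigma> \<inter> \<tau>) \<Longrightarrow> h' p = h p * u p"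
      "\<And>p. p \<in> U \<sigma> \<Longrightarrow> p \<notin> U (\<sigma> \<inter> \<tau>) \<Longrightarrow> h' p = 0"
      by (rule laurent_extend_fraction[OF assms(1) st Int_lower1]) (rule that)
    have "x \<in> U (\<sigma> \<inter> \<tau>)" using x t assms chart_inter[OF assms(1) t(1)] by auto
    moreover have "f y = g' y / h' y" if y: "y \<in> V" "h' y \<noteq> 0" for y
    proof -
      have "y \<in> U (\<sigma> \<inter> \<tau>)" using gh'(6) y assms by blast
      then show ?thesis
        using gh'(3-5)[of y] gh(4)[of y] y chart_inter[OF assms(1) t(1)] by auto
    qed
    ultimately show "\<exists>g h. laurent \<sigma> g \<and> laurent \<sigma> h \<and> h x \<noteq> 0 \<and> (\<forall>y\<in>V. h y \<noteq> 0 \<longrightarrow> f y = g y / h y)"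
      using gh' gh(3) by (intro exI[of _ g'] exI[of _ h']) auto
  qed
next
  assume "\<forall>x\<in>V. \<exists>g h. laurent \<sigma> g \<and> laurent \<sigma> h \<and> h x \<noteq> 0 \<and> (\<forall>y\<in>V. h y \<noteq> 0 \<longrightarrow> f y = g y / h y)"
  then have "\<forall>x\<in>V. x \<in> U \<sigma> \<and> (\<exists>g h. laurent \<sigma> g \<and> laurent \<sigma> h \<and> h x \<noteq> 0 \<and>
      (\<forall>y\<in>V \<inter> U \<sigma>. h y \<noteq> 0 \<longrightarrow> f y = g y / h y))"
    using assms(2) by (simp add: Int_absorb2 subset_iff)
  then show "regular_on X V f"
    unfolding regular_on_iff using assms(1) by blast
qed

lemma laurent_regular:
  assumes "\<sigma> \<in> \<Sigma>" "V \<subseteq> U \<sigma>" "laurent \<sigma> f"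
  shows "regular_on X V f"
proof -
  have "laurent \<sigma> f \<and> laurent \<sigma> (\<lambda>_. 1) \<and> (1::complex) \<noteq> 0 \<and> (\<forall>y\<in>V. (1::complex) \<noteq> 0 \<longrightarrow> f y = f y / 1)"
    using assms(3) laurent_const by simp
  then show ?thesis unfolding regular_in_chart[OF assms(1,2)] by blast
qed

lemma zopen_chart:
  assumes "\<sigma> \<in> \<Sigma>"
  shows "zopen X (U \<sigma>)"
proof -
  have "laurent \<sigma> (\<lambda>_. 1) \<and> (1::complex) \<noteq> 0 \<and> {y\<in>U \<sigma>. (1::complex) \<noteq> 0} \<subseteq> U \<sigma>"
    using laurent_const by simp
  then show ?thesis unfolding zopen_in_chart[OF assms order_refl] by blast
qed

text \<open>
The real points of the identity component of the torus. They suffice for density arguments, because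
different characters grow at different rates along a generic ray of vectors \<open>v\<close>.
\<close>

definition torus_point :: "'a \<Rightarrow> 'a toric_point" where
  "torus_point v = point_class {0} (\<lambda>m\<in>M. exp (of_real (m \<bullet> v)))"

lemma torus_point:
  shows "torus_point v \<in> U {0}" and "m \<in> M \<Longrightarrow> ch {0} m (torus_point v) = exp (of_real (m \<bullet> v))"
proof -
  have h: "(\<lambda>m\<in>M. exp (of_real (m \<bullet> v))) \<in> monoid_homs (S {0})"
    unfolding monoid_homs_def dual_monoid_origin
    by (auto simp: dual_lattice_zero dual_lattice_add inner_add_left exp_add)
  show "torus_point v \<in> U {0}" unfolding torus_point_def by (rule class_chart[OF origin_cone h])
  show "m \<in> M \<Longrightarrow> ch {0} m (torus_point v) = exp (of_real (m \<bullet> v))"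
    unfolding torus_point_def character_local_hom local_hom_class[OF origin_cone h] by simp
qed

lemma torus_subset: "\<sigma> \<in> \<Sigma> \<Longrightarrow> U {0} \<subseteq> U \<sigma>"
  by (rule chart_mono) (auto intro: origin_cone origin_in)

text \<open>
The irreducibility of the variety in usable form. Far out on a generic one-parameter subgroup of the
torus a Laurent polynomial is dominated by a single monomial.
\<close>

lemma torus_dense:
  assumes "finite H" and H: "\<And>h. h \<in> H \<Longrightarrow> \<exists>\<sigma>\<in>\<Sigma>. \<exists>x\<in>U \<sigma>. laurent \<sigma> h \<and> h x \<noteq> 0"
  shows "\<exists>t\<in>U {0}. \<forall>h\<in>H. h t \<noteq> 0"
proof -
  have "\<exists>F c. finite F \<and> F \<subseteq> M \<and> (\<exists>m\<in>F. c m \<noteq> 0) \<and> (\<forall>p\<in>U {0}. h p = (\<Sum>m\<in>F. c m * ch {0} m p))"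
    if h: "h \<in> H" for h
  proof -
    obtain \<sigma> x where s: "\<sigma> \<in> \<Sigma>" "x \<in> U \<sigma>" "laurent \<sigma> h" "h x \<noteq> 0" using H[OF h] by auto
    obtain F c where f: "finite F" "F \<subseteq> S \<sigma>" "\<And>p. p \<in> U \<sigma> \<Longrightarrow> h p = (\<Sum>m\<in>F. c m * ch \<sigma> m p)"
      using s(3) by (auto simp: laurent_def)
    have FM: "F \<subseteq> M" using f(2) dual_monoid_subset[of N \<sigma>] by auto
    have "\<exists>m\<in>F. c m \<noteq> 0"
    proof (rule ccontr)
      assume "\<not> (\<exists>m\<in>F. c m \<noteq> 0)"
      then have "\<forall>m\<in>F. c m = 0" by auto
      then show False using s(4) f(3)[OF s(2)] by simp
    qed
    moreover have "h p = (\<Sum>m\<in>F. c m * ch {0} m p)" if p: "p \<in> U {0}" for p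
    proof -
      have p': "p \<in> U \<sigma>" using p torus_subset[OF s(1)] by auto
      have "ch \<sigma> m p = ch {0} m p" if "m \<in> F" for m
        using that f(2) FM by (intro character_consistent[OF p' p]) (auto simp: dual_monoid_origin)
      then show ?thesis by (simp add: f(3)[OF p'])
    qed
    ultimately show ?thesis using f(1) FM by blast
  qed
  then have "\<exists>F. \<forall>h\<in>H. \<exists>c. finite (F h) \<and> F h \<subseteq> M \<and> (\<exists>m\<in>F h. c m \<noteq> 0) \<and>
      (\<forall>p\<in>U {0}. h p = (\<Sum>m\<in>F h. c m * ch {0} m p))"
    by (intro bchoice) auto
  then obtain F where "\<forall>h\<in>H. \<exists>c. finite (F h) \<and> F h \<subseteq> M \<and> (\<exists>m\<in>F h. c m \<noteq> 0) \<and>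
      (\<forall>p\<in>U {0}. h p = (\<Sum>m\<in>F h. c m * ch {0} m p))" by (rule exE)
  then have "\<exists>c. \<forall>h\<in>H. finite (F h) \<and> F h \<subseteq> M \<and> (\<exists>m\<in>F h. c h m \<noteq> 0) \<and>
      (\<forall>p\<in>U {0}. h p = (\<Sum>m\<in>F h. c h m * ch {0} m p))" by (rule bchoice)
  then obtain c where "\<forall>h\<in>H. finite (F h) \<and> F h \<subseteq> M \<and> (\<exists>m\<in>F h. c h m \<noteq> 0) \<and>
      (\<forall>p\<in>U {0}. h p = (\<Sum>m\<in>F h. c h m * ch {0} m p))" by (rule exE)
  then have F: "\<And>h. h \<in> H \<Longrightarrow> finite (F h)" "\<And>h. h \<in> H \<Longrightarrow> F h \<subseteq> M"
      "\<And>h. h \<in> H \<Longrightarrow> \<exists>m\<in>F h. c h m \<noteq> 0"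
      "\<And>h p. h \<in> H \<Longrightarrow> p \<in> U {0} \<Longrightarrow> h p = (\<Sum>m\<in>F h. c h m * ch {0} m p)"
    by blast+
  define D where "D = (\<Union>h\<in>H. (\<lambda>(m, m'). m - m') ` (F h \<times> F h)) - {0}"
  have "finite D" unfolding D_def using assms(1) F(1) by auto
  then obtain v where v: "\<And>d. d \<in> D \<Longrightarrow> d \<bullet> v \<noteq> 0" using generic_vector[of D] by (auto simp: D_def)
  have "\<forall>\<^sub>F s in at_top. h (torus_point (s *\<^sub>R v)) \<noteq> 0" if h: "h \<in> H" for h
  proof -
    have "inj_on (\<lambda>m. m \<bullet> v) (F h)"
    proof (rule inj_onI, rule ccontr)
      fix m m' assume m: "m \<in> F h" "m' \<in> F h" "m \<bullet> v = m' \<bullet> v" "m \<noteq> m'"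
      then have "m - m' \<in> D" using h by (force simp: D_def)
      then show False using v[of "m - m'"] m(3) by (simp add: inner_diff_left)
    qed
    moreover have "h (torus_point (s *\<^sub>R v)) = (\<Sum>m\<in>F h. c h m * exp (of_real (s * (m \<bullet> v))))" for s
    proof -
      have "h (torus_point (s *\<^sub>R v)) = (\<Sum>m\<in>F h. c h m * ch {0} m (torus_point (s *\<^sub>R v)))"
        by (rule F(4)[OF h torus_point(1)])
      also have "\<dots> = (\<Sum>m\<in>F h. c h m * exp (of_real (s * (m \<bullet> v))))"
        using F(2)[OF h] by (intro sum.cong) (auto simp: torus_point(2) subset_iff)
      finally show ?thesis .
    qed
    ultimately show ?thesis using exp_sum_eventually_nonzero[of "F h" "\<lambda>m. m \<bullet> v" "c h"] F(1,3)[OF h] by simp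
  qed
  then have "\<forall>\<^sub>F s in at_top. \<forall>h\<in>H. h (torus_point (s *\<^sub>R v)) \<noteq> 0"
    by (intro eventually_ball_finite[OF assms(1)] ballI)
  then have "\<exists>s. \<forall>h\<in>H. h (torus_point (s *\<^sub>R v)) \<noteq> 0"
    by (rule eventually_happens'[OF trivial_limit_at_top_linorder])
  then obtain s where "\<forall>h\<in>H. h (torus_point (s *\<^sub>R v)) \<noteq> 0" by (rule exE)
  then show ?thesis using torus_point(1) by blast
qed

lemma zopen_contains_basic:
  assumes "zopen X W" "W \<noteq> {}"
  shows "\<exists>\<sigma>\<in>\<Sigma>. \<exists>h. laurent \<sigma> h \<and> (\<exists>x\<in>U \<sigma>. h x \<noteq> 0) \<and> {y\<in>U \<sigma>. h y \<noteq> 0} \<subseteq> W"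
proof -
  obtain x where x: "x \<in> W" using assms(2) by auto
  then have "x \<in> points X" using assms(1) by (auto simp: zopen_def)
  then obtain \<sigma> where s: "\<sigma> \<in> \<Sigma>" "x \<in> U \<sigma>" unfolding points_def toric_variety_def by auto
  obtain h where "laurent \<sigma> h" "h x \<noteq> 0" "{y\<in>U \<sigma>. h y \<noteq> 0} \<subseteq> W"
    using assms(1) x s unfolding zopen_iff by blast
  then show ?thesis using s by blast
qed

lemma zopen_meets_torus:
  assumes "zopen X W" "W \<noteq> {}" and "finite H"
    and H: "\<And>h. h \<in> H \<Longrightarrow> \<exists>\<sigma>\<in>\<Sigma>. \<exists>x\<in>U \<sigma>. laurent \<sigma> h \<and> h x \<noteq> 0"
  shows "\<exists>t\<in>U {0}. t \<in> W \<and> (\<forall>h\<in>H. h t \<noteq> 0)"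
proof -
  obtain \<sigma> h where h: "\<sigma> \<in> \<Sigma>" "laurent \<sigma> h" "\<exists>x\<in>U \<sigma>. h x \<noteq> 0" "{y\<in>U \<sigma>. h y \<noteq> 0} \<subseteq> W"
    using zopen_contains_basic[OF assms(1,2)] by blast
  obtain t where t: "t \<in> U {0}" "\<forall>h'\<in>insert h H. h' t \<noteq> 0"
  proof -
    have "\<exists>\<sigma>\<in>\<Sigma>. \<exists>x\<in>U \<sigma>. laurent \<sigma> h' \<and> h' x \<noteq> 0" if "h' \<in> insert h H" for h'
      using that H[of h'] h(1-3) by (cases "h' = h") auto
    then show ?thesis using torus_dense[of "insert h H"] assms(3) that by blast
  qed
  then have "t \<in> W" using h(4) torus_subset[OF h(1)] by auto
  then show ?thesis using t by auto
qed

text \<open>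
If the difference of two regular functions were nonzero at \<open>x\<close>, its numerator would be a nonzero
Laurent polynomial, and a torus point of \<open>W\<close> where neither it nor the denominator vanishes would
contradict the agreement on \<open>W\<close>.
\<close>

lemma regular_identity:
  assumes "zopen X W" "W \<noteq> {}" "\<And>t. t \<in> W \<Longrightarrow> t \<in> U {0} \<Longrightarrow> g t = f t"
    and s: "\<sigma> \<in> \<Sigma>" "laurent \<sigma> f" "regular_on X (U \<sigma>) g" and x: "x \<in> U \<sigma>"
  shows "g x = f x"
proof (rule ccontr)
  assume ne: "g x \<noteq> f x"
  obtain a b where ab: "laurent \<sigma> a" "laurent \<sigma> b" "b x \<noteq> 0" "\<And>y. y \<in> U \<sigma> \<Longrightarrow> b y \<noteq> 0 \<Longrightarrow> g y = a y / b y"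
    using bspec[OF s(3)[unfolded regular_in_chart[OF s(1) order_refl]] x] by blast
  define d where "d p = a p + (- 1) * (b p * f p)" for p
  have d: "laurent \<sigma> d" unfolding d_def using ab s(2) by (intro laurent_add laurent_mult laurent_const)
  have dx: "d x \<noteq> 0" using ne ab(3) ab(4)[OF x] by (auto simp: d_def field_simps)
  obtain t where t: "t \<in> U {0}" "t \<in> W" "b t \<noteq> 0" "d t \<noteq> 0"
  proof -
    have "\<exists>\<sigma>\<in>\<Sigma>. \<exists>x\<in>U \<sigma>. laurent \<sigma> h \<and> h x \<noteq> 0" if "h \<in> {b, d}" for h
      using that d dx ab(2,3) x s(1) by auto
    then show ?thesis using zopen_meets_torus[OF assms(1,2), of "{b, d}"] that by auto
  qed
  then have "g t = a t / b t" using torus_subset[OF s(1)] by (intro ab(4)) auto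
  then show False using assms(3)[OF t(2,1)] t by (auto simp: d_def)
qed

end

section \<open>Affine charts\<close>

lemma poly_functions_power: "p \<in> poly_functions r \<Longrightarrow> (\<lambda>y. p y ^ k) \<in> poly_functions r"
  by (induction k) (auto intro: poly_functions.intros)

lemma poly_functions_sum:
  "finite I \<Longrightarrow> (\<And>i. i \<in> I \<Longrightarrow> p i \<in> poly_functions r) \<Longrightarrow> (\<lambda>y. \<Sum>i\<in>I. p i y) \<in> poly_functions r"
  by (induction I rule: finite_induct) (auto intro: poly_functions.intros)

lemma poly_functions_monomial: "(\<lambda>y. \<Prod>j<r. y j ^ a j) \<in> poly_functions r"
proof -
  have "(\<lambda>y. \<Prod>j\<in>J. y j ^ a j) \<in> poly_functions r" if "finite J" "J \<subseteq> {..<r}" for J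
    using that
    by (induction J rule: finite_induct)
      (auto intro: poly_functions.const intro!: poly_functions.mult poly_functions_power poly_functions.coordinate)
  then show ?thesis by simp
qed

lemma zopen_affine_variety:
  "zopen (affine_variety r Y) W \<longleftrightarrow>
    W \<subseteq> Y \<and> (\<forall>y\<in>W. \<exists>h\<in>poly_functions r. h y \<noteq> 0 \<and> {z\<in>Y. h z \<noteq> 0} \<subseteq> W)"
  unfolding zopen_def affine_variety_def points_def by auto

lemma regular_on_affine_variety:
  assumes "W \<subseteq> Y"
  shows "regular_on (affine_variety r Y) W f \<longleftrightarrow> (\<forall>y\<in>W. \<exists>g\<in>poly_functions r. \<exists>h\<in>poly_functions r.
    h y \<noteq> 0 \<and> (\<forall>z\<in>W. h z \<noteq> 0 \<longrightarrow> f z = g z / h z))"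
proof -
  have "W \<inter> Y = W" using assms by auto
  then show ?thesis using assms unfolding regular_on_def affine_variety_def by (auto simp: subset_iff)
qed

context toric_fan begin

context
  fixes \<sigma> :: "'a set" and gs :: "'a list"
  assumes \<sigma>: "\<sigma> \<in> \<Sigma>" and gs: "set gs \<subseteq> S \<sigma>"
    and generate: "\<And>m. m \<in> S \<sigma> \<Longrightarrow> \<exists>a. m = (\<Sum>j<length gs. real (a j) *\<^sub>R gs ! j)"
begin

definition combination :: "(nat \<Rightarrow> nat) \<Rightarrow> 'a" where
  "combination a = (\<Sum>j<length gs. real (a j) *\<^sub>R gs ! j)"

definition embed :: "'a toric_point \<Rightarrow> nat \<Rightarrow> complex" where
  "embed p = (\<lambda>j. if j < length gs then ch \<sigma> (gs ! j) p else 0)"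

lemma gs_nth: "j < length gs \<Longrightarrow> gs ! j \<in> S \<sigma>"
  using gs by auto

lemma partial_combination_mem: "k \<le> length gs \<Longrightarrow> (\<Sum>j<k. real (a j) *\<^sub>R gs ! j) \<in> S \<sigma>"
  by (induction k) (auto intro!: dual_monoid_zero dual_monoid_add dual_monoid_scale gs_nth)

lemma combination_mem: "combination a \<in> S \<sigma>"
  unfolding combination_def by (rule partial_combination_mem) simp

lemma combination_surj:
  assumes "m \<in> S \<sigma>"
  shows "\<exists>a. combination a = m"
proof -
  obtain a where "m = (\<Sum>j<length gs. real (a j) *\<^sub>R gs ! j)" using generate[OF assms] by (rule exE)
  then show ?thesis unfolding combination_def by auto
qed

lemma combination_add: "combination (\<lambda>j. a j + b j) = combination a + combination b"
  unfolding combination_def by (simp add: scaleR_add_left sum.distrib)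

lemma combination_zero: "combination (\<lambda>_. 0) = 0"
  unfolding combination_def by simp

lemma combination_unit: "j < length gs \<Longrightarrow> combination (\<lambda>i. if i = j then 1 else 0) = gs ! j"
  unfolding combination_def by (simp add: if_distrib[of real] if_distrib[of "\<lambda>x. x *\<^sub>R _"] cong: if_cong)

lemma prod_unit: "(j::nat) < r \<Longrightarrow> (\<Prod>i<r. y i ^ (if i = j then 1 else 0)) = (y j :: complex)"
  by (simp add: if_distrib[of "\<lambda>k. _ ^ k"] prod.delta cong: if_cong)

lemma character_combination:
  assumes p: "p \<in> U \<sigma>"
  shows "ch \<sigma> (combination a) p = (\<Prod>j<length gs. embed p j ^ a j)"
proof -
  have "ch \<sigma> (\<Sum>j<k. real (a j) *\<^sub>R gs ! j) p = (\<Prod>j<k. embed p j ^ a j)" if "k \<le> length gs" for k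
    using that
  proof (induction k)
    case (Suc k)
    then show ?case
      using character_add[OF p partial_combination_mem dual_monoid_scale[OF gs_nth], of k k a "a k"]
        character_scale[OF p gs_nth, of k "a k"] by (simp add: embed_def)
  qed (simp add: character_zero[OF p])
  then show ?thesis unfolding combination_def by simp
qed

lemma inj_on_embed: "inj_on embed (U \<sigma>)"
proof (rule inj_onI)
  fix p q assume p: "p \<in> U \<sigma>" and q: "q \<in> U \<sigma>" and e: "embed p = embed q"
  have "local_hom \<sigma> p = local_hom \<sigma> q"
  proof (rule monoid_homs_eqI[OF local_hom_hom[OF p] local_hom_hom[OF q]])
    fix m assume "m \<in> S \<sigma>"
    then obtain a where "m = combination a" using combination_surj by metis
    then show "local_hom \<sigma> p m = local_hom \<sigma> q m"
      using character_combination[OF p, of a] character_combination[OF q, of a] e by (simp add: character_local_hom)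
  qed
  from arg_cong[OF this, of "point_class \<sigma>"] show "p = q"
    unfolding class_local_hom[OF p] class_local_hom[OF q] .
qed

text \<open>
The image is defined by binomial equations: a point that satisfies all relations between the
generators assigns a well-defined value to each element of the monoid, and multiplicatively so.
\<close>

lemma embed_image:
  "embed ` U \<sigma> = {y. (\<forall>j\<ge>length gs. y j = 0) \<and>
     (\<forall>a b. combination a = combination b \<longrightarrow> (\<Prod>j<length gs. y j ^ a j) = (\<Prod>j<length gs. y j ^ b j))}"
    (is "_ = ?Y")
proof
  show "embed ` U \<sigma> \<subseteq> ?Y"
  proof
    fix y assume "y \<in> embed ` U \<sigma>"
    then obtain p where p: "p \<in> U \<sigma>" "y = embed p" by auto
    have "(\<Prod>j<length gs. y j ^ a j) = (\<Prod>j<length gs. y j ^ b j)" if "combination a = combination b" for a b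
      by (simp only: p(2) character_combination[OF p(1), symmetric] that)
    moreover have "y j = 0" if "j \<ge> length gs" for j using that by (simp add: p(2) embed_def)
    ultimately show "y \<in> ?Y" by blast
  qed
  show "?Y \<subseteq> embed ` U \<sigma>"
  proof
    fix y assume "y \<in> ?Y"
    note Y = CollectD[OF this]
    have y0: "y j = 0" if "j \<ge> length gs" for j using Y that by blast
    have y: "(\<Prod>j<length gs. y j ^ a j) = (\<Prod>j<length gs. y j ^ b j)" if "combination a = combination b" for a b
      using Y that by blast
    define a where "a m = (SOME a. combination a = m)" for m
    have a: "combination (a m) = m" if "m \<in> S \<sigma>" for m
      unfolding a_def by (rule someI_ex[of "\<lambda>a. combination a = m", OF combination_surj[OF that]])
    define \<gamma> where "\<gamma> = (\<lambda>m\<in>S \<sigma>. \<Prod>j<length gs. y j ^ a m j)"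
    have \<gamma>: "\<gamma> (combination b) = (\<Prod>j<length gs. y j ^ b j)" for b
      using y[of "a (combination b)" b] a[OF combination_mem] combination_mem by (simp add: \<gamma>_def)
    have h: "\<gamma> \<in> monoid_homs (S \<sigma>)"
      unfolding monoid_homs_def
    proof (intro CollectI conjI ballI)
      show "\<gamma> \<in> extensional (S \<sigma>)" by (simp add: \<gamma>_def)
      show "\<gamma> 0 = 1" using \<gamma>[of "\<lambda>_. 0"] by (simp add: combination_zero)
      fix m m' assume m: "m \<in> S \<sigma>" "m' \<in> S \<sigma>"
      show "\<gamma> (m + m') = \<gamma> m * \<gamma> m'"
        using \<gamma>[of "\<lambda>j. a m j + a m' j"] \<gamma>[of "a m"] \<gamma>[of "a m'"] a[OF m(1)] a[OF m(2)]
        by (simp add: combination_add power_add prod.distrib)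
    qed
    have "embed (point_class \<sigma> \<gamma>) = y"
    proof
      fix j
      show "embed (point_class \<sigma> \<gamma>) j = y j"
      proof (cases "j < length gs")
        case True
        then show ?thesis
          using \<gamma>[of "\<lambda>i. if i = j then 1 else 0"]
          by (simp add: embed_def character_local_hom local_hom_class[OF \<sigma> h] combination_unit prod_unit)
      qed (simp add: embed_def y0)
    qed
    then show "y \<in> embed ` U \<sigma>" using class_chart[OF \<sigma> h] by blast
  qed
qed

lemma algebraic_set_embed: "algebraic_set (length gs) (embed ` U \<sigma>)"
proof -
  define P where "P = {\<lambda>y::nat \<Rightarrow> complex. (\<Prod>j<length gs. y j ^ a j) + (- 1) * (\<Prod>j<length gs. y j ^ b j) | a b. combination a = combination b}"
  have "P \<subseteq> poly_functions (length gs)"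
  proof
    fix q assume "q \<in> P"
    then obtain a b where q: "q = (\<lambda>y. (\<Prod>j<length gs. y j ^ a j) + (- 1) * (\<Prod>j<length gs. y j ^ b j))"
      unfolding P_def by blast
    show "q \<in> poly_functions (length gs)"
      unfolding q by (intro poly_functions.add poly_functions.mult poly_functions.const poly_functions_monomial)
  qed
  moreover have "(\<forall>a b. combination a = combination b \<longrightarrow> (\<Prod>j<length gs. y j ^ a j) = (\<Prod>j<length gs. y j ^ b j)) \<longleftrightarrow>
      (\<forall>p\<in>P. p y = 0)" (is "?L \<longleftrightarrow> ?R") for y
  proof
    assume ?L
    show ?R
    proof
      fix p assume "p \<in> P"
      then obtain a b where q: "p = (\<lambda>y. (\<Prod>j<length gs. y j ^ a j) + (- 1) * (\<Prod>j<length gs. y j ^ b j))"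
        and ab: "combination a = combination b" unfolding P_def by blast
      have "(\<Prod>j<length gs. y j ^ a j) = (\<Prod>j<length gs. y j ^ b j)" using \<open>?L\<close> ab by blast
      then show "p y = 0" unfolding q by simp
    qed
  next
    assume R: ?R
    show ?L
    proof (intro allI impI)
      fix a b assume "combination a = combination b"
      then have "(\<lambda>y. (\<Prod>j<length gs. y j ^ a j) + (- 1) * (\<Prod>j<length gs. y j ^ b j)) \<in> P"
        unfolding P_def by blast
      from bspec[OF R this] show "(\<Prod>j<length gs. y j ^ a j) = (\<Prod>j<length gs. y j ^ b j)" by simp
    qed
  qed
  then have "embed ` U \<sigma> = {y. (\<forall>j\<ge>length gs. y j = 0) \<and> (\<forall>p\<in>P. p y = 0)}"
    unfolding embed_image by simp
  ultimately show ?thesis unfolding algebraic_set_def by blast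
qed

lemma poly_embed_laurent: "q \<in> poly_functions (length gs) \<Longrightarrow> laurent \<sigma> (\<lambda>p. q (embed p))"
proof (induction rule: poly_functions.induct)
  case (coordinate j)
  then show ?case by (auto simp: embed_def intro: laurent_character gs_nth)
qed (auto intro: laurent_const laurent_add laurent_mult)

lemma laurent_poly_embed:
  assumes "laurent \<sigma> f"
  shows "\<exists>q\<in>poly_functions (length gs). \<forall>p\<in>U \<sigma>. f p = q (embed p)"
proof -
  obtain F c where F: "finite F" "F \<subseteq> S \<sigma>" "\<And>p. p \<in> U \<sigma> \<Longrightarrow> f p = (\<Sum>m\<in>F. c m * ch \<sigma> m p)"
    using assms by (auto simp: laurent_def)
  have "\<exists>a. \<forall>m\<in>F. combination (a m) = m" by (rule bchoice) (use combination_surj F(2) in auto)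
  then obtain a where a: "\<And>m. m \<in> F \<Longrightarrow> combination (a m) = m" by auto
  have "(\<lambda>y. \<Sum>m\<in>F. c m * (\<Prod>j<length gs. y j ^ a m j)) \<in> poly_functions (length gs)"
    by (intro poly_functions_sum F(1) poly_functions.mult poly_functions.const poly_functions_monomial)
  moreover have "f p = (\<Sum>m\<in>F. c m * (\<Prod>j<length gs. embed p j ^ a m j))" if p: "p \<in> U \<sigma>" for p
    unfolding F(3)[OF p] using character_combination[OF p] a by (intro sum.cong refl) metis
  ultimately show ?thesis by (intro bexI[of _ "\<lambda>y. \<Sum>m\<in>F. c m * (\<Prod>j<length gs. y j ^ a m j)"]) auto
qed

lemma zopen_embed:
  assumes V: "V \<subseteq> U \<sigma>"
  shows "zopen X V \<longleftrightarrow> zopen (affine_variety (length gs) (embed ` U \<sigma>)) (embed ` V)"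
proof -
  have im: "embed p \<in> embed ` V \<longleftrightarrow> p \<in> V" if "p \<in> U \<sigma>" for p
    using inj_on_image_mem_iff[OF inj_on_embed that V] .
  have "(\<exists>h. laurent \<sigma> h \<and> h x \<noteq> 0 \<and> {y\<in>U \<sigma>. h y \<noteq> 0} \<subseteq> V) \<longleftrightarrow>
    (\<exists>h\<in>poly_functions (length gs). h (embed x) \<noteq> 0 \<and> {z\<in>embed ` U \<sigma>. h z \<noteq> 0} \<subseteq> embed ` V)"
    if x: "x \<in> V" for x
  proof
    assume "\<exists>h. laurent \<sigma> h \<and> h x \<noteq> 0 \<and> {y\<in>U \<sigma>. h y \<noteq> 0} \<subseteq> V"
    then obtain h where h: "laurent \<sigma> h" "h x \<noteq> 0" "{y\<in>U \<sigma>. h y \<noteq> 0} \<subseteq> V" by blast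
    obtain q where q: "q \<in> poly_functions (length gs)" "\<And>p. p \<in> U \<sigma> \<Longrightarrow> h p = q (embed p)"
      using laurent_poly_embed[OF h(1)] by blast
    have "q (embed x) \<noteq> 0" using q(2)[of x] h(2) x V by auto
    moreover have "{z\<in>embed ` U \<sigma>. q z \<noteq> 0} \<subseteq> embed ` V" using q(2) h(3) by auto
    ultimately show "\<exists>h\<in>poly_functions (length gs). h (embed x) \<noteq> 0 \<and> {z\<in>embed ` U \<sigma>. h z \<noteq> 0} \<subseteq> embed ` V"
      using q(1) by blast
  next
    assume "\<exists>h\<in>poly_functions (length gs). h (embed x) \<noteq> 0 \<and> {z\<in>embed ` U \<sigma>. h z \<noteq> 0} \<subseteq> embed ` V"
    then obtain q where q: "q \<in> poly_functions (length gs)" "q (embed x) \<noteq> 0"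
      "{z\<in>embed ` U \<sigma>. q z \<noteq> 0} \<subseteq> embed ` V" by blast
    have "{y\<in>U \<sigma>. q (embed y) \<noteq> 0} \<subseteq> V" using q(3) im by auto
    then show "\<exists>h. laurent \<sigma> h \<and> h x \<noteq> 0 \<and> {y\<in>U \<sigma>. h y \<noteq> 0} \<subseteq> V"
      using poly_embed_laurent[OF q(1)] q(2) by (intro exI[of _ "\<lambda>p. q (embed p)"]) simp
  qed
  then show ?thesis
    unfolding zopen_affine_variety zopen_in_chart[OF \<sigma> V] using V by (simp add: image_mono)
qed

lemma regular_embed:
  assumes V: "V \<subseteq> U \<sigma>"
  shows "regular_on (affine_variety (length gs) (embed ` U \<sigma>)) (embed ` V) f \<longleftrightarrow> regular_on X V (f \<circ> embed)"
proof -
  have "(\<exists>g\<in>poly_functions (length gs). \<exists>h\<in>poly_functions (length gs).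
      h (embed x) \<noteq> 0 \<and> (\<forall>z\<in>embed ` V. h z \<noteq> 0 \<longrightarrow> f z = g z / h z)) \<longleftrightarrow>
    (\<exists>g h. laurent \<sigma> g \<and> laurent \<sigma> h \<and> h x \<noteq> 0 \<and> (\<forall>y\<in>V. h y \<noteq> 0 \<longrightarrow> (f \<circ> embed) y = g y / h y))"
    if x: "x \<in> V" for x
  proof
    assume "\<exists>g h. laurent \<sigma> g \<and> laurent \<sigma> h \<and> h x \<noteq> 0 \<and> (\<forall>y\<in>V. h y \<noteq> 0 \<longrightarrow> (f \<circ> embed) y = g y / h y)"
    then obtain g h where h: "laurent \<sigma> g" "laurent \<sigma> h" "h x \<noteq> 0"
      "\<And>y. y \<in> V \<Longrightarrow> h y \<noteq> 0 \<Longrightarrow> f (embed y) = g y / h y" by auto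
    obtain q where q: "q \<in> poly_functions (length gs)" "\<And>p. p \<in> U \<sigma> \<Longrightarrow> g p = q (embed p)"
      using laurent_poly_embed[OF h(1)] by blast
    obtain q' where q': "q' \<in> poly_functions (length gs)" "\<And>p. p \<in> U \<sigma> \<Longrightarrow> h p = q' (embed p)"
      using laurent_poly_embed[OF h(2)] by blast
    have "q' (embed x) \<noteq> 0" using q'(2)[of x] h(3) x V by auto
    moreover have "f (embed y) = q (embed y) / q' (embed y)" if "y \<in> V" "q' (embed y) \<noteq> 0" for y
      using h(4)[OF that(1)] q(2)[of y] q'(2)[of y] that V by auto
    ultimately show "\<exists>g\<in>poly_functions (length gs). \<exists>h\<in>poly_functions (length gs).
      h (embed x) \<noteq> 0 \<and> (\<forall>z\<in>embed ` V. h z \<noteq> 0 \<longrightarrow> f z = g z / h z)"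
      using q(1) q'(1) by blast
  next
    assume "\<exists>g\<in>poly_functions (length gs). \<exists>h\<in>poly_functions (length gs).
      h (embed x) \<noteq> 0 \<and> (\<forall>z\<in>embed ` V. h z \<noteq> 0 \<longrightarrow> f z = g z / h z)"
    then obtain g h where "g \<in> poly_functions (length gs)" "h \<in> poly_functions (length gs)"
      "h (embed x) \<noteq> 0" "\<And>y. y \<in> V \<Longrightarrow> h (embed y) \<noteq> 0 \<Longrightarrow> f (embed y) = g (embed y) / h (embed y)" by auto
    then show "\<exists>g h. laurent \<sigma> g \<and> laurent \<sigma> h \<and> h x \<noteq> 0 \<and> (\<forall>y\<in>V. h y \<noteq> 0 \<longrightarrow> (f \<circ> embed) y = g y / h y)"
      by (intro exI[of _ "\<lambda>p. g (embed p)"] exI[of _ "\<lambda>p. h (embed p)"]) (auto intro: poly_embed_laurent)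
  qed
  then show ?thesis
    unfolding regular_on_affine_variety[OF image_mono[OF V]] regular_in_chart[OF \<sigma> V] by simp
qed

text \<open>
Polynomials in the coordinates of the embedding are precisely the Laurent polynomials on the chart,
which turns both the topology and the regular functions into those of the image.
\<close>

lemma chart_affine_open: "affine_open X (U \<sigma>)"
  unfolding affine_open_def
proof (intro conjI exI allI impI)
  show "zopen X (U \<sigma>)" by (rule zopen_chart[OF \<sigma>])
  show "algebraic_set (length gs) (embed ` U \<sigma>)" by (rule algebraic_set_embed)
  show "bij_betw embed (U \<sigma>) (embed ` U \<sigma>)" by (rule inj_on_imp_bij_betw[OF inj_on_embed])
qed (auto simp: zopen_embed[symmetric] regular_embed)

end

lemma point_in_chart:
  assumes "p \<in> points X"
  obtains \<sigma> where "\<sigma> \<in> \<Sigma>" "p \<in> U \<sigma>"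
  using assms unfolding points_def toric_variety_def by auto

section \<open>Torus action\<close>

text \<open>
The action of a torus element on a representative \<open>(\<sigma>, \<gamma>)\<close> of a point.
\<close>

definition act_pair :: "('a \<Rightarrow> complex) \<Rightarrow> 'a set \<times> ('a \<Rightarrow> complex) \<Rightarrow> 'a set \<times> ('a \<Rightarrow> complex)" where
  "act_pair t = (\<lambda>(\<sigma>, \<gamma>). (\<sigma>, \<lambda>m\<in>S \<sigma>. t m * \<gamma> m))"

lemma torus_mult: "t \<in> torus N \<Longrightarrow> \<gamma> \<in> monoid_homs (S \<sigma>) \<Longrightarrow> (\<lambda>m\<in>S \<sigma>. t m * \<gamma> m) \<in> monoid_homs (S \<sigma>)"
  using dual_monoid_subset[of N \<sigma>]
  by (auto simp: torus_def monoid_homs_def dual_monoid_zero dual_monoid_add subset_iff)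

lemma torus_unit: "t \<in> torus N \<Longrightarrow> m \<in> M \<Longrightarrow> t m \<noteq> 0"
  unfolding torus_def by (auto dest!: monoid_homs_unit intro: dual_lattice_uminus)

lemma torus_inverse: "t \<in> torus N \<Longrightarrow> (\<lambda>m\<in>M. 1 / t m) \<in> torus N"
  unfolding torus_def monoid_homs_def by (auto simp: dual_lattice_zero dual_lattice_add)

lemma act_pair_glue:
  assumes "t \<in> torus N" "(a, b) \<in> glue N \<Sigma>"
  shows "(act_pair t a, act_pair t b) \<in> glue N \<Sigma>"
proof -
  obtain \<sigma> \<gamma> \<tau> \<delta> where ab: "a = (\<sigma>, \<gamma>)" "b = (\<tau>, \<delta>)" by (cases a; cases b)
  obtain \<epsilon> where e: "\<sigma> \<in> \<Sigma>" "\<tau> \<in> \<Sigma>" "\<gamma> \<in> monoid_homs (S \<sigma>)" "\<delta> \<in> monoid_homs (S \<tau>)"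
    "\<epsilon> \<in> monoid_homs (S (\<sigma> \<inter> \<tau>))" "\<forall>m\<in>S \<sigma>. \<gamma> m = \<epsilon> m" "\<forall>m\<in>S \<tau>. \<delta> m = \<epsilon> m"
    using assms(2) unfolding ab glue_def by auto
  have "S \<sigma> \<subseteq> S (\<sigma> \<inter> \<tau>)" "S \<tau> \<subseteq> S (\<sigma> \<inter> \<tau>)" by (auto intro!: dual_monoid_antimono)
  then show ?thesis
    using e torus_mult[OF assms(1)] unfolding ab glue_def act_pair_def
    by (auto intro!: bexI[of _ "\<lambda>m\<in>S (\<sigma> \<inter> \<tau>). t m * \<epsilon> m"])
qed

lemma act_pair_inverse:
  assumes "t \<in> torus N" "a \<in> pairs"
  shows "act_pair t (act_pair (\<lambda>m\<in>M. 1 / t m) a) = a" "act_pair (\<lambda>m\<in>M. 1 / t m) (act_pair t a) = a"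
proof -
  obtain \<sigma> \<gamma> where a: "a = (\<sigma>, \<gamma>)" "\<gamma> \<in> monoid_homs (S \<sigma>)" using assms(2) by auto
  have "\<gamma> \<in> extensional (S \<sigma>)" using a(2) by (simp add: monoid_homs_def)
  then show "act_pair t (act_pair (\<lambda>m\<in>M. 1 / t m) a) = a" "act_pair (\<lambda>m\<in>M. 1 / t m) (act_pair t a) = a"
    using torus_unit[OF assms(1)] dual_monoid_subset[of N \<sigma>]
    by (auto simp: a(1) act_pair_def fun_eq_iff subset_iff extensional_def)
qed

text \<open>
Acting on every member of a class yields a full class because the inverse torus element leads back.
\<close>

lemma torus_action_class:
  assumes t: "t \<in> torus N" and s: "\<sigma> \<in> \<Sigma>" "\<gamma> \<in> monoid_homs (S \<sigma>)"
  shows "torus_action N t (point_class \<sigma> \<gamma>) = point_class \<sigma> (\<lambda>m\<in>S \<sigma>. t m * \<gamma> m)"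
proof -
  let ?t' = "\<lambda>m\<in>M. 1 / t m"
  have c: "point_class \<sigma> (\<lambda>m\<in>S \<sigma>. t m * \<gamma> m) = glue N \<Sigma> `` {act_pair t (\<sigma>, \<gamma>)}"
    by (simp add: point_class_def act_pair_def)
  have "act_pair t ` (glue N \<Sigma> `` {(\<sigma>, \<gamma>)}) = glue N \<Sigma> `` {act_pair t (\<sigma>, \<gamma>)}"
  proof
    show "act_pair t ` (glue N \<Sigma> `` {(\<sigma>, \<gamma>)}) \<subseteq> glue N \<Sigma> `` {act_pair t (\<sigma>, \<gamma>)}"
      using act_pair_glue[OF t] by auto
    show "glue N \<Sigma> `` {act_pair t (\<sigma>, \<gamma>)} \<subseteq> act_pair t ` (glue N \<Sigma> `` {(\<sigma>, \<gamma>)})"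
    proof
      fix b assume "b \<in> glue N \<Sigma> `` {act_pair t (\<sigma>, \<gamma>)}"
      then have b: "(act_pair t (\<sigma>, \<gamma>), b) \<in> glue N \<Sigma>" by simp
      then have "(act_pair ?t' (act_pair t (\<sigma>, \<gamma>)), act_pair ?t' b) \<in> glue N \<Sigma>" by (rule act_pair_glue[OF torus_inverse[OF t]])
      then have "((\<sigma>, \<gamma>), act_pair ?t' b) \<in> glue N \<Sigma>" using act_pair_inverse(2)[OF t, of "(\<sigma>, \<gamma>)"] s by simp
      moreover have "b \<in> pairs" using b by (auto simp: glue_def)
      then have "b = act_pair t (act_pair ?t' b)" using act_pair_inverse(1)[OF t] by simp
      ultimately show "b \<in> act_pair t ` (glue N \<Sigma> `` {(\<sigma>, \<gamma>)})" by blast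
    qed
  qed
  then show ?thesis unfolding c unfolding torus_action_def point_class_def act_pair_def .
qed

lemma torus_action_chart:
  assumes t: "t \<in> torus N" and p: "p \<in> U \<sigma>"
  shows "torus_action N t p \<in> U \<sigma>" "m \<in> S \<sigma> \<Longrightarrow> ch \<sigma> m (torus_action N t p) = t m * ch \<sigma> m p"
    "torus_action N (\<lambda>m\<in>M. 1 / t m) (torus_action N t p) = p"
proof -
  note s = chart_cone[OF p] and g = local_hom_hom[OF p]
  note tg = torus_mult[OF t g]
  have e: "torus_action N t p = point_class \<sigma> (\<lambda>m\<in>S \<sigma>. t m * local_hom \<sigma> p m)"
    using torus_action_class[OF t s g] by (simp add: class_local_hom[OF p])
  show "torus_action N t p \<in> U \<sigma>" unfolding e by (rule class_chart[OF s tg])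
  show "ch \<sigma> m (torus_action N t p) = t m * ch \<sigma> m p" if "m \<in> S \<sigma>"
    using that by (simp add: e character_local_hom local_hom_class[OF s tg])
  have "act_pair (\<lambda>m\<in>M. 1 / t m) (act_pair t (\<sigma>, local_hom \<sigma> p)) = (\<sigma>, local_hom \<sigma> p)"
    using act_pair_inverse(2)[OF t] s g by auto
  then have "(\<lambda>m\<in>S \<sigma>. (\<lambda>m\<in>M. 1 / t m) m * (\<lambda>m\<in>S \<sigma>. t m * local_hom \<sigma> p m) m) = local_hom \<sigma> p"
    by (simp add: act_pair_def)
  then show "torus_action N (\<lambda>m\<in>M. 1 / t m) (torus_action N t p) = p"
    unfolding e torus_action_class[OF torus_inverse[OF t] s tg] by (simp only: class_local_hom[OF p])
qed

lemma torus_action_vimage: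
  assumes t: "t \<in> torus N"
  shows "points X \<inter> torus_action N t -` U \<sigma> = U \<sigma>"
proof
  show "U \<sigma> \<subseteq> points X \<inter> torus_action N t -` U \<sigma>"
    using torus_action_chart(1)[OF t] chart_points by auto
  show "points X \<inter> torus_action N t -` U \<sigma> \<subseteq> U \<sigma>"
  proof
    fix p assume p: "p \<in> points X \<inter> torus_action N t -` U \<sigma>"
    then obtain \<tau> where "p \<in> U \<tau>" using point_in_chart by blast
    then show "p \<in> U \<sigma>"
      using torus_action_chart(1)[OF torus_inverse[OF t], of "torus_action N t p" \<sigma>] torus_action_chart(3)[OF t] p
      by auto
  qed
qed

end

section \<open>The divisor of a strictly convex support function\<close>

text \<open>
The value \<open>a \<sigma>\<close> is the linear function that a support function agrees with on the maximal cone \<open>\<sigma>\<close>. That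
\<open>a \<sigma> - a \<sigma>'\<close> cuts out \<open>\<sigma> \<inter> \<sigma>'\<close> is strict convexity: the function \<open>a \<sigma>\<close> exceeds \<open>a \<sigma>'\<close> on \<open>\<sigma>\<close> except where the
two cones meet.
\<close>

locale polarized_toric_fan = toric_fan +
  fixes \<M> :: "'a set set" and a :: "'a set \<Rightarrow> 'a"
  assumes max_cone: "\<M> \<subseteq> \<Sigma>"
    and max_cover: "\<tau> \<in> \<Sigma> \<Longrightarrow> \<exists>\<sigma>\<in>\<M>. \<tau> \<subseteq> \<sigma>"
    and support_lattice: "\<sigma> \<in> \<M> \<Longrightarrow> a \<sigma> \<in> dual_lattice N"
    and support_cut_out: "\<sigma> \<in> \<M> \<Longrightarrow> \<sigma>' \<in> \<M> \<Longrightarrow> cuts_out N \<sigma> (\<sigma> \<inter> \<sigma>') (a \<sigma> - a \<sigma>')"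
    and finitely_generated: "\<sigma> \<in> \<M> \<Longrightarrow> \<exists>gs. set gs \<subseteq> dual_monoid N \<sigma> \<and>
      (\<forall>m\<in>dual_monoid N \<sigma>. \<exists>b. m = (\<Sum>j<length gs. real (b j) *\<^sub>R gs ! j))"
begin

definition support_divisor :: "'a toric_point divisor" where
  "support_divisor = (\<lambda>\<sigma>. (U \<sigma>, ch {0} (a \<sigma>))) ` \<M>"

text \<open>
Local equations for the divisor of the support function. The constants leave room for the torus
action, which multiplies the character \<open>\<chi>\<^sup>m\<close> by a scalar.
\<close>

definition represents :: "'a toric_point divisor \<Rightarrow> bool" where
  "represents D \<longleftrightarrow>
     (\<forall>(W, f)\<in>D. \<exists>\<sigma>\<in>\<M>. W = U \<sigma> \<and> (\<exists>c. c \<noteq> 0 \<and> (\<forall>p\<in>U {0}. f p = c * ch {0} (a \<sigma>) p))) \<and>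
     (\<forall>\<sigma>\<in>\<M>. \<exists>f. (U \<sigma>, f) \<in> D)"

lemma represents_local:
  assumes "represents D" "(W, f) \<in> D"
  obtains \<sigma> c where "\<sigma> \<in> \<M>" "W = U \<sigma>" "c \<noteq> 0" "\<And>p. p \<in> U {0} \<Longrightarrow> f p = c * ch {0} (a \<sigma>) p"
  using assms unfolding represents_def by fast

lemma represents_chart: "represents D \<Longrightarrow> \<sigma> \<in> \<M> \<Longrightarrow> \<exists>f. (U \<sigma>, f) \<in> D"
  unfolding represents_def by blast

lemma representsI:
  assumes "\<And>W f. (W, f) \<in> D \<Longrightarrow>
      \<exists>\<sigma>\<in>\<M>. W = U \<sigma> \<and> (\<exists>c. c \<noteq> 0 \<and> (\<forall>p\<in>U {0}. f p = c * ch {0} (a \<sigma>) p))"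
    and "\<And>\<sigma>. \<sigma> \<in> \<M> \<Longrightarrow> \<exists>f. (U \<sigma>, f) \<in> D"
  shows "represents D"
  unfolding represents_def
proof (intro conjI ballI)
  fix x assume "x \<in> D"
  then show "case x of (W, f) \<Rightarrow> \<exists>\<sigma>\<in>\<M>. W = U \<sigma> \<and> (\<exists>c. c \<noteq> 0 \<and> (\<forall>p\<in>U {0}. f p = c * ch {0} (a \<sigma>) p))"
    using assms(1) by (cases x) simp
qed (rule assms(2))

lemma torus_nonempty: "U {0} \<noteq> {}"
  using torus_point(1) by blast

lemma character_torus_unit: "m \<in> M \<Longrightarrow> p \<in> U {0} \<Longrightarrow> ch {0} m p \<noteq> 0"
  by (rule character_unit) (auto simp: dual_monoid_origin dual_lattice_uminus)

lemma character_on_torus: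
  assumes "\<sigma> \<in> \<Sigma>" "p \<in> U {0}" "m - m' \<in> S \<sigma>" "m \<in> M" "m' \<in> M"
  shows "ch \<sigma> (m - m') p = ch {0} m p * ch {0} (- m') p"
proof -
  have "ch \<sigma> (m - m') p = ch {0} (m + - m') p"
    using assms torus_subset[OF assms(1)] dual_lattice_diff[OF assms(4,5)]
    by (subst character_consistent[of p \<sigma> "{0}"]) (auto simp: dual_monoid_origin)
  then show ?thesis
    using character_add[OF assms(2), of m "- m'"] assms(4,5)
    by (simp add: dual_monoid_origin dual_lattice_uminus)
qed

lemma character_torus_inverse:
  assumes "p \<in> U {0}" "m \<in> M"
  shows "ch {0} (- m) p * ch {0} m p = 1"
  using character_add[OF assms(1), of "- m" m] character_zero[OF assms(1)] assms(2)
  by (simp add: dual_monoid_origin dual_lattice_uminus)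

lemma points_max_charts: "points X = (\<Union>\<sigma>\<in>\<M>. U \<sigma>)"
proof -
  have "\<exists>\<sigma>\<in>\<M>. p \<in> U \<sigma>" if p: "p \<in> points X" for p
  proof -
    obtain \<tau> where t: "\<tau> \<in> \<Sigma>" "p \<in> U \<tau>" using point_in_chart[OF p] by blast
    obtain \<sigma> where s: "\<sigma> \<in> \<M>" "\<tau> \<subseteq> \<sigma>" using max_cover[OF t(1)] by auto
    then show ?thesis using chart_mono[of \<sigma> \<tau>] t max_cone by blast
  qed
  then show ?thesis using chart_points by blast
qed

lemma represents_rational:
  assumes c: "c \<noteq> 0" "\<And>p. p \<in> U {0} \<Longrightarrow> f p = c * ch {0} m p" and m: "m \<in> M"
  shows "rational_fun X f" "\<not> rat_eq X f (\<lambda>_. 0)"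
proof -
  have l: "laurent {0} f"
    by (rule laurent_cong[OF laurent_monomial[of m "{0}" c]]) (use c m in \<open>auto simp: dual_monoid_origin\<close>)
  then show "rational_fun X f"
    unfolding rational_fun_def
    using zopen_chart[OF origin_cone] torus_nonempty laurent_regular[OF origin_cone order_refl l] by blast
  show "\<not> rat_eq X f (\<lambda>_. 0)"
  proof
    assume "rat_eq X f (\<lambda>_. 0)"
    then obtain W where W: "zopen X W" "W \<noteq> {}" "\<forall>x\<in>W. f x = 0" by (auto simp: rat_eq_def)
    obtain t where "t \<in> U {0}" "t \<in> W" using zopen_meets_torus[OF W(1,2), of "{}"] by auto
    then show False using W(3) c character_torus_unit[OF m, of t] by auto
  qed
qed

lemma represents_cartier:
  assumes D: "represents D"
  shows "cartier_divisor X D"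
proof -
  have "zopen X W \<and> rational_fun X f \<and> \<not> rat_eq X f (\<lambda>_. 0)" if Wf: "(W, f) \<in> D" for W f
  proof -
    obtain \<sigma> c where s: "\<sigma> \<in> \<M>" "W = U \<sigma>" "c \<noteq> 0" "\<And>p. p \<in> U {0} \<Longrightarrow> f p = c * ch {0} (a \<sigma>) p"
      by (rule represents_local[OF D Wf]) (rule that)
    then show ?thesis
      using represents_rational[OF s(3,4) support_lattice[OF s(1)]] zopen_chart[of \<sigma>] max_cone by auto
  qed
  moreover have "(\<Union>(W, f)\<in>D. W) = points X"
  proof
    show "(\<Union>(W, f)\<in>D. W) \<subseteq> points X"
      using D chart_points by (auto elim!: represents_local)
    show "points X \<subseteq> (\<Union>(W, f)\<in>D. W)"
      unfolding points_max_charts using represents_chart[OF D] by blast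
  qed
  moreover have "\<exists>u. regular_on X (W \<inter> W') u \<and> (\<forall>x\<in>W \<inter> W'. u x \<noteq> 0) \<and> rat_eq X f (\<lambda>x. u x * f' x)"
    if WW: "(W, f) \<in> D" "(W', f') \<in> D" for W f W' f'
  proof -
    obtain \<sigma> c where s: "\<sigma> \<in> \<M>" "W = U \<sigma>" "c \<noteq> 0" "\<And>p. p \<in> U {0} \<Longrightarrow> f p = c * ch {0} (a \<sigma>) p"
      by (rule represents_local[OF D WW(1)]) (rule that)
    obtain \<sigma>' c' where s': "\<sigma>' \<in> \<M>" "W' = U \<sigma>'" "c' \<noteq> 0" "\<And>p. p \<in> U {0} \<Longrightarrow> f' p = c' * ch {0} (a \<sigma>') p"
      by (rule represents_local[OF D WW(2)]) (rule that)
    have ss: "\<sigma> \<in> \<Sigma>" "\<sigma>' \<in> \<Sigma>" using s s' max_cone by auto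
    let ?\<tau> = "\<sigma> \<inter> \<sigma>'"
    have t: "?\<tau> \<in> \<Sigma>" by (rule inter_cone[OF ss])
    have W: "W \<inter> W' = U ?\<tau>" using chart_inter[OF ss] s(2) s'(2) by simp
    have m: "a \<sigma> - a \<sigma>' \<in> S ?\<tau>" "- (a \<sigma> - a \<sigma>') \<in> S ?\<tau>"
      using cuts_out_uminus[OF support_cut_out[OF s(1) s'(1)]] by auto
    define u where "u = (\<lambda>p. (c / c') * ch ?\<tau> (a \<sigma> - a \<sigma>') p)"
    have "regular_on X (W \<inter> W') u"
      unfolding W u_def by (intro laurent_regular[OF t order_refl] laurent_monomial m(1))
    moreover have "u x \<noteq> 0" if "x \<in> W \<inter> W'" for x
      using that s(3) s'(3) character_unit[of x ?\<tau>, OF _ m] unfolding W u_def by auto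
    moreover have "rat_eq X f (\<lambda>x. u x * f' x)"
      unfolding rat_eq_def
    proof (intro exI conjI ballI)
      show "zopen X (U {0})" by (rule zopen_chart[OF origin_cone])
      show "U {0} \<noteq> {}" by (rule torus_nonempty)
      fix p assume p: "p \<in> U {0}"
      have "ch {0} (- a \<sigma>') p * ch {0} (a \<sigma>') p = 1"
        by (rule character_torus_inverse[OF p support_lattice[OF s'(1)]])
      then have e: "ch ?\<tau> (a \<sigma> - a \<sigma>') p * ch {0} (a \<sigma>') p = ch {0} (a \<sigma>) p"
        unfolding character_on_torus[OF t p m(1) support_lattice[OF s(1)] support_lattice[OF s'(1)]]
        by (simp add: mult.assoc)
      have "u p * f' p = (c / c') * c' * (ch ?\<tau> (a \<sigma> - a \<sigma>') p * ch {0} (a \<sigma>') p)"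
        unfolding u_def s'(4)[OF p] by simp
      also have "\<dots> = f p" unfolding e s(4)[OF p] using s'(3) by simp
      finally show "f p = u p * f' p" by simp
    qed
    ultimately show ?thesis by blast
  qed
  ultimately show ?thesis unfolding cartier_divisor_def by blast
qed

lemma represents_pullback:
  assumes D: "represents D" and t: "t \<in> torus N"
  shows "represents (pullback_divisor X (torus_action N t) D)"
proof -
  have e: "pullback_divisor X (torus_action N t) D = (\<lambda>(W, f). (W, f \<circ> torus_action N t)) ` D"
    unfolding pullback_divisor_def
  proof (rule image_cong[OF refl])
    fix x assume x: "x \<in> D"
    obtain W f where x': "x = (W, f)" by (cases x)
    obtain \<sigma> where "W = U \<sigma>" using represents_local[OF D x[unfolded x']] by metis
    then show "(case x of (V, f) \<Rightarrow> (points X \<inter> torus_action N t -` V, f \<circ> torus_action N t)) =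
      (case x of (W, f) \<Rightarrow> (W, f \<circ> torus_action N t))" using torus_action_vimage[OF t] by (simp add: x')
  qed
  have "\<exists>\<sigma>\<in>\<M>. W = U \<sigma> \<and> (\<exists>c. c \<noteq> 0 \<and> (\<forall>p\<in>U {0}. (f \<circ> torus_action N t) p = c * ch {0} (a \<sigma>) p))"
    if Wf: "(W, f) \<in> D" for W f
  proof -
    obtain \<sigma> c where s: "\<sigma> \<in> \<M>" "W = U \<sigma>" "c \<noteq> 0" "\<And>p. p \<in> U {0} \<Longrightarrow> f p = c * ch {0} (a \<sigma>) p"
      by (rule represents_local[OF D Wf]) (rule that)
    have m: "a \<sigma> \<in> S {0}" using support_lattice[OF s(1)] by (simp add: dual_monoid_origin)
    have "(f \<circ> torus_action N t) p = (c * t (a \<sigma>)) * ch {0} (a \<sigma>) p" if p: "p \<in> U {0}" for p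
      using s(4)[OF torus_action_chart(1)[OF t p]] torus_action_chart(2)[OF t p m] by simp
    moreover have "c * t (a \<sigma>) \<noteq> 0" using s(3) torus_unit[OF t support_lattice[OF s(1)]] by simp
    ultimately show ?thesis using s(1,2) by blast
  qed
  moreover have "\<exists>f. (U \<sigma>, f) \<in> (\<lambda>(W, f). (W, f \<circ> torus_action N t)) ` D" if "\<sigma> \<in> \<M>" for \<sigma>
  proof -
    obtain f where "(U \<sigma>, f) \<in> D" using represents_chart[OF D \<open>\<sigma> \<in> \<M>\<close>] by blast
    then show ?thesis by force
  qed
  ultimately show ?thesis unfolding e by (intro representsI) auto
qed

lemma represents_union: "represents D \<Longrightarrow> represents D' \<Longrightarrow> represents (D \<union> D')"
  unfolding represents_def by (simp add: ball_Un) blast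

lemma represents_support_divisor: "represents support_divisor"
proof -
  have "\<exists>c. c \<noteq> 0 \<and> (\<forall>p\<in>U {0}. ch {0} (a \<sigma>) p = c * ch {0} (a \<sigma>) p)" for \<sigma>
    by (intro exI[of _ 1]) simp
  then show ?thesis unfolding support_divisor_def by (intro representsI) auto
qed

lemma support_divisor_invariant: "torus_invariant_divisor N \<Sigma> support_divisor"
  unfolding torus_invariant_divisor_def divisor_eq_def
  using represents_cartier represents_pullback represents_union represents_support_divisor by blast

lemma multiple_one: "multiple_divisor 1 D = D"
  unfolding multiple_divisor_def by simp

lemma support_section:
  assumes s0: "\<sigma>\<^sub>0 \<in> \<M>" and s: "\<sigma> \<in> \<M>"
  shows "laurent \<sigma> (ch \<sigma> (a \<sigma> - a \<sigma>\<^sub>0))"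
    and "p \<in> U {0} \<Longrightarrow> ch \<sigma> (a \<sigma> - a \<sigma>\<^sub>0) p = ch {0} (- a \<sigma>\<^sub>0) p * ch {0} (a \<sigma>) p"
proof -
  have m: "a \<sigma> - a \<sigma>\<^sub>0 \<in> S \<sigma>" using support_cut_out[OF s s0] by (simp add: cuts_out_def)
  show "laurent \<sigma> (ch \<sigma> (a \<sigma> - a \<sigma>\<^sub>0))" by (rule laurent_character[OF m])
  show "p \<in> U {0} \<Longrightarrow> ch \<sigma> (a \<sigma> - a \<sigma>\<^sub>0) p = ch {0} (- a \<sigma>\<^sub>0) p * ch {0} (a \<sigma>) p"
    using character_on_torus[OF _ _ m support_lattice[OF s] support_lattice[OF s0], of p] max_cone s by auto
qed

lemma support_section_sections:
  assumes s0: "\<sigma>\<^sub>0 \<in> \<M>"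
  shows "ch {0} (- a \<sigma>\<^sub>0) \<in> sections X support_divisor"
proof -
  have "\<exists>g. regular_on X (U \<sigma>) g \<and> rat_eq X g (\<lambda>x. ch {0} (- a \<sigma>\<^sub>0) x * ch {0} (a \<sigma>) x)" if s: "\<sigma> \<in> \<M>" for \<sigma>
  proof (intro exI conjI)
    show "regular_on X (U \<sigma>) (ch \<sigma> (a \<sigma> - a \<sigma>\<^sub>0))"
      by (rule laurent_regular[OF _ order_refl support_section(1)[OF s0 s]]) (use max_cone s in auto)
    show "rat_eq X (ch \<sigma> (a \<sigma> - a \<sigma>\<^sub>0)) (\<lambda>x. ch {0} (- a \<sigma>\<^sub>0) x * ch {0} (a \<sigma>) x)"
      unfolding rat_eq_def using zopen_chart[OF origin_cone] torus_nonempty support_section(2)[OF s0 s] by blast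
  qed
  moreover have "rational_fun X (ch {0} (- a \<sigma>\<^sub>0))"
    by (rule represents_rational(1)[of 1 _ "- a \<sigma>\<^sub>0"]) (simp_all add: support_lattice[OF s0] dual_lattice_uminus)
  ultimately show ?thesis unfolding sections_def support_divisor_def by auto
qed

text \<open>
On the chart of \<open>\<sigma>\<close> the section is, in terms of the local generator, the character of
\<open>a \<sigma> - a \<sigma>\<^sub>0\<close>. It vanishes at the points outside the chart of \<open>\<sigma> \<inter> \<sigma>\<^sub>0\<close>.
\<close>

lemma support_section_locus:
  assumes s0: "\<sigma>\<^sub>0 \<in> \<M>"
  shows "nonvanishing_locus X support_divisor (ch {0} (- a \<sigma>\<^sub>0)) = U \<sigma>\<^sub>0"
proof
  have S0: "\<sigma>\<^sub>0 \<in> \<Sigma>" using s0 max_cone by auto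
  show "nonvanishing_locus X support_divisor (ch {0} (- a \<sigma>\<^sub>0)) \<subseteq> U \<sigma>\<^sub>0"
  proof
    fix x assume "x \<in> nonvanishing_locus X support_divisor (ch {0} (- a \<sigma>\<^sub>0))"
    then obtain \<sigma> g where s: "\<sigma> \<in> \<M>" "x \<in> U \<sigma>" and g: "regular_on X (U \<sigma>) g" "g x \<noteq> 0"
      "rat_eq X g (\<lambda>x. ch {0} (- a \<sigma>\<^sub>0) x * ch {0} (a \<sigma>) x)"
      unfolding nonvanishing_locus_def support_divisor_def by auto
    have S: "\<sigma> \<in> \<Sigma>" using s max_cone by auto
    obtain W where W: "zopen X W" "W \<noteq> {}" "\<forall>x\<in>W. g x = ch {0} (- a \<sigma>\<^sub>0) x * ch {0} (a \<sigma>) x"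
      using g(3) unfolding rat_eq_def by blast
    have "g x = ch \<sigma> (a \<sigma> - a \<sigma>\<^sub>0) x"
      by (rule regular_identity[OF W(1,2) _ S support_section(1)[OF s0 s(1)] g(1) s(2)])
        (use W(3) support_section(2)[OF s0 s(1)] in auto)
    then have "x \<in> U (\<sigma> \<inter> \<sigma>\<^sub>0)"
      using g(2) chart_principal[OF S inter_cone[OF S S0] support_cut_out[OF s(1) s0] s(2)] by simp
    then show "x \<in> U \<sigma>\<^sub>0" using chart_inter[OF S S0] by auto
  qed
  show "U \<sigma>\<^sub>0 \<subseteq> nonvanishing_locus X support_divisor (ch {0} (- a \<sigma>\<^sub>0))"
  proof
    fix x assume x: "x \<in> U \<sigma>\<^sub>0"
    have "regular_on X (U \<sigma>\<^sub>0) (\<lambda>_. 1)" by (rule laurent_regular[OF S0 order_refl laurent_const])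
    moreover have "rat_eq X (\<lambda>_. 1) (\<lambda>x. ch {0} (- a \<sigma>\<^sub>0) x * ch {0} (a \<sigma>\<^sub>0) x)"
      unfolding rat_eq_def
      using zopen_chart[OF origin_cone] torus_nonempty character_torus_inverse[OF _ support_lattice[OF s0]] by fastforce
    moreover have "(1::complex) \<noteq> 0" by simp
    ultimately show "x \<in> nonvanishing_locus X support_divisor (ch {0} (- a \<sigma>\<^sub>0))"
      unfolding nonvanishing_locus_def support_divisor_def using x s0 by blast
  qed
qed

lemma support_divisor_ample: "ample X support_divisor"
  unfolding ample_def
proof
  fix x assume "x \<in> points X"
  then obtain \<sigma> where s: "\<sigma> \<in> \<M>" "x \<in> U \<sigma>" using points_max_charts by auto
  obtain gs where gs: "set gs \<subseteq> S \<sigma>" "\<And>m. m \<in> S \<sigma> \<Longrightarrow> \<exists>b. m = (\<Sum>j<length gs. real (b j) *\<^sub>R gs ! j)"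
    using finitely_generated[OF s(1)] by blast
  have "affine_open X (U \<sigma>)" by (rule chart_affine_open[OF _ gs]) (use s max_cone in auto)
  then show "\<exists>k\<ge>1. \<exists>s\<in>sections X (multiple_divisor k support_divisor).
      x \<in> nonvanishing_locus X (multiple_divisor k support_divisor) s \<and>
      affine_open X (nonvanishing_locus X (multiple_divisor k support_divisor) s)"
    using s support_section_sections[OF s(1)]
    by (intro exI[of _ 1] conjI bexI[of _ "ch {0} (- a \<sigma>)"])
      (simp_all only: multiple_one support_section_locus order_refl)
qed

theorem polarized_projective: "complete_fan N \<Sigma> \<Longrightarrow> projective_fan N \<Sigma>"
  unfolding projective_fan_def
  using represents_cartier[OF represents_support_divisor] support_divisor_invariant support_divisor_ample by blast

end

section \<open>Finite generation of dual monoids\<close>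

text \<open>
Dickson's lemma. By induction there is a finite set \<open>A1\<close> of elements that suffice for the coordinates in
\<open>B\<close>. They also suffice for every element whose new coordinate is at least \<open>K\<close>, and the remaining elements
form finitely many slices with constant new coordinate.
\<close>

lemma dickson:
  fixes f :: "'m \<Rightarrow> 'b \<Rightarrow> nat"
  assumes "finite B"
  shows "\<exists>A\<^sub>0\<subseteq>A. finite A\<^sub>0 \<and> (\<forall>a\<in>A. \<exists>a\<^sub>0\<in>A\<^sub>0. \<forall>b\<in>B. f a\<^sub>0 b \<le> f a b)"
  using assms
proof (induction B arbitrary: A rule: finite_induct)
  case empty
  show ?case
  proof (cases "A = {}")
    case False
    then obtain a where "a \<in> A" by auto
    then show ?thesis by (intro exI[of _ "{a}"]) auto
  qed auto
next
  case (insert b B)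
  obtain A1 where A1: "A1 \<subseteq> A" "finite A1" "\<And>a. a \<in> A \<Longrightarrow> \<exists>a\<^sub>0\<in>A1. \<forall>b\<in>B. f a\<^sub>0 b \<le> f a b"
    using insert.IH[of A] by blast
  \<comment> \<open>an upper bound for the new coordinate on \<open>A1\<close>\<close>
  define K where "K = (\<Sum>a\<in>A1. f a b)"
  have K: "f a b \<le> K" if "a \<in> A1" for a
    unfolding K_def using that A1(2) by (intro member_le_sum) auto
  have "\<exists>G. \<forall>v. G v \<subseteq> {a\<in>A. f a b = v} \<and> finite (G v) \<and>
      (\<forall>a\<in>{a\<in>A. f a b = v}. \<exists>a\<^sub>0\<in>G v. \<forall>b\<in>B. f a\<^sub>0 b \<le> f a b)"
    by (intro choice allI insert.IH)
  then obtain G where G0: "\<forall>v. G v \<subseteq> {a\<in>A. f a b = v} \<and> finite (G v) \<and>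
      (\<forall>a\<in>{a\<in>A. f a b = v}. \<exists>a\<^sub>0\<in>G v. \<forall>b\<in>B. f a\<^sub>0 b \<le> f a b)" by (rule exE)
  have G: "G v \<subseteq> {a\<in>A. f a b = v}" "finite (G v)"
    "a \<in> A \<Longrightarrow> f a b = v \<Longrightarrow> \<exists>a\<^sub>0\<in>G v. \<forall>b\<in>B. f a\<^sub>0 b \<le> f a b" for v a
    using spec[OF G0, of v] by auto
  show ?case
  proof (intro exI[of _ "A1 \<union> (\<Union>v<K. G v)"] conjI ballI)
    show "A1 \<union> (\<Union>v<K. G v) \<subseteq> A" using A1(1) G(1) by blast
    show "finite (A1 \<union> (\<Union>v<K. G v))" using A1(2) G(2) by simp
    fix a assume a: "a \<in> A"
    show "\<exists>a\<^sub>0\<in>A1 \<union> (\<Union>v<K. G v). \<forall>b'\<in>insert b B. f a\<^sub>0 b' \<le> f a b'"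
    proof (cases "f a b < K")
      case True
      obtain a0 where a0: "a0 \<in> G (f a b)" "\<forall>b\<in>B. f a0 b \<le> f a b" using G(3)[OF a refl] by blast
      moreover have "f a0 b = f a b" using G(1) a0(1) by blast
      ultimately show ?thesis using True by (intro bexI[of _ a0]) auto
    next
      case False
      obtain a0 where a0: "a0 \<in> A1" "\<forall>b\<in>B. f a0 b \<le> f a b" using A1(3)[OF a] by blast
      moreover have "f a0 b \<le> f a b" using K[OF a0(1)] False by simp
      ultimately show ?thesis by (intro bexI[of _ a0]) auto
    qed
  qed
qed

lemma Cone_finite:
  assumes "finite S"
  shows "Cone S = {\<Sum>b\<in>S. c b *\<^sub>R b | c. \<forall>b\<in>S. 0 \<le> c b}"
proof
  show "Cone S \<subseteq> {\<Sum>b\<in>S. c b *\<^sub>R b | c. \<forall>b\<in>S. 0 \<le> c b}"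
  proof
    fix x assume "x \<in> Cone S"
    then obtain F c where F: "finite F" "F \<subseteq> S" "\<forall>v\<in>F. 0 \<le> c v" "x = (\<Sum>v\<in>F. c v *\<^sub>R v)"
      by (auto simp: Cone_def)
    have "x = (\<Sum>v\<in>S. (if v \<in> F then c v else 0) *\<^sub>R v)"
      unfolding F(4) using F(2) assms by (intro sum.mono_neutral_cong_left) auto
    moreover have "\<forall>v\<in>S. 0 \<le> (if v \<in> F then c v else 0)" using F(3) by auto
    ultimately show "x \<in> {\<Sum>b\<in>S. c b *\<^sub>R b | c. \<forall>b\<in>S. 0 \<le> c b}"
      unfolding mem_Collect_eq by (intro exI[of _ "\<lambda>v. if v \<in> F then c v else 0"] conjI)
  qed
  show "{\<Sum>b\<in>S. c b *\<^sub>R b | c. \<forall>b\<in>S. 0 \<le> c b} \<subseteq> Cone S"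
    using assms unfolding Cone_def by blast
qed

lemma ConeI: "finite S \<Longrightarrow> (\<And>b. b \<in> S \<Longrightarrow> 0 \<le> c b) \<Longrightarrow> (\<Sum>b\<in>S. c b *\<^sub>R b) \<in> Cone S"
  unfolding Cone_finite by blast

lemma ConeE:
  assumes "finite S" "x \<in> Cone S"
  obtains c where "\<And>b. b \<in> S \<Longrightarrow> 0 \<le> c b" "x = (\<Sum>b\<in>S. c b *\<^sub>R b)"
  using assms unfolding Cone_finite[OF assms(1)] by blast

lemma zero_in_Cone: "0 \<in> Cone S"
  unfolding Cone_def by (auto intro!: exI[of _ "{}"])

lemma Cone_empty: "Cone {} = {0}"
  unfolding Cone_def by auto

lemma Cone_mono: "S \<subseteq> T \<Longrightarrow> Cone S \<subseteq> Cone T"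
  unfolding Cone_def by blast

lemma Cone_add:
  assumes S: "finite S" and x: "x \<in> Cone S" and y: "y \<in> Cone S"
  shows "x + y \<in> Cone S"
proof -
  obtain c where c: "\<And>b. b \<in> S \<Longrightarrow> 0 \<le> c b" "x = (\<Sum>b\<in>S. c b *\<^sub>R b)" by (rule ConeE[OF S x]) (rule that)
  obtain d where d: "\<And>b. b \<in> S \<Longrightarrow> 0 \<le> d b" "y = (\<Sum>b\<in>S. d b *\<^sub>R b)" by (rule ConeE[OF S y]) (rule that)
  show ?thesis
    using ConeI[of S "\<lambda>b. c b + d b"] S c d by (simp add: scaleR_add_left sum.distrib)
qed

lemma Cone_scale:
  assumes S: "finite S" and x: "x \<in> Cone S" and r: "0 \<le> r"
  shows "r *\<^sub>R x \<in> Cone S"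
proof -
  obtain c where c: "\<And>b. b \<in> S \<Longrightarrow> 0 \<le> c b" "x = (\<Sum>b\<in>S. c b *\<^sub>R b)" by (rule ConeE[OF S x]) (rule that)
  show ?thesis
    using ConeI[of S "\<lambda>b. r * c b"] S c r by (simp add: scaleR_sum_right)
qed

lemma Cone_minimal:
  assumes "S \<subseteq> K" "0 \<in> K" "\<And>x y. x \<in> K \<Longrightarrow> y \<in> K \<Longrightarrow> x + y \<in> K"
    and "\<And>r x. 0 \<le> r \<Longrightarrow> x \<in> K \<Longrightarrow> r *\<^sub>R x \<in> K"
  shows "Cone S \<subseteq> K"
proof
  fix x assume "x \<in> Cone S"
  then obtain F c where F: "finite F" "F \<subseteq> S" "\<forall>v\<in>F. 0 \<le> c v" "x = (\<Sum>v\<in>F. c v *\<^sub>R v)"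
    by (auto simp: Cone_def)
  have "(\<Sum>v\<in>F. c v *\<^sub>R v) \<in> K"
    using F(1-3) by (induction F rule: finite_induct) (use assms in auto)
  then show "x \<in> K" using F(4) by simp
qed

lemma Cone_base: "b \<in> S \<Longrightarrow> b \<in> Cone S"
  unfolding Cone_def by (auto intro!: exI[of _ "{b}"] exI[of _ "\<lambda>_. 1"])

lemma Cone_span: "Cone S \<subseteq> span S"
  by (rule Cone_minimal) (auto intro: span_base span_zero span_add span_scale)

lemma Cone_inner_nonneg: "(\<And>b. b \<in> S \<Longrightarrow> 0 \<le> w \<bullet> b) \<Longrightarrow> x \<in> Cone S \<Longrightarrow> 0 \<le> w \<bullet> x"
  using Cone_minimal[of S "{x. 0 \<le> w \<bullet> x}"] by (auto simp: inner_add_right)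

lemma dual_monoid_Cone: "dual_monoid N (Cone S) = {m\<in>dual_lattice N. \<forall>b\<in>S. 0 \<le> m \<bullet> b}"
  unfolding dual_monoid_def using Cone_base Cone_inner_nonneg by blast

lemma convex_Cone: "finite S \<Longrightarrow> convex (Cone S)"
  unfolding convex_def by (auto intro: Cone_add Cone_scale)

lemma face_of_Cone_cone:
  assumes S: "finite S" and f: "\<tau> face_of Cone S" and x: "x \<in> \<tau>"
  shows "0 \<in> \<tau>" and "0 \<le> r \<Longrightarrow> r *\<^sub>R x \<in> \<tau>"
proof -
  have xC: "x \<in> Cone S" using f x by (auto simp: face_of_def)
  have seg: "0 \<in> \<tau> \<and> s *\<^sub>R x \<in> \<tau>" if "s > 1" "x \<noteq> 0" for s
  proof -
    have "x \<in> open_segment 0 (s *\<^sub>R x)"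
      using that unfolding in_segment by (auto intro!: exI[of _ "1 / s"])
    then show ?thesis
      using f x zero_in_Cone Cone_scale[OF S xC, of s] that unfolding face_of_def by (meson less_imp_le order_trans zero_le_one)
  qed
  show z: "0 \<in> \<tau>" using seg[of 2] x by (cases "x = 0") auto
  show "r *\<^sub>R x \<in> \<tau>" if r: "0 \<le> r"
  proof (cases "r \<le> 1")
    case True
    have "convex \<tau>" using f by (simp add: face_of_def)
    then have "r *\<^sub>R x + (1 - r) *\<^sub>R 0 \<in> \<tau>" using x z r True unfolding convex_def by (metis add.commute diff_add_cancel diff_ge_0_iff_ge)
    then show ?thesis by simp
  next
    case False
    then show ?thesis using seg[of r] z by (cases "x = 0") auto
  qed
qed

text \<open>
The sum is the midpoint of \<open>2 u\<close> and \<open>2 v\<close>.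
\<close>

lemma face_of_Cone_summand:
  assumes S: "finite S" and f: "\<tau> face_of Cone S" and x: "u + v \<in> \<tau>" "u \<in> Cone S" "v \<in> Cone S"
  shows "u \<in> \<tau>"
proof (cases "u = v")
  case True
  then have "u + v = 2 *\<^sub>R u" by (simp add: scaleR_2)
  then show ?thesis using face_of_Cone_cone(2)[OF S f x(1), of "1/2"] by simp
next
  case False
  have "u + v \<in> open_segment (2 *\<^sub>R u) (2 *\<^sub>R v)"
    using False unfolding in_segment by (auto intro!: exI[of _ "1/2"])
  moreover have "2 *\<^sub>R u \<in> Cone S" "2 *\<^sub>R v \<in> Cone S" using Cone_scale[OF S] x by auto
  ultimately have "2 *\<^sub>R u \<in> \<tau>" using f x(1) unfolding face_of_def by blast
  then show ?thesis using face_of_Cone_cone(2)[OF S f, of "2 *\<^sub>R u" "1/2"] by simp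
qed

text \<open>
With a nonnegative combination, a face contains each of its terms.
\<close>

lemma face_of_Cone:
  assumes S: "finite S" and f: "\<tau> face_of Cone S" and ne: "\<tau> \<noteq> {}"
  shows "\<tau> = Cone (S \<inter> \<tau>)"
proof
  have conv: "convex \<tau>" using f by (simp add: face_of_def)
  show "Cone (S \<inter> \<tau>) \<subseteq> \<tau>"
  proof (rule Cone_minimal)
    fix x y assume "x \<in> \<tau>" "y \<in> \<tau>"
    then have "(1/2) *\<^sub>R x + (1/2) *\<^sub>R y \<in> \<tau>" using conv by (intro convexD) auto
    from face_of_Cone_cone(2)[OF S f this, of 2] show "x + y \<in> \<tau>" by (simp add: scaleR_add_right)
  qed (use face_of_Cone_cone[OF S f] ne in auto)
  show "\<tau> \<subseteq> Cone (S \<inter> \<tau>)"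
  proof
    fix x assume x: "x \<in> \<tau>"
    then have xC: "x \<in> Cone S" using f by (auto simp: face_of_def)
    obtain c where c: "\<And>b. b \<in> S \<Longrightarrow> 0 \<le> c b" "x = (\<Sum>b\<in>S. c b *\<^sub>R b)" by (rule ConeE[OF S xC]) (rule that)
    have "b \<in> \<tau>" if b: "b \<in> S" "c b \<noteq> 0" for b
    proof -
      have "x = c b *\<^sub>R b + (\<Sum>b\<in>S - {b}. c b *\<^sub>R b)" unfolding c(2) by (rule sum.remove[OF S b(1)])
      moreover have "c b *\<^sub>R b \<in> Cone S" using Cone_scale[OF S Cone_base[OF b(1)] c(1)[OF b(1)]] .
      moreover have "(\<Sum>b\<in>S - {b}. c b *\<^sub>R b) \<in> Cone S"
        using ConeI[of "S - {b}" c] c(1) S Cone_mono[of "S - {b}" S] by auto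
      ultimately have "c b *\<^sub>R b \<in> \<tau>" using face_of_Cone_summand[OF S f] x by metis
      from face_of_Cone_cone(2)[OF S f this, of "1 / c b"] show ?thesis using b c(1)[OF b(1)] by simp
    qed
    then have "x = (\<Sum>b\<in>S \<inter> \<tau>. c b *\<^sub>R b)"
      unfolding c(2) using S by (intro sum.mono_neutral_right) auto
    then show "x \<in> Cone (S \<inter> \<tau>)" using ConeI[of "S \<inter> \<tau>" c] S c(1) by simp
  qed
qed

lemma Cone_face_of:
  assumes S: "finite S" "T \<subseteq> S" and w: "\<And>b. b \<in> T \<Longrightarrow> w \<bullet> b = 0" "\<And>b. b \<in> S - T \<Longrightarrow> 0 < w \<bullet> b"
  shows "Cone T face_of Cone S"
proof -
  have nonneg: "0 \<le> w \<bullet> b" if "b \<in> S" for b using w[of b] that by (cases "b \<in> T") auto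
  have "Cone T = Cone S \<inter> {x. w \<bullet> x = 0}"
  proof
    show "Cone T \<subseteq> Cone S \<inter> {x. w \<bullet> x = 0}"
      using S w(1) Cone_base by (intro Cone_minimal) (auto intro: zero_in_Cone Cone_add Cone_scale simp: inner_add_right)
    show "Cone S \<inter> {x. w \<bullet> x = 0} \<subseteq> Cone T"
    proof
      fix x assume x: "x \<in> Cone S \<inter> {x. w \<bullet> x = 0}"
      then have xC: "x \<in> Cone S" by simp
      obtain c where c: "\<And>b. b \<in> S \<Longrightarrow> 0 \<le> c b" "x = (\<Sum>b\<in>S. c b *\<^sub>R b)" by (rule ConeE[OF S(1) xC]) (rule that)
      have "(\<Sum>b\<in>S. c b * (w \<bullet> b)) = 0" using x unfolding c(2) by (simp add: inner_sum_right)
      then have "\<forall>b\<in>S. c b * (w \<bullet> b) = 0"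
        using sum_nonneg_eq_0_iff[OF S(1), of "\<lambda>b. c b * (w \<bullet> b)"] c(1) nonneg by simp
      then have "c b = 0" if "b \<in> S - T" for b using that w(2)[OF that] by auto
      then have "x = (\<Sum>b\<in>T. c b *\<^sub>R b)"
        unfolding c(2) using S by (intro sum.mono_neutral_right) auto
      then show "x \<in> Cone T" using ConeI[of T c] finite_subset[OF S(2,1)] c(1) S(2) by auto
    qed
  qed
  then show ?thesis
    using face_of_Int_supporting_hyperplane_ge[OF convex_Cone[OF S(1)], where a=w and b=0] Cone_inner_nonneg[OF nonneg] by auto
qed

lemma large_multiple:
  assumes "finite T" "\<And>b. b \<in> T \<Longrightarrow> 0 < w \<bullet> b"
  shows "\<exists>k. \<forall>b\<in>T. 0 \<le> (m + real k *\<^sub>R w) \<bullet> b"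
  using assms
proof (induction T rule: finite_induct)
  case (insert b T)
  then obtain k where k: "\<forall>b\<in>T. 0 \<le> (m + real k *\<^sub>R w) \<bullet> b" by auto
  obtain l where l: "\<bar>m \<bullet> b\<bar> / (w \<bullet> b) \<le> real l" using real_arch_simple by blast
  have wb: "0 < w \<bullet> b'" if "b' \<in> insert b T" for b' using insert.prems that by blast
  have "0 \<le> (m + real (k + l) *\<^sub>R w) \<bullet> b'" if b': "b' \<in> insert b T" for b'
  proof (cases "b' = b")
    case True
    have "\<bar>m \<bullet> b\<bar> \<le> real l * (w \<bullet> b)" using l wb[of b] by (simp add: field_simps)
    moreover have "0 \<le> real k * (w \<bullet> b)" using wb[of b] by simp
    ultimately show ?thesis using True by (simp add: inner_add_left algebra_simps)
  next
    case False
    then have "0 \<le> (m + real k *\<^sub>R w) \<bullet> b'" using k b' by auto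
    moreover have "0 \<le> real l * (w \<bullet> b')" using wb[OF b'] by simp
    ultimately show ?thesis by (simp add: inner_add_left algebra_simps)
  qed
  then show ?case by blast
qed auto

lemma cuts_out_Cone:
  assumes S: "finite S" "T \<subseteq> S" and w: "w \<in> dual_lattice N" "\<And>b. b \<in> T \<Longrightarrow> w \<bullet> b = 0" "\<And>b. b \<in> S - T \<Longrightarrow> 0 < w \<bullet> b"
  shows "cuts_out N (Cone S) (Cone T) w"
  unfolding cuts_out_def
proof (intro conjI ballI)
  have "0 \<le> w \<bullet> b" if "b \<in> S" for b using w(2,3)[of b] that by (cases "b \<in> T") auto
  then show wS: "w \<in> dual_monoid N (Cone S)" using w(1) by (simp add: dual_monoid_Cone)
  show "Cone T \<subseteq> Cone S" by (rule Cone_mono[OF S(2)])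
  show "w \<bullet> x = 0" if "x \<in> Cone T" for x
    using Cone_minimal[of T "{x. w \<bullet> x = 0}"] w(2) that by (auto simp: inner_add_right)
  fix m' assume m': "m' \<in> dual_monoid N (Cone T)"
  obtain k where k: "\<forall>b\<in>S - T. 0 \<le> (m' + real k *\<^sub>R w) \<bullet> b"
    using large_multiple[of "S - T" w m'] w(3) S(1) by auto
  have "0 \<le> (m' + real k *\<^sub>R w) \<bullet> b" if "b \<in> S" for b
    using that k m' w(2) by (cases "b \<in> T") (auto simp: dual_monoid_Cone inner_add_left)
  moreover have "m' + real k *\<^sub>R w \<in> dual_lattice N"
    using m' dual_monoid_subset dual_monoid_scale[OF wS] by (blast intro: dual_lattice_add)
  ultimately show "\<exists>k. m' + real k *\<^sub>R w \<in> dual_monoid N (Cone S)" unfolding dual_monoid_Cone by blast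
qed

text \<open>
Gordan's lemma. The values at the elements of \<open>B\<close> embed the dual monoid into \<open>\<nat>\<^sup>B\<close>, as \<open>B\<close> spans. If one
element is coordinatewise below another, the difference belongs to the dual monoid too, so the minimal
nonzero elements generate it, and there are finitely many by Dickson's lemma.
\<close>

lemma gordan:
  fixes B N :: "'a::euclidean_space set"
  assumes B: "finite B" "B \<subseteq> N" "span B = span N"
  shows "\<exists>gs. set gs \<subseteq> dual_monoid N (Cone B) \<and>
      (\<forall>m\<in>dual_monoid N (Cone B). \<exists>c. m = (\<Sum>j<length gs. real (c j) *\<^sub>R gs ! j))"
proof -
  let ?S = "dual_monoid N (Cone B)"
  define f where "f m b = nat \<lfloor>m \<bullet> b\<rfloor>" for m b :: 'a
  have f: "m \<bullet> b = real (f m b)" if "m \<in> ?S" "b \<in> B" for m b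
  proof -
    have "m \<bullet> b \<in> \<int>" "0 \<le> m \<bullet> b" using that B(2) by (auto simp: dual_monoid_Cone dual_lattice_def)
    then show ?thesis by (auto simp: f_def elim!: Ints_cases)
  qed
  obtain A0 where A0: "A0 \<subseteq> ?S - {0}" "finite A0"
    "\<And>a. a \<in> ?S - {0} \<Longrightarrow> \<exists>a0\<in>A0. \<forall>b\<in>B. f a0 b \<le> f a b"
    using dickson[OF B(1), of "?S - {0}" f] by blast
  obtain gs where gs: "set gs = A0" using finite_list[OF A0(2)] by blast
  have "\<exists>c. m = (\<Sum>j<length gs. real (c j) *\<^sub>R gs ! j)" if "m \<in> ?S" for m
    using that
  proof (induction "\<Sum>b\<in>B. f m b" arbitrary: m rule: less_induct)
    case less
    show ?case
    proof (cases "m = 0")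
      case True
      then show ?thesis by (intro exI[of _ "\<lambda>_. 0"]) simp
    next
      case False
      obtain a0 where a0: "a0 \<in> A0" "\<forall>b\<in>B. f a0 b \<le> f m b" using A0(3) less.prems False by blast
      have a0S: "a0 \<in> ?S" "a0 \<noteq> 0" using a0 A0(1) by auto
      have dS: "m - a0 \<in> ?S"
        using less.prems a0S(1) a0(2) f[OF less.prems] f[OF a0S(1)]
        by (auto simp: dual_monoid_Cone inner_diff_left intro!: dual_lattice_diff)
      have sub: "f m b = f (m - a0) b + f a0 b" if "b \<in> B" for b
      proof -
        have "real (f m b) = real (f (m - a0) b) + real (f a0 b)"
          unfolding f[OF less.prems that, symmetric] f[OF dS that, symmetric] f[OF a0S(1) that, symmetric]
          by (simp add: inner_diff_left)
        then show ?thesis by linarith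
      qed
      have "\<exists>b\<in>B. f a0 b \<noteq> 0"
      proof (rule ccontr)
        assume "\<not> (\<exists>b\<in>B. f a0 b \<noteq> 0)"
        then have "orthogonal a0 b" if "b \<in> B" for b using f[OF a0S(1) that] that by (simp add: orthogonal_def)
        moreover have "a0 \<in> span B" using a0S(1) B(3) by (simp add: dual_monoid_def dual_lattice_def)
        ultimately have "orthogonal a0 a0" using orthogonal_to_span by blast
        then show False using a0S(2) by (simp add: orthogonal_def)
      qed
      then have "0 < (\<Sum>b\<in>B. f a0 b)" using B(1) by (auto simp: sum_pos2)
      moreover have "(\<Sum>b\<in>B. f m b) = (\<Sum>b\<in>B. f (m - a0) b) + (\<Sum>b\<in>B. f a0 b)"
        by (simp add: sub sum.distrib)
      ultimately obtain c where c: "m - a0 = (\<Sum>j<length gs. real (c j) *\<^sub>R gs ! j)"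
        using less.hyps[OF _ dS] by auto
      obtain i where i: "i < length gs" "gs ! i = a0" using a0(1) gs by (metis in_set_conv_nth)
      have "(\<Sum>j<length gs. real (c j + (if j = i then 1 else 0)) *\<^sub>R gs ! j) = (m - a0) + a0"
        using i unfolding c by (simp add: scaleR_add_left sum.distrib if_distrib[of "\<lambda>x. x *\<^sub>R _"] if_distrib[of real] cong: if_cong)
      then have "(\<Sum>j<length gs. real (c j + (if j = i then 1 else 0)) *\<^sub>R gs ! j) = m" by simp
      note e = this[symmetric]
      show ?thesis by (rule exI, rule e)
    qed
  qed
  then show ?thesis using gs A0(1) by (intro exI[of _ gs]) auto
qed

section \<open>Fans of normal cones\<close>

text \<open>
The normal fan of the convex hull of a finite set \<open>V\<close> of points of the dual lattice, in the case where
the normal cone of every point of \<open>V\<close> is full-dimensional and simplicial. The dual vectors express the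
linear independence of the generators in integral form.
\<close>

locale simplicial_normal_fan =
  fixes N :: "'a::euclidean_space set" and V :: "'a set" and B :: "'a \<Rightarrow> 'a set"
  assumes finite_vertices: "finite V" and vertices_nonempty: "V \<noteq> {}" and vertices_lattice: "V \<subseteq> dual_lattice N"
    and finite_generators: "m \<in> V \<Longrightarrow> finite (B m)"
    and generators_lattice: "m \<in> V \<Longrightarrow> B m \<subseteq> N"
    and generators_span: "m \<in> V \<Longrightarrow> span (B m) = span N"
    and dual_vector: "m \<in> V \<Longrightarrow> b \<in> B m \<Longrightarrow> \<exists>d\<in>dual_lattice N. 0 < d \<bullet> b \<and> (\<forall>b'\<in>B m - {b}. d \<bullet> b' = 0)"
    and normal_cone: "m \<in> V \<Longrightarrow> Cone (B m) = {x\<in>span N. \<forall>m'\<in>V. m' \<bullet> x \<le> m \<bullet> x}"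
begin

definition cones :: "'a set set" where
  "cones = {\<tau>. \<tau> \<noteq> {} \<and> (\<exists>m\<in>V. \<tau> face_of Cone (B m))}"

lemma cut_vector:
  assumes m: "m \<in> V" "S \<subseteq> B m"
  obtains w where "w \<in> dual_lattice N" "\<And>b. b \<in> B m - S \<Longrightarrow> w \<bullet> b = 0" "\<And>b. b \<in> S \<Longrightarrow> 0 < w \<bullet> b"
proof -
  have S: "finite S" using finite_generators[OF m(1)] m(2) finite_subset by blast
  have "\<exists>d. \<forall>b\<in>B m. d b \<in> dual_lattice N \<and> 0 < d b \<bullet> b \<and> (\<forall>b'\<in>B m - {b}. d b \<bullet> b' = 0)"
    by (rule bchoice) (use dual_vector[OF m(1)] in blast)
  then obtain d where d: "\<And>b. b \<in> B m \<Longrightarrow> d b \<in> dual_lattice N" "\<And>b. b \<in> B m \<Longrightarrow> 0 < d b \<bullet> b"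
    "\<And>b b'. b \<in> B m \<Longrightarrow> b' \<in> B m \<Longrightarrow> b' \<noteq> b \<Longrightarrow> d b \<bullet> b' = 0" by blast
  define w where "w = (\<Sum>b\<in>S. d b)"
  have "w \<in> dual_lattice N"
  proof -
    have "(\<Sum>b\<in>T. d b) \<in> dual_lattice N" if "finite T" "T \<subseteq> B m" for T
      using that by (induction T rule: finite_induct) (auto intro: dual_lattice_zero dual_lattice_add d(1))
    then show ?thesis using S m(2) by (simp add: w_def)
  qed
  moreover have "w \<bullet> b = (if b \<in> S then d b \<bullet> b else 0)" if b: "b \<in> B m" for b
  proof -
    have "w \<bullet> b = (\<Sum>b'\<in>S. if b' = b then d b \<bullet> b else 0)"
      unfolding w_def inner_sum_left using d(3)[OF _ b] m(2) by (intro sum.cong) auto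
    then show ?thesis using S by simp
  qed
  ultimately show ?thesis
    using d(2) m(2) by (intro that[of w]) auto
qed

lemma subset_face:
  assumes "m \<in> V" "S \<subseteq> B m" "T \<subseteq> S"
  shows "Cone T face_of Cone S"
proof -
  obtain w where "w \<in> dual_lattice N" "\<And>b. b \<in> B m - (B m - T) \<Longrightarrow> w \<bullet> b = 0" "\<And>b. b \<in> B m - T \<Longrightarrow> 0 < w \<bullet> b"
    using cut_vector[OF assms(1), of "B m - T"] by blast
  then show ?thesis
    using assms finite_subset[OF assms(2) finite_generators[OF assms(1)]] by (intro Cone_face_of[of S T w]) auto
qed

lemma cones_iff: "\<sigma> \<in> cones \<longleftrightarrow> (\<exists>m\<in>V. \<exists>S\<subseteq>B m. \<sigma> = Cone S)"
proof
  assume "\<sigma> \<in> cones"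
  then obtain m where m: "m \<in> V" "\<sigma> face_of Cone (B m)" "\<sigma> \<noteq> {}" by (auto simp: cones_def)
  then have "\<sigma> = Cone (B m \<inter> \<sigma>)" using face_of_Cone finite_generators by blast
  then show "\<exists>m\<in>V. \<exists>S\<subseteq>B m. \<sigma> = Cone S" using m(1) by blast
next
  assume "\<exists>m\<in>V. \<exists>S\<subseteq>B m. \<sigma> = Cone S"
  then show "\<sigma> \<in> cones" unfolding cones_def using subset_face zero_in_Cone by blast
qed

lemma conesE:
  assumes "\<sigma> \<in> cones"
  obtains m S where "m \<in> V" "S \<subseteq> B m" "finite S" "\<sigma> = Cone S"
  using assms finite_generators finite_subset unfolding cones_iff by metis

lemma normal_cones_agree:
  assumes "m \<in> V" "m' \<in> V" "x \<in> Cone (B m)" "x \<in> Cone (B m')"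
  shows "(m - m') \<bullet> x = 0"
proof -
  have "m' \<bullet> x \<le> m \<bullet> x" "m \<bullet> x \<le> m' \<bullet> x"
    using assms(3,4) assms(1,2) unfolding normal_cone[OF assms(1)] normal_cone[OF assms(2)] by blast+
  then show ?thesis by (simp add: inner_diff_left)
qed

lemma normal_cones_inter_face:
  assumes "m \<in> V" "m' \<in> V"
  shows "Cone (B m) \<inter> Cone (B m') face_of Cone (B m)"
proof -
  have e: "Cone (B m) \<inter> Cone (B m') = Cone (B m) \<inter> {x. (m - m') \<bullet> x = 0}"
  proof
    show "Cone (B m) \<inter> Cone (B m') \<subseteq> Cone (B m) \<inter> {x. (m - m') \<bullet> x = 0}"
      using normal_cones_agree[OF assms] by auto
    show "Cone (B m) \<inter> {x. (m - m') \<bullet> x = 0} \<subseteq> Cone (B m) \<inter> Cone (B m')"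
      using assms by (auto simp: normal_cone inner_diff_left)
  qed
  have "\<And>x. x \<in> Cone (B m) \<Longrightarrow> 0 \<le> (m - m') \<bullet> x"
    using assms by (auto simp: normal_cone inner_diff_left)
  then show ?thesis
    unfolding e using face_of_Int_supporting_hyperplane_ge[OF convex_Cone[OF finite_generators[OF assms(1)]], where a="m - m'" and b=0] by auto
qed

text \<open>
Two normal cones meet where the inner products with the two points agree, which defines a face of
both. For the general case the faces of one cone that lie in this common face are faces of the other.
\<close>

lemma cones_inter_face:
  assumes "\<sigma> \<in> cones" "\<tau> \<in> cones"
  shows "\<sigma> \<inter> \<tau> face_of \<sigma>"
proof -
  obtain m where m: "m \<in> V" "\<sigma> face_of Cone (B m)" using assms(1) by (auto simp: cones_def)
  obtain m' where m': "m' \<in> V" "\<tau> face_of Cone (B m')" using assms(2) by (auto simp: cones_def)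
  let ?K = "Cone (B m) \<inter> Cone (B m')"
  have K: "?K face_of Cone (B m)" "?K face_of Cone (B m')"
    using normal_cones_inter_face[OF m(1) m'(1)] normal_cones_inter_face[OF m'(1) m(1)] by (auto simp: Int_commute)
  have "\<tau> \<inter> ?K face_of Cone (B m')" using m'(2) K(2) by (rule face_of_Int)
  then have "\<tau> \<inter> ?K face_of ?K" by (rule face_of_subset) auto
  then have "\<tau> \<inter> ?K face_of Cone (B m)" using K(1) face_of_trans by blast
  then have "\<sigma> \<inter> (\<tau> \<inter> ?K) face_of Cone (B m)" using m(2) face_of_Int by blast
  moreover have "\<sigma> \<inter> (\<tau> \<inter> ?K) = \<sigma> \<inter> \<tau>" using m(2) m'(2) by (auto simp: face_of_def)
  ultimately have "\<sigma> \<inter> \<tau> face_of Cone (B m)" by simp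
  then show ?thesis by (rule face_of_subset) (use m(2) in \<open>auto simp: face_of_def\<close>)
qed

lemma zero_in_cones: "\<sigma> \<in> cones \<Longrightarrow> 0 \<in> \<sigma>"
  unfolding cones_iff using zero_in_Cone by auto

lemma cones_inter: "\<sigma> \<in> cones \<Longrightarrow> \<tau> \<in> cones \<Longrightarrow> \<sigma> \<inter> \<tau> \<in> cones"
proof -
  assume a: "\<sigma> \<in> cones" "\<tau> \<in> cones"
  obtain m where m: "m \<in> V" "\<sigma> face_of Cone (B m)" using a(1) by (auto simp: cones_def)
  have "\<sigma> \<inter> \<tau> face_of Cone (B m)" using cones_inter_face[OF a] m(2) face_of_trans by blast
  moreover have "\<sigma> \<inter> \<tau> \<noteq> {}" using zero_in_cones a by blast
  ultimately show ?thesis using m(1) by (auto simp: cones_def)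
qed

lemma finite_cones: "finite cones"
proof -
  have "cones \<subseteq> (\<Union>m\<in>V. Cone ` Pow (B m))" unfolding cones_iff subset_iff by blast
  then show ?thesis using finite_subset finite_vertices finite_generators by (metis (no_types, lifting) finite_UN finite_imageI finite_Pow_iff)
qed

lemma Cone_subset_span: "m \<in> V \<Longrightarrow> S \<subseteq> B m \<Longrightarrow> Cone S \<subseteq> span N"
  using Cone_span[of S] span_mono[of S "B m"] generators_span by blast

lemma generator_coefficient:
  assumes m: "m \<in> V" "S \<subseteq> B m" "b \<in> S"
  obtains d where "\<And>c. d \<bullet> (\<Sum>b\<in>S. c b *\<^sub>R b) = c b" "\<And>b'. b' \<in> S \<Longrightarrow> 0 \<le> d \<bullet> b'"
proof -
  have S: "finite S" using finite_generators[OF m(1)] m(2) finite_subset by blast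
  obtain d where d: "0 < d \<bullet> b" "\<forall>b'\<in>B m - {b}. d \<bullet> b' = 0" using dual_vector[OF m(1)] m by blast
  define e where "e = (1 / (d \<bullet> b)) *\<^sub>R d"
  have eS: "e \<bullet> b' = (if b' = b then 1 else 0)" if "b' \<in> S" for b'
    using d that m(2) by (auto simp: e_def)
  show ?thesis
  proof (rule that[of e])
    show "e \<bullet> (\<Sum>b\<in>S. c b *\<^sub>R b) = c b" for c
    proof -
      have "e \<bullet> (\<Sum>b\<in>S. c b *\<^sub>R b) = (\<Sum>b'\<in>S. if b' = b then c b else 0)"
        unfolding inner_sum_right inner_scaleR_right by (intro sum.cong refl) (simp add: eS)
      also have "\<dots> = c b" using S m(3) by simp
      finally show ?thesis .
    qed
    show "0 \<le> e \<bullet> b'" if "b' \<in> S" for b' unfolding eS[OF that] by simp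
  qed
qed

lemma generators_independent:
  assumes "m \<in> V" "S \<subseteq> B m"
  shows "independent S"
proof (rule independent_if_scalars_zero)
  show "finite S" using assms finite_generators finite_subset by blast
  fix c b assume z: "(\<Sum>x\<in>S. c x *\<^sub>R x) = 0" and b: "b \<in> S"
  obtain d where d: "\<And>c. d \<bullet> (\<Sum>b\<in>S. c b *\<^sub>R b) = c b" "\<And>b'. b' \<in> S \<Longrightarrow> 0 \<le> d \<bullet> b'"
    by (rule generator_coefficient[OF assms b]) (rule that)
  from d(1)[of c] show "c b = 0" by (simp add: z)
qed

lemma cones_strongly_convex:
  assumes "\<sigma> \<in> cones"
  shows "strongly_convex_cone \<sigma>"
proof -
  obtain m S where m: "m \<in> V" "S \<subseteq> B m" "finite S" "\<sigma> = Cone S" by (rule conesE[OF assms])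
  have "x = 0" if x: "x \<in> Cone S" "- x \<in> Cone S" for x
  proof -
    obtain c where c: "\<And>b. b \<in> S \<Longrightarrow> 0 \<le> c b" "x = (\<Sum>b\<in>S. c b *\<^sub>R b)" by (rule ConeE[OF m(3) x(1)]) (rule that)
    have "c b = 0" if b: "b \<in> S" for b
    proof -
      obtain d where d: "\<And>c. d \<bullet> (\<Sum>b\<in>S. c b *\<^sub>R b) = c b" "\<And>b'. b' \<in> S \<Longrightarrow> 0 \<le> d \<bullet> b'"
        by (rule generator_coefficient[OF m(1,2) b]) (rule that)
      have "0 \<le> d \<bullet> (- x)" using Cone_inner_nonneg[OF d(2) x(2)] .
      then show ?thesis using d(1)[of c] c(1)[OF b] unfolding c(2)[symmetric] by simp
    qed
    then show ?thesis unfolding c(2) by simp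
  qed
  then show ?thesis unfolding strongly_convex_cone_def m(4) using zero_in_Cone by (auto simp: image_iff)
qed

lemma fan_cones: "fan N cones"
  unfolding fan_def
proof (intro conjI ballI allI impI)
  show "finite cones" by (rule finite_cones)
  show "rational_polyhedral_cone N \<sigma>" if "\<sigma> \<in> cones" for \<sigma>
    using that generators_lattice unfolding rational_polyhedral_cone_def by (meson conesE subset_trans)
  show "strongly_convex_cone \<sigma>" if "\<sigma> \<in> cones" for \<sigma> by (rule cones_strongly_convex[OF that])
  show "\<tau> \<in> cones" if "\<sigma> \<in> cones" "\<tau> face_of \<sigma> \<and> \<tau> \<noteq> {}" for \<sigma> \<tau>
    using that face_of_trans unfolding cones_def by blast
  show "\<sigma> \<inter> \<tau> face_of \<sigma>" if "\<sigma> \<in> cones" "\<tau> \<in> cones" for \<sigma> \<tau> by (rule cones_inter_face[OF that])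
  show "\<sigma> \<inter> \<tau> face_of \<tau>" if "\<sigma> \<in> cones" "\<tau> \<in> cones" for \<sigma> \<tau>
    using cones_inter_face[OF that(2,1)] by (simp add: Int_commute)
qed

lemma simplicial_cones: "simplicial cones"
  unfolding simplicial_def using conesE generators_independent by metis

lemma max_cone_mem: "m \<in> V \<Longrightarrow> Cone (B m) \<in> cones"
  unfolding cones_iff by blast

lemma complete_cones: "complete_fan N cones"
  unfolding complete_fan_def
proof
  show "fan N cones" by (rule fan_cones)
  show "\<Union>cones = span N"
  proof
    show "\<Union>cones \<subseteq> span N"
    proof (rule Union_least)
      fix \<sigma> assume "\<sigma> \<in> cones"
      then show "\<sigma> \<subseteq> span N" using Cone_subset_span by (auto simp: cones_iff)
    qed
    show "span N \<subseteq> \<Union>cones"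
    proof
      fix x assume x: "x \<in> span N"
      have "Max ((\<lambda>m. m \<bullet> x) ` V) \<in> (\<lambda>m. m \<bullet> x) ` V"
        using finite_vertices vertices_nonempty by (intro Max_in) auto
      then obtain m where m: "m \<in> V" "Max ((\<lambda>m. m \<bullet> x) ` V) = m \<bullet> x" by auto
      have "m' \<bullet> x \<le> m \<bullet> x" if "m' \<in> V" for m'
        unfolding m(2)[symmetric] using finite_vertices that by (intro Max_ge) auto
      then have "x \<in> Cone (B m)" using normal_cone[OF m(1)] x by blast
      then show "x \<in> \<Union>cones" using max_cone_mem[OF m(1)] by blast
    qed
  qed
qed

text \<open>
On the smaller cone both points have the same inner products, and this cone spans.
\<close>

lemma normal_cone_subset:
  assumes "m \<in> V" "m' \<in> V" "Cone (B m) \<subseteq> Cone (B m')"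
  shows "m = m'"
proof -
  have "orthogonal (m - m') b" if "b \<in> B m" for b
  proof -
    have "b \<in> Cone (B m)" "b \<in> Cone (B m')" using Cone_base[OF that] assms(3) by auto
    then show ?thesis using normal_cones_agree[OF assms(1,2)] by (simp add: orthogonal_def)
  qed
  moreover have "m - m' \<in> span (B m)"
    using vertices_lattice assms(1,2) unfolding generators_span[OF assms(1)]
    by (auto simp: dual_lattice_def intro!: span_diff)
  ultimately have "orthogonal (m - m') (m - m')" using orthogonal_to_span by blast
  then show ?thesis by (simp add: orthogonal_def)
qed

lemma maximal_cones_eq: "maximal_cones cones = {Cone (B m) | m. m \<in> V}"
proof
  show "maximal_cones cones \<subseteq> {Cone (B m) | m. m \<in> V}"
  proof
    fix \<sigma> assume s: "\<sigma> \<in> maximal_cones cones"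
    then obtain m S where m: "m \<in> V" "S \<subseteq> B m" "\<sigma> = Cone S" unfolding maximal_cones_def cones_iff by blast
    then have "\<sigma> \<subseteq> Cone (B m)" using Cone_mono by blast
    then have "Cone (B m) = \<sigma>" using s max_cone_mem[OF m(1)] unfolding maximal_cones_def by blast
    then show "\<sigma> \<in> {Cone (B m) | m. m \<in> V}" using m(1) by blast
  qed
  show "{Cone (B m) | m. m \<in> V} \<subseteq> maximal_cones cones"
  proof
    fix \<sigma> assume "\<sigma> \<in> {Cone (B m) | m. m \<in> V}"
    then obtain m where m: "m \<in> V" "\<sigma> = Cone (B m)" by blast
    have "\<tau> = \<sigma>" if "\<tau> \<in> cones" "\<sigma> \<subseteq> \<tau>" for \<tau>
    proof -
      obtain m' S where m': "m' \<in> V" "S \<subseteq> B m'" "\<tau> = Cone S" using \<open>\<tau> \<in> cones\<close> unfolding cones_iff by blast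
      have t: "\<tau> \<subseteq> Cone (B m')" unfolding m'(3) by (rule Cone_mono[OF m'(2)])
      then have "m = m'" using normal_cone_subset[OF m(1) m'(1)] m(2) that(2) by blast
      then show ?thesis using t that(2) m(2) by blast
    qed
    then show "\<sigma> \<in> maximal_cones cones" using max_cone_mem m unfolding maximal_cones_def by blast
  qed
qed

sublocale toric_fan N cones
proof
  obtain m where "m \<in> V" using vertices_nonempty by blast
  then show "{0} \<in> cones" unfolding cones_iff Cone_empty[symmetric] by blast
  show "0 \<in> \<sigma>" if "\<sigma> \<in> cones" for \<sigma> by (rule zero_in_cones[OF that])
  show "\<sigma> \<inter> \<tau> \<in> cones" if "\<sigma> \<in> cones" "\<tau> \<in> cones" for \<sigma> \<tau> by (rule cones_inter[OF that])
  have sub: "\<tau> = Cone (S \<inter> \<tau>)" if "m \<in> V" "finite S" "S \<subseteq> B m" "\<tau> \<in> cones" "\<tau> \<subseteq> Cone S" for m S \<tau>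
  proof -
    have "Cone S \<in> cones" using that unfolding cones_iff by blast
    then have "Cone S \<inter> \<tau> face_of Cone S" using cones_inter_face that(4) by blast
    moreover have "Cone S \<inter> \<tau> = \<tau>" using that(5) by blast
    ultimately show ?thesis using face_of_Cone[OF that(2)] zero_in_cones[OF that(4)] by fastforce
  qed
  show "\<exists>m. cuts_out N \<sigma> \<tau> m" if a: "\<sigma> \<in> cones" "\<tau> \<in> cones" "\<tau> \<subseteq> \<sigma>" for \<sigma> \<tau>
  proof -
    obtain m S where m: "m \<in> V" "S \<subseteq> B m" "finite S" "\<sigma> = Cone S" by (rule conesE[OF a(1)])
    obtain w where w: "w \<in> dual_lattice N" "\<And>b. b \<in> B m - (S - S \<inter> \<tau>) \<Longrightarrow> w \<bullet> b = 0"
      "\<And>b. b \<in> S - S \<inter> \<tau> \<Longrightarrow> 0 < w \<bullet> b"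
      by (rule cut_vector[OF m(1), of "S - S \<inter> \<tau>"]) (use m(2) in auto)
    have "cuts_out N (Cone S) (Cone (S \<inter> \<tau>)) w"
      using w m(2,3) by (intro cuts_out_Cone) auto
    then show ?thesis using sub[OF m(1,3,2) a(2)] a(3) m(4) by metis
  qed
  show "\<exists>m1\<in>dual_monoid N \<tau>. \<exists>m2\<in>dual_monoid N \<rho>. n = m1 + m2"
    if a: "\<sigma> \<in> cones" "\<tau> \<in> cones" "\<rho> \<in> cones" "\<tau> \<subseteq> \<sigma>" "\<rho> \<subseteq> \<sigma>" "n \<in> dual_monoid N (\<tau> \<inter> \<rho>)" for \<sigma> \<tau> \<rho> n
  proof -
    obtain m S where m: "m \<in> V" "S \<subseteq> B m" "finite S" "\<sigma> = Cone S" by (rule conesE[OF a(1)])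
    let ?T = "S \<inter> \<tau>" and ?R = "S \<inter> \<rho>"
    have t: "\<tau> = Cone ?T" "\<rho> = Cone ?R" using sub[OF m(1,3,2)] a m(4) by auto
    \<comment> \<open>The negative values of \<open>n\<close> on \<open>\<tau>\<close> occur at generators outside \<open>\<rho>\<close>; a multiple of a vector that is
      positive there and vanishes on \<open>\<rho>\<close> compensates them.\<close>
    obtain w where w: "w \<in> dual_lattice N" "\<And>b. b \<in> B m - (?T - ?R) \<Longrightarrow> w \<bullet> b = 0"
      "\<And>b. b \<in> ?T - ?R \<Longrightarrow> 0 < w \<bullet> b"
      by (rule cut_vector[OF m(1), of "?T - ?R"]) (use m(2) in auto)
    obtain k where k: "\<forall>b\<in>?T - ?R. 0 \<le> (n + real k *\<^sub>R w) \<bullet> b"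
      using large_multiple[of "?T - ?R" w n] w(3) m(3) by auto
    have nl: "n \<in> dual_lattice N" and n0: "\<And>x. x \<in> \<tau> \<inter> \<rho> \<Longrightarrow> 0 \<le> n \<bullet> x" using a(6) by (auto simp: dual_monoid_def)
    have kw: "real k *\<^sub>R w \<in> dual_lattice N"
      using dual_monoid_scale[of w N "{0}" k] w(1) by (simp add: dual_monoid_origin)
    have "0 \<le> (n + real k *\<^sub>R w) \<bullet> b" if "b \<in> ?T" for b
      using k n0[of b] w(2)[of b] that m(2) by (cases "b \<in> ?R") (auto simp: inner_add_left)
    then have "n + real k *\<^sub>R w \<in> dual_monoid N \<tau>"
      using dual_monoid_Cone[of N ?T] dual_lattice_add[OF nl kw] t(1) by auto
    moreover have "0 \<le> - (real k *\<^sub>R w) \<bullet> b" if "b \<in> ?R" for b using w(2)[of b] that m(2) by auto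
    then have "- (real k *\<^sub>R w) \<in> dual_monoid N (Cone ?R)"
      using dual_lattice_uminus[OF kw] unfolding dual_monoid_Cone by blast
    then have "- (real k *\<^sub>R w) \<in> dual_monoid N \<rho>" using t(2) by simp
    ultimately show ?thesis by (intro bexI[of _ "n + real k *\<^sub>R w"] bexI[of _ "- (real k *\<^sub>R w)"]) simp_all
  qed
qed

lemma inj_on_normal_cone: "inj_on (\<lambda>m. Cone (B m)) V"
  using normal_cone_subset by (intro inj_onI) blast

theorem projective_cones: "projective_fan N cones"
proof -
  define a where "a = inv_into V (\<lambda>m. Cone (B m))"
  have a: "a (Cone (B m)) = m" if "m \<in> V" for m
    unfolding a_def using inv_into_f_f[OF inj_on_normal_cone that] .
  interpret polarized_toric_fan N cones "(\<lambda>m. Cone (B m)) ` V" a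
  proof
    show "(\<lambda>m. Cone (B m)) ` V \<subseteq> cones" using max_cone_mem by auto
    show "\<exists>\<sigma>\<in>(\<lambda>m. Cone (B m)) ` V. \<tau> \<subseteq> \<sigma>" if "\<tau> \<in> cones" for \<tau>
      using that Cone_mono unfolding cones_iff by blast
    show "a \<sigma> \<in> dual_lattice N" if "\<sigma> \<in> (\<lambda>m. Cone (B m)) ` V" for \<sigma>
      using that a vertices_lattice by auto
    show "\<exists>gs. set gs \<subseteq> dual_monoid N \<sigma> \<and> (\<forall>m\<in>dual_monoid N \<sigma>. \<exists>b. m = (\<Sum>j<length gs. real (b j) *\<^sub>R gs ! j))"
      if s: "\<sigma> \<in> (\<lambda>m. Cone (B m)) ` V" for \<sigma>
    proof -
      obtain m where m: "m \<in> V" "\<sigma> = Cone (B m)" using s by blast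
      show ?thesis
        unfolding m(2) by (rule gordan[OF finite_generators[OF m(1)] generators_lattice[OF m(1)] generators_span[OF m(1)]])
    qed
    fix \<sigma> \<sigma>' assume "\<sigma> \<in> (\<lambda>m. Cone (B m)) ` V" "\<sigma>' \<in> (\<lambda>m. Cone (B m)) ` V"
    then obtain m m' where m: "m \<in> V" "\<sigma> = Cone (B m)" "m' \<in> V" "\<sigma>' = Cone (B m')" by blast
    let ?T = "B m \<inter> (\<sigma> \<inter> \<sigma>')"
    have f: "\<sigma> \<inter> \<sigma>' face_of Cone (B m)" unfolding m(2,4) by (rule normal_cones_inter_face[OF m(1,3)])
    have T: "\<sigma> \<inter> \<sigma>' = Cone ?T"
      by (rule face_of_Cone[OF finite_generators[OF m(1)] f]) (use zero_in_Cone m in blast)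
    have "cuts_out N (Cone (B m)) (Cone ?T) (m - m')"
    proof (rule cuts_out_Cone)
      show "finite (B m)" by (rule finite_generators[OF m(1)])
      show "m - m' \<in> dual_lattice N" using m vertices_lattice by (intro dual_lattice_diff) auto
      show "(m - m') \<bullet> b = 0" if "b \<in> ?T" for b
      proof -
        have "b \<in> Cone (B m)" "b \<in> Cone (B m')" using that m by auto
        then show ?thesis using normal_cones_agree[OF m(1,3)] by simp
      qed
      show "0 < (m - m') \<bullet> b" if "b \<in> B m - ?T" for b
      proof -
        have b: "b \<in> Cone (B m)" "b \<notin> Cone (B m')" using that m Cone_base by auto
        then obtain m'' where "m'' \<in> V" "\<not> m'' \<bullet> b \<le> m' \<bullet> b" using m by (auto simp: normal_cone)
        then show ?thesis using b(1) m(1) by (fastforce simp: normal_cone inner_diff_left)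
      qed
    qed auto
    then show "cuts_out N \<sigma> (\<sigma> \<inter> \<sigma>') (a \<sigma> - a \<sigma>')" using T m a by metis
  qed
  show ?thesis by (rule polarized_projective[OF complete_cones])
qed

end

section \<open>Flags of faces of the root polytope\<close>

text \<open>
The faces of the root polytope correspond to pairs of disjoint nonempty sets of indices; the next
larger faces of a given one arise by adding an index to one of the two sets.
\<close>

definition pair_extends :: "nat set \<Rightarrow> nat set \<Rightarrow> nat set \<Rightarrow> nat set \<Rightarrow> nat set \<Rightarrow> bool" where
  "pair_extends A I J K L \<longleftrightarrow> (\<exists>z\<in>A. z \<notin> I \<union> J \<and> (K = insert z I \<and> L = J \<or> K = I \<and> L = insert z J))"

text \<open>
The last two arguments are the largest face of the flag.
\<close>

inductive flag :: "nat set \<Rightarrow> (nat set \<times> nat set) set \<Rightarrow> nat set \<Rightarrow> nat set \<Rightarrow> bool" for A where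
  start: "i \<in> A \<Longrightarrow> j \<in> A \<Longrightarrow> i \<noteq> j \<Longrightarrow> flag A {({i}, {j})} {i} {j}"
| step: "flag A F I J \<Longrightarrow> pair_extends A I J K L \<Longrightarrow> flag A (insert (K, L) F) K L"

definition complete_flag :: "nat set \<Rightarrow> (nat set \<times> nat set) set \<Rightarrow> bool" where
  "complete_flag A F \<longleftrightarrow> (\<exists>I J. flag A F I J \<and> I \<union> J = A)"

lemma flag_invariants:
  assumes "flag A F I J"
  shows "(I, J) \<in> F \<and> I \<subseteq> A \<and> J \<subseteq> A \<and> I \<inter> J = {} \<and> I \<noteq> {} \<and> J \<noteq> {} \<and> finite I \<and> finite J \<and>
    (\<forall>(I', J')\<in>F. I' \<subseteq> I \<and> J' \<subseteq> J \<and> I' \<noteq> {} \<and> J' \<noteq> {})"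
  using assms
proof (induction rule: flag.induct)
  case (step F I J K L)
  obtain z where z: "z \<in> A" "z \<notin> I \<union> J" "K = insert z I \<and> L = J \<or> K = I \<and> L = insert z J"
    using step.hyps(2) unfolding pair_extends_def by blast
  have F: "I' \<subseteq> I \<and> J' \<subseteq> J \<and> I' \<noteq> {} \<and> J' \<noteq> {}" if "(I', J') \<in> F" for I' J'
    using step.IH that by blast
  have i: "I \<subseteq> A" "J \<subseteq> A" "I \<inter> J = {}" "I \<noteq> {}" "J \<noteq> {}" "finite I" "finite J"
    using step.IH by simp_all
  have KL: "I \<subseteq> K" "J \<subseteq> L" "K \<subseteq> A" "L \<subseteq> A" "K \<inter> L = {}" "K \<noteq> {}" "L \<noteq> {}" "finite K" "finite L"
    using z i by auto
  have "I' \<subseteq> K \<and> J' \<subseteq> L \<and> I' \<noteq> {} \<and> J' \<noteq> {}" if "(I', J') \<in> insert (K, L) F" for I' J'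
  proof (cases "(I', J') = (K, L)")
    case False
    then show ?thesis using F[of I' J'] that KL(1,2) by blast
  qed (use KL in simp)
  then show ?case using KL(3-9) by blast
qed auto

lemma flag_pair:
  assumes "flag A F I J" "(I', J') \<in> F"
  shows "I' \<subseteq> I \<and> J' \<subseteq> J \<and> I' \<noteq> {} \<and> J' \<noteq> {} \<and> finite I' \<and> finite J'"
proof -
  note i = flag_invariants[OF assms(1)]
  have "I' \<subseteq> I \<and> J' \<subseteq> J \<and> I' \<noteq> {} \<and> J' \<noteq> {}" using i assms(2) by blast
  moreover have "finite I" "finite J" using i by simp_all
  ultimately show ?thesis using finite_subset by blast
qed

lemma flag_top:
  assumes "flag A F I J"
  shows "(I, J) \<in> F" "I \<subseteq> A" "J \<subseteq> A" "I \<inter> J = {}"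
  using flag_invariants[OF assms] by auto

lemma flag_finite: "flag A F I J \<Longrightarrow> finite F"
  by (induction rule: flag.induct) auto

lemma pair_extends_swap: "pair_extends A I J K L \<Longrightarrow> pair_extends A J I L K"
  unfolding pair_extends_def by blast

lemma flag_swap: "flag A F I J \<Longrightarrow> flag A (prod.swap ` F) J I"
proof (induction rule: flag.induct)
  case (start i j)
  then show ?case using flag.start[of j A i] by simp
next
  case (step F I J K L)
  then show ?case using flag.step[OF step.IH pair_extends_swap[OF step.hyps(2)]] by simp
qed

text \<open>
Up to the factor \<open>|I| |J|\<close>, the value at the barycentre of the face \<open>(I, J)\<close> of the functional with
coordinates \<open>w\<close>, namely the average of \<open>w\<close> over \<open>I\<close> minus its average over \<open>J\<close>. The factor keeps the
value integral for integral \<open>w\<close>.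
\<close>

definition gap :: "(nat \<Rightarrow> 'r::comm_ring_1) \<Rightarrow> nat set \<Rightarrow> nat set \<Rightarrow> 'r" where
  "gap w I J = of_nat (card J) * sum w I - of_nat (card I) * sum w J"

lemma gap_swap: "gap (\<lambda>j. - w j) J I = gap w I J"
  unfolding gap_def by (simp add: sum_negf)

text \<open>
The averages \<open>P\<close> and \<open>Q\<close> of \<open>w\<close> over \<open>I\<close> and \<open>J\<close> stay integral. When an index enters, one of the two averages is
unchanged and the prescribed value determines the other, hence the weight of the new index.
\<close>

lemma flag_interpolation:
  fixes h :: "nat set \<times> nat set \<Rightarrow> int"
  assumes "flag A F I J"
  shows "\<exists>w. \<forall>(I', J')\<in>F. gap w I' J' = int (card I' * card J') * h (I', J')"
proof -
  have "\<exists>w P Q. sum w I = int (card I) * P \<and> sum w J = int (card J) * Q \<and>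
      (\<forall>(I', J')\<in>F. gap w I' J' = int (card I' * card J') * h (I', J'))"
    using assms
  proof (induction rule: flag.induct)
    case (start i j)
    then show ?case
      by (intro exI[of _ "\<lambda>x. if x = i then h ({i}, {j}) else 0"] exI[of _ "h ({i}, {j})"] exI[of _ 0])
        (auto simp: gap_def)
  next
    case (step F I J K L)
    then obtain w P Q where w: "sum w I = int (card I) * P" "sum w J = int (card J) * Q"
      and F: "\<And>I' J'. (I', J') \<in> F \<Longrightarrow> gap w I' J' = int (card I' * card J') * h (I', J')" by blast
    have fin: "finite I" "finite J" using flag_pair[OF step.hyps(1) flag_top(1)[OF step.hyps(1)]] by auto
    obtain z where z: "z \<in> A" "z \<notin> I \<union> J" "K = insert z I \<and> L = J \<or> K = I \<and> L = insert z J"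
      using step.hyps(2) unfolding pair_extends_def by blast
    have unchanged: "sum (w(z := c)) T = sum w T" if "z \<notin> T" for c T
      using that by (intro sum.cong) auto
    have old: "gap (w(z := c)) I' J' = int (card I' * card J') * h (I', J')" if "(I', J') \<in> F" for c I' J'
    proof -
      have *: "z \<notin> I'" "z \<notin> J'" using flag_pair[OF step.hyps(1) that] z(2) by auto
      show ?thesis using F[OF that] unfolding gap_def by (simp only: unchanged[OF *(1)] unchanged[OF *(2)])
    qed
    from z(3) show ?case
    proof
      assume KL: "K = insert z I \<and> L = J"
      define P' where "P' = h (K, L) + Q"
      define w' where "w' = w(z := int (card K) * P' - int (card I) * P)"
      have cK: "card K = card I + 1" using KL z(2) fin by simp
      have wz: "w' z = int (card K) * P' - int (card I) * P" by (simp add: w'_def)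
      have "sum w' I = sum w I" "sum w' J = sum w J" unfolding w'_def by (rule unchanged, use z(2) in blast)+
      then have s: "sum w' K = int (card K) * P'" "sum w' L = int (card L) * Q"
        using KL z(2) fin w wz by auto
      moreover have "gap w' K L = int (card K * card L) * h (K, L)"
        unfolding gap_def s by (simp add: P'_def algebra_simps)
      moreover have "\<And>I' J'. (I', J') \<in> F \<Longrightarrow> gap w' I' J' = int (card I' * card J') * h (I', J')"
        unfolding w'_def by (rule old)
      ultimately show ?thesis by (intro exI[of _ w'] exI[of _ P'] exI[of _ Q]) auto
    next
      assume KL: "K = I \<and> L = insert z J"
      define Q' where "Q' = P - h (K, L)"
      define w' where "w' = w(z := int (card L) * Q' - int (card J) * Q)"
      have wz: "w' z = int (card L) * Q' - int (card J) * Q" by (simp add: w'_def)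
      have "sum w' I = sum w I" "sum w' J = sum w J" unfolding w'_def by (rule unchanged, use z(2) in blast)+
      then have s: "sum w' L = int (card L) * Q'" "sum w' K = int (card K) * P"
        using KL z(2) fin w wz by auto
      moreover have "gap w' K L = int (card K * card L) * h (K, L)"
        unfolding gap_def s by (simp add: Q'_def algebra_simps)
      moreover have "\<And>I' J'. (I', J') \<in> F \<Longrightarrow> gap w' I' J' = int (card I' * card J') * h (I', J')"
        unfolding w'_def by (rule old)
      ultimately show ?thesis by (intro exI[of _ w'] exI[of _ P] exI[of _ Q']) auto
    qed
  qed
  then show ?thesis by blast
qed

text \<open>
The support function takes the value \<open>C - |I| |J|\<close> at the barycentre of \<open>(I, J)\<close>; the factor
\<open>|I| |J|\<close> matches the scaling of \<open>gap\<close>.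
\<close>

definition height :: "real \<Rightarrow> nat set \<Rightarrow> nat set \<Rightarrow> real" where
  "height C I J = real (card I * card J) * (C - real (card I * card J))"

lemma height_swap: "height C J I = height C I J"
  by (simp add: height_def mult.commute)

text \<open>
Write \<open>k\<close>, \<open>l\<close>, \<open>c + 1\<close>, \<open>d\<close> for the sizes of \<open>I\<close>, \<open>J\<close>, \<open>I'\<close>, \<open>J'\<close>. The two equalities determine \<open>w z\<close>, and the
inequalities for \<open>(I' - {z}, J')\<close> and \<open>(I, J')\<close> then bound the gap of \<open>(I', J')\<close>. The height exceeds this
bound by \<open>d ((k + 1) (l - d) + 2 (k - c) d)\<close>, which vanishes only for \<open>c = k\<close> and \<open>d = l\<close>.
\<close>

lemma gap_extend:
  fixes w :: "nat \<Rightarrow> real"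
  assumes fin: "finite I" "finite J" and ne: "I \<noteq> {}" "J \<noteq> {}" and z: "z \<notin> I"
    and eq: "gap w I J = height C I J" "gap w (insert z I) J = height C (insert z I) J"
    and le: "\<And>I' J'. I' \<subseteq> I \<Longrightarrow> J' \<subseteq> J \<Longrightarrow> I' \<noteq> {} \<Longrightarrow> J' \<noteq> {} \<Longrightarrow> gap w I' J' \<le> height C I' J'"
    and IJ: "z \<in> I'" "I' \<subseteq> insert z I" "J' \<subseteq> J" "J' \<noteq> {}"
  shows "gap w I' J' \<le> height C I' J'" "(I', J') \<noteq> (insert z I, J) \<Longrightarrow> gap w I' J' < height C I' J'"
proof -
  define I'' where "I'' = I' - {z}"
  have I'': "I' = insert z I''" "z \<notin> I''" "I'' \<subseteq> I" using IJ by (auto simp: I''_def)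
  have fin': "finite I''" "finite I'" "finite J'"
    using finite_subset[OF I''(3) fin(1)] finite_subset[OF IJ(3) fin(2)] I''(1) by auto
  define k l c d a b s t W where kl: "k = real (card I)" "l = real (card J)" "c = real (card I'')" "d = real (card J')"
    "a = sum w I''" "b = sum w J'" "s = sum w I" "t = sum w J" "W = w z"
  have pos: "k \<ge> 1" "l \<ge> 1" "d \<ge> 1" using fin fin' ne IJ(4) by (auto simp: kl Suc_le_eq card_gt_0_iff)
  have cd: "c \<ge> 0" "c \<le> k" "d \<le> l" using card_mono[OF fin(1) I''(3)] card_mono[OF fin(2) IJ(3)] by (auto simp: kl)
  have e1: "l * s - k * t = k * l * (C - k * l)"
    using eq(1) by (simp add: gap_def height_def kl)
  have e2: "l * (s + W) - (k + 1) * t = (k + 1) * l * (C - (k + 1) * l)"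
    using eq(2) z fin by (simp add: gap_def height_def kl algebra_simps)
  \<comment> \<open>The new weight is \<open>(k + 1) l\<close> below the average of \<open>w\<close> over \<open>I\<close>.\<close>
  have "l * (k * W) = l * (s - k * (k + 1) * l)" using e1 e2 by algebra
  then have W: "k * W = s - k * (k + 1) * l" using pos by simp
  have i1: "d * a - c * b \<le> c * d * (C - c * d)"
  proof (cases "I'' = {}")
    case False
    then show ?thesis using le[OF I''(3) IJ(3) False IJ(4)] by (simp add: gap_def height_def kl)
  qed (simp add: kl)
  have i2: "d * s - k * b \<le> k * d * (C - k * d)"
    using le[OF order_refl IJ(3) ne(1) IJ(4)] by (simp add: gap_def height_def kl)
  have "k * (d * W - b) = (d * s - k * b) - k * ((k + 1) * l * d)" using W by algebra
  also have "\<dots> \<le> k * (d * (C - k * d) - (k + 1) * l * d)" using i2 by (simp add: algebra_simps)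
  finally have i3: "d * W - b \<le> d * (C - k * d) - (k + 1) * l * d" using pos by simp
  have g: "gap w I' J' = (d * a - c * b) + (d * W - b)"
    using I'' fin' by (simp add: gap_def kl algebra_simps)
  have h: "height C I' J' = (c + 1) * d * (C - (c + 1) * d)"
    using I'' fin' by (simp add: height_def kl algebra_simps)
  have diff: "height C I' J' - gap w I' J' \<ge> d * (k * d + (k + 1) * l - (2 * c + 1) * d)"
    using i1 i3 unfolding g h by (simp add: algebra_simps)
  have sp: "k * d + (k + 1) * l - (2 * c + 1) * d = (k + 1) * (l - d) + 2 * ((k - c) * d)"
    by (simp add: algebra_simps)
  have nn: "(k + 1) * (l - d) \<ge> 0" "(k - c) * d \<ge> 0" using pos cd by auto
  then have "d * (k * d + (k + 1) * l - (2 * c + 1) * d) \<ge> 0" unfolding sp using pos by simp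
  then show "gap w I' J' \<le> height C I' J'" using diff by linarith
  assume "(I', J') \<noteq> (insert z I, J)"
  then have "I'' \<noteq> I \<or> J' \<noteq> J" using I'' by auto
  then have "c < k \<or> d < l"
    using psubset_card_mono[OF fin(1), of I''] psubset_card_mono[OF fin(2), of J'] I''(3) IJ(3) by (auto simp: kl)
  then have "(k + 1) * (l - d) > 0 \<or> (k - c) * d > 0" using pos by auto
  then have "(k + 1) * (l - d) + 2 * ((k - c) * d) > 0" using nn by linarith
  then have "d * (k * d + (k + 1) * l - (2 * c + 1) * d) > 0" unfolding sp using pos by simp
  then show "gap w I' J' < height C I' J'" using diff by linarith
qed

text \<open>
A subface of the new face that contains the new index is treated by \<open>gap_extend\<close>; an index that enters
\<open>J\<close> is reduced to this case by exchanging the two sets and negating the weights.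
\<close>

lemma flag_gap:
  fixes w :: "nat \<Rightarrow> real"
  assumes "flag A F I J" "\<And>I' J'. (I', J') \<in> F \<Longrightarrow> gap w I' J' = height C I' J'"
    and "I' \<subseteq> I" "J' \<subseteq> J" "I' \<noteq> {}" "J' \<noteq> {}"
  shows "gap w I' J' \<le> height C I' J' \<and> ((I', J') \<notin> F \<longrightarrow> gap w I' J' < height C I' J')"
  using assms
proof (induction arbitrary: I' J' rule: flag.induct)
  case (start i j)
  then have "I' = {i}" "J' = {j}" by auto
  then show ?case using start.prems(1) by simp
next
  case (step F I J K L)
  have F: "gap w I' J' = height C I' J'" if "(I', J') \<in> F" for I' J' using step.prems(1) that by blast
  note top = flag_top[OF step.hyps(1)]
  have fin: "finite I" "finite J" and ne: "I \<noteq> {}" "J \<noteq> {}" using flag_pair[OF step.hyps(1) top(1)] by auto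
  have IH: "gap w I' J' \<le> height C I' J' \<and> ((I', J') \<notin> F \<longrightarrow> gap w I' J' < height C I' J')"
    if "I' \<subseteq> I" "J' \<subseteq> J" "I' \<noteq> {}" "J' \<noteq> {}" for I' J' using step.IH[OF F that] .
  obtain z where z: "z \<in> A" "z \<notin> I \<union> J" "K = insert z I \<and> L = J \<or> K = I \<and> L = insert z J"
    using step.hyps(2) unfolding pair_extends_def by blast
  have new: "gap w K L = height C K L" using step.prems(1) by simp
  consider "I' \<subseteq> I" "J' \<subseteq> J" | "K = insert z I" "L = J" "z \<in> I'" | "K = I" "L = insert z J" "z \<in> J'"
    using z(3) step.prems(2,3) by blast
  then show ?case
  proof cases
    case 1
    then have "(I', J') \<noteq> (K, L)" using z by auto
    then show ?thesis using IH[OF 1 step.prems(4,5)] by auto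
  next
    case 2
    have *: "gap w I' J' \<le> height C I' J'" "(I', J') \<noteq> (insert z I, J) \<Longrightarrow> gap w I' J' < height C I' J'"
      by (rule gap_extend[OF fin ne, where z=z and w=w and C=C and I'=I' and J'=J'];
          use z 2 new IH step.prems F[OF top(1)] in auto)+
    then show ?thesis using 2 by auto
  next
    case 3
    let ?w = "\<lambda>j. - w j"
    have le: "gap ?w L' K' \<le> height C L' K'" if "L' \<subseteq> J" "K' \<subseteq> I" "L' \<noteq> {}" "K' \<noteq> {}" for L' K'
      using IH[OF that(2,1,4,3)] unfolding gap_swap height_swap[of C L'] by blast
    have "z \<notin> J" "J' \<subseteq> insert z J" "I' \<subseteq> I" using z 3 step.prems(2,3) by auto
    moreover have "gap ?w J I = height C J I" "gap ?w (insert z J) I = height C (insert z J) I"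
      using F[OF top(1)] new 3(1,2) unfolding gap_swap height_swap[of C _ I] by auto
    ultimately have *: "gap ?w J' I' \<le> height C J' I'"
        "(J', I') \<noteq> (insert z J, I) \<Longrightarrow> gap ?w J' I' < height C J' I'"
      using gap_extend[OF fin(2,1) ne(2,1) _ _ _ le 3(3), of I'] step.prems(4) by blast+
    then show ?thesis using 3 unfolding gap_swap height_swap[of C J' I'] by auto
  qed
qed

section \<open>Weights on a complete flag\<close>

text \<open>
The weights on \<open>I\<close> lie slightly below \<open>p\<close>, and those on \<open>J\<close> slightly above \<open>- q\<close>.
\<close>

definition weight_bounds :: "(nat \<Rightarrow> real) \<Rightarrow> nat set \<Rightarrow> nat set \<Rightarrow> real \<Rightarrow> real \<Rightarrow> bool" where
  "weight_bounds w I J p q \<longleftrightarrow>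
    (p - real (card I * card J) \<le> sum w I / real (card I) \<and> sum w I / real (card I) \<le> p) \<and>
    (q - real (card I * card J) \<le> - (sum w J / real (card J)) \<and> - (sum w J / real (card J)) \<le> q) \<and>
    (\<forall>z\<in>I. w z \<le> p \<and> p - 2 * real (card I * card J) \<le> w z) \<and>
    (\<forall>z\<in>J. - w z \<le> q \<and> q - 2 * real (card I * card J) \<le> - w z)"

lemma weight_boundsD:
  assumes "weight_bounds w I J p q"
  shows "p - real (card I * card J) \<le> sum w I / real (card I)" "sum w I / real (card I) \<le> p"
    "q - real (card I * card J) \<le> - (sum w J / real (card J))" "- (sum w J / real (card J)) \<le> q"
    "z \<in> I \<Longrightarrow> w z \<le> p" "z \<in> I \<Longrightarrow> p - 2 * real (card I * card J) \<le> w z"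
    "z \<in> J \<Longrightarrow> - w z \<le> q" "z \<in> J \<Longrightarrow> q - 2 * real (card I * card J) \<le> - w z"
  using assms unfolding weight_bounds_def by blast+

lemma flag_weight_bounds:
  fixes w :: "nat \<Rightarrow> real"
  assumes "flag A F I J" "\<And>I' J'. (I', J') \<in> F \<Longrightarrow> gap w I' J' = height C I' J'"
  shows "\<exists>p q. p + q = C - 1 \<and> weight_bounds w I J p q"
  using assms
proof (induction rule: flag.induct)
  case (start i j)
  have "w i - w j = C - 1" using start.prems[of "{i}" "{j}"] by (simp add: gap_def height_def)
  then show ?case by (intro exI[of _ "w i"] exI[of _ "- w j"]) (auto simp: weight_bounds_def)
next
  case (step F I J K L)
  have F: "gap w I' J' = height C I' J'" if "(I', J') \<in> F" for I' J' using step.prems(1) that by blast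
  note top = flag_top[OF step.hyps(1)]
  have fin: "finite I" "finite J" and ne: "I \<noteq> {}" "J \<noteq> {}" using flag_pair[OF step.hyps(1) top(1)] by auto
  obtain p q where pq0: "p + q = C - 1" "weight_bounds w I J p q"
    using step.IH[OF F] by blast
  note pq = pq0(1) weight_boundsD[OF pq0(2)]
  define k l P Q where kl: "k = real (card I)" "l = real (card J)" "P = sum w I / k" "Q = - (sum w J / l)"
  have pos: "k \<ge> 1" "l \<ge> 1" using fin ne by (auto simp: kl Suc_le_eq card_gt_0_iff)
  have s: "sum w I = k * P" "sum w J = - (l * Q)" using pos by (auto simp: kl)
  have "k * l * (P + Q) = k * l * (C - k * l)"
    using F[OF top(1)] unfolding gap_def height_def s kl(1,2)[symmetric] by (simp add: kl(1,2)[symmetric] algebra_simps)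
  then have PQ: "P + Q = C - k * l" using pos by simp
  have b: "p - k * l \<le> P" "P \<le> p" "q - k * l \<le> Q" "Q \<le> q" "\<And>z. z \<in> I \<Longrightarrow> p - 2 * (k * l) \<le> w z"
    "\<And>z. z \<in> J \<Longrightarrow> q - 2 * (k * l) \<le> - w z"
    using pq(2-5,7,9) by (auto simp: kl)
  obtain z where z: "z \<in> A" "z \<notin> I \<union> J" "K = insert z I \<and> L = J \<or> K = I \<and> L = insert z J"
    using step.hyps(2) unfolding pair_extends_def by blast
  have new: "gap w K L = height C K L" using step.prems by simp
  from z(3) show ?case
  proof
    assume KL: "K = insert z I \<and> L = J"
    have "sum w K = w z + sum w I" "card K = Suc (card I)" using KL z(2) fin by simp_all
    then have c: "real (card K) = k + 1" "real (card L) = l" "sum w K = k * P + w z"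
      using KL s(1) by (simp_all add: kl(1,2))
    have "l * (k * P + w z) + (k + 1) * (l * Q) = (k + 1) * l * (C - (k + 1) * l)"
      using new KL s unfolding gap_def height_def of_nat_mult c by (simp add: c)
    then have "l * w z = l * (P - (k + 1) * l)" using PQ by algebra
    then have wz: "w z = P - (k + 1) * l" using pos by simp
    have P': "sum w K / real (card K) = P - l"
      using pos unfolding c wz by (simp add: field_simps)
    have kl': "real (card K * card L) = k * l + l" unfolding of_nat_mult c by (simp add: algebra_simps)
    have Q': "- (sum w L / real (card L)) = Q" using KL by (simp add: kl)
    have lp: "k * l \<ge> 0" using pos by simp
    have wz': "w z = P - k * l - l" unfolding wz by (simp add: algebra_simps)
    have bI: "w x \<le> p \<and> p - 2 * real (card K * card L) \<le> w x" if "x \<in> K" for x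
    proof (cases "x \<in> I")
      case True
      show ?thesis unfolding kl' using pq(6)[OF True] b(5)[OF True] pos by simp
    next
      case False
      then have "x = z" using that KL by auto
      then show ?thesis unfolding kl' using wz' b(1,2) lp pos KL False that by auto
    qed
    have bJ: "- w x \<le> q \<and> q - 2 * real (card K * card L) \<le> - w x" if "x \<in> L" for x
    proof (cases "x \<in> J")
      case True
      show ?thesis unfolding kl' using pq(8)[OF True] b(6)[OF True] pos by simp
    next
      case False
      then have "x = z" using that KL by auto
      then show ?thesis unfolding kl' using wz' b(3,4) lp pos KL False that by auto
    qed
    have bP: "p - real (card K * card L) \<le> sum w K / real (card K)" "sum w K / real (card K) \<le> p"
      "q - real (card K * card L) \<le> - (sum w L / real (card L))" "- (sum w L / real (card L)) \<le> q"
      unfolding kl' P' Q' using b(1-4) pos by auto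
    have "weight_bounds w K L p q" unfolding weight_bounds_def using bI bJ bP by simp
    then show ?thesis using pq(1) by blast
  next
    assume KL: "K = I \<and> L = insert z J"
    have "sum w L = w z + sum w J" "card L = Suc (card J)" using KL z(2) fin by simp_all
    then have c: "real (card K) = k" "real (card L) = l + 1" "sum w L = w z - l * Q"
      using KL s(2) by (simp_all add: kl(1,2))
    have "(l + 1) * (k * P) - k * (w z - l * Q) = k * (l + 1) * (C - k * (l + 1))"
      using new KL s unfolding gap_def height_def of_nat_mult c by (simp add: c)
    then have "k * (- w z) = k * (Q - (l + 1) * k)" using PQ by algebra
    then have wz: "- w z = Q - (l + 1) * k" using pos by (metis mult_cancel_left not_one_le_zero)
    have Q': "- (sum w L / real (card L)) = Q - k"
    proof -
      have "w z = (l + 1) * k - Q" using wz by simp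
      then show ?thesis using pos unfolding c by (simp add: field_simps)
    qed
    have kl': "real (card K * card L) = k * l + k" unfolding of_nat_mult c by (simp add: algebra_simps)
    have P': "sum w K / real (card K) = P" using KL by (simp add: kl)
    have lp: "k * l \<ge> 0" using pos by simp
    have wz': "- w z = Q - k * l - k" unfolding wz by (simp add: algebra_simps)
    have bI: "w x \<le> p \<and> p - 2 * real (card K * card L) \<le> w x" if "x \<in> K" for x
    proof (cases "x \<in> I")
      case True
      show ?thesis unfolding kl' using pq(6)[OF True] b(5)[OF True] pos by simp
    next
      case False
      then have "x = z" using that KL by auto
      then show ?thesis unfolding kl' using wz' b(1,2) lp pos KL False that by auto
    qed
    have bJ: "- w x \<le> q \<and> q - 2 * real (card K * card L) \<le> - w x" if "x \<in> L" for x
    proof (cases "x \<in> J")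
      case True
      show ?thesis unfolding kl' using pq(8)[OF True] b(6)[OF True] pos by simp
    next
      case False
      then have "x = z" using that KL by auto
      then show ?thesis unfolding kl' using wz' b(3,4) lp pos KL False that by auto
    qed
    have bP: "p - real (card K * card L) \<le> sum w K / real (card K)" "sum w K / real (card K) \<le> p"
      "q - real (card K * card L) \<le> - (sum w L / real (card L))" "- (sum w L / real (card L)) \<le> q"
      unfolding kl' P' Q' using b(1-4) pos by auto
    have "weight_bounds w K L p q" unfolding weight_bounds_def using bI bJ bP by simp
    then show ?thesis using pq(1) by blast
  qed
qed

text \<open>
The distance \<open>C\<close> between the weights on \<open>I\<close> and those on \<open>J\<close> has to dominate the spread of the weights,
which is at most \<open>2 N\<^sup>2\<close>, and the corrections \<open>|I|\<^sup>2 |J| \<le> N\<^sup>3\<close>.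
\<close>

definition height_offset :: "nat \<Rightarrow> int" where
  "height_offset N = 2 * int N ^ 2 + int N ^ 3 + 2"

text \<open>
An index of \<open>J\<close> that occurs in \<open>I'\<close> lowers the average over \<open>I'\<close> by about \<open>C / |I'|\<close>, more than the
differences between the other weights can make up for.
\<close>

lemma flag_gap_outside:
  fixes w :: "nat \<Rightarrow> real"
  assumes f: "flag A F I J" and A: "I \<union> J = A" "finite A"
    and eq: "\<And>I' J'. (I', J') \<in> F \<Longrightarrow> gap w I' J' = height (real_of_int (height_offset (card A))) I' J'"
    and IJ: "I' \<subseteq> A" "J' \<subseteq> A" "J' \<noteq> {}" and z: "z \<in> I'" "z \<in> J"
  shows "gap w I' J' < height (real_of_int (height_offset (card A))) I' J'"
proof -
  define C where "C = real_of_int (height_offset (card A))"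
  define N where "N = real (card A)"
  note top = flag_top[OF f]
  have fin: "finite I'" "finite J'"
    using finite_subset[OF IJ(1) A(2)] finite_subset[OF IJ(2) A(2)] by auto
  define k l where kl: "k = real (card I')" "l = real (card J')"
  have C: "C = 2 * N ^ 2 + N ^ 3 + 2" by (simp add: C_def N_def height_offset_def)
  have pos: "k \<ge> 1" "l \<ge> 1" using fin z IJ by (auto simp: kl Suc_le_eq card_gt_0_iff)
  have up: "k \<le> N" "l \<le> N" "real (card I) \<le> N" "real (card J) \<le> N"
    using card_mono[OF A(2)] IJ top by (auto simp: kl N_def)
  have m: "real (card I * card J) \<le> N ^ 2"
    unfolding of_nat_mult power2_eq_square using up by (intro mult_mono) auto
  obtain p q where pq0: "p + q = C - 1" "weight_bounds w I J p q"
    using flag_weight_bounds[OF f, of w C] eq unfolding C_def by blast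
  note pq = pq0(1) weight_boundsD(5-8)[OF pq0(2)]
  have N0: "N ^ 3 \<ge> 0" by (simp add: N_def)
  have wI: "w x \<le> p" if "x \<in> A" for x
  proof (cases "x \<in> I")
    case False
    then have "x \<in> J" using that A(1) by blast
    then show ?thesis using pq(1) pq(5)[of x] m C N0 by linarith
  qed (rule pq(2))
  have wJ: "- w x \<le> q" if "x \<in> A" for x
  proof (cases "x \<in> J")
    case False
    then have "x \<in> I" using that A(1) by blast
    then show ?thesis using pq(1) pq(3)[of x] m C N0 by linarith
  qed (rule pq(4))
  have wz: "w z \<le> 2 * N ^ 2 - q" using pq(5)[OF z(2)] m by linarith
  have "sum w I' = w z + sum w (I' - {z})" by (rule sum.remove[OF fin(1) z(1)])
  moreover have "sum w (I' - {z}) \<le> real (card (I' - {z})) * p"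
    using sum_bounded_above[of "I' - {z}" w p] wI IJ(1) by auto
  moreover have "real (card (I' - {z})) = k - 1" using z(1) fin(1) pos(1) by (simp add: kl)
  ultimately have sI: "sum w I' \<le> 2 * N ^ 2 - q + (k - 1) * p" using wz by simp
  have sJ: "- sum w J' \<le> l * q"
    using sum_bounded_above[of J' "\<lambda>x. - w x" q] wJ IJ(2) by (auto simp: kl sum_negf)
  have "gap w I' J' = l * sum w I' + k * (- sum w J')" by (simp add: gap_def kl)
  also have "\<dots> \<le> l * (2 * N ^ 2 - q + (k - 1) * p) + k * (l * q)"
    using sI sJ pos by (intro add_mono mult_left_mono) auto
  also have "\<dots> = l * (2 * N ^ 2 + (k - 1) * (p + q))" by (simp add: algebra_simps)
  also have "\<dots> < l * (k * (C - k * l))"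
  proof -
    have "k * k * l \<le> N * N * N" using up pos by (intro mult_mono) auto
    then have "k * k * l \<le> N ^ 3" by (simp add: power3_eq_cube)
    then have "2 * N ^ 2 + (k - 1) * (C - 1) < k * (C - k * l)"
      using C pos by (simp add: algebra_simps)
    then show ?thesis unfolding pq(1) using pos by simp
  qed
  also have "\<dots> = height C I' J'" by (simp add: height_def kl algebra_simps)
  finally show ?thesis unfolding C_def .
qed

lemma complete_flag_gap:
  fixes w :: "nat \<Rightarrow> real"
  assumes f: "complete_flag A F" "finite A"
    and eq: "\<And>I' J'. (I', J') \<in> F \<Longrightarrow> gap w I' J' = height (real_of_int (height_offset (card A))) I' J'"
    and IJ: "I' \<subseteq> A" "J' \<subseteq> A" "I' \<noteq> {}" "J' \<noteq> {}"
  shows "gap w I' J' \<le> height (real_of_int (height_offset (card A))) I' J'"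
    and "(I', J') \<notin> F \<Longrightarrow> gap w I' J' < height (real_of_int (height_offset (card A))) I' J'"
proof -
  obtain I J where F: "flag A F I J" "I \<union> J = A" using f by (auto simp: complete_flag_def)
  have "gap w I' J' \<le> height (real_of_int (height_offset (card A))) I' J' \<and>
      ((I', J') \<notin> F \<longrightarrow> gap w I' J' < height (real_of_int (height_offset (card A))) I' J')"
  proof -
    consider "I' \<subseteq> I" "J' \<subseteq> J" | z where "z \<in> I'" "z \<in> J" | z where "z \<in> J'" "z \<in> I"
      using IJ(1,2) F(2) by blast
    then show ?thesis
    proof cases
      case 1
      show ?thesis by (rule flag_gap[OF F(1) eq 1 IJ(3,4)])
    next
      case 2
      then show ?thesis using flag_gap_outside[OF F f(2) eq IJ(1,2,4) 2] by simp
    next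
      case 3
      have "gap (\<lambda>j. - w j) J' I' < height (real_of_int (height_offset (card A))) J' I'"
      proof (rule flag_gap_outside[OF flag_swap[OF F(1)] _ f(2) _ IJ(2,1,3) 3])
        show "J \<union> I = A" using F(2) by blast
        show "gap (\<lambda>j. - w j) K L = height (real_of_int (height_offset (card A))) K L" if "(K, L) \<in> prod.swap ` F" for K L
          using that eq unfolding gap_swap height_swap[of _ K L] by auto
      qed
      then show ?thesis unfolding gap_swap height_swap[of _ J' I'] by simp
    qed
  qed
  then show "gap w I' J' \<le> height (real_of_int (height_offset (card A))) I' J'"
    "(I', J') \<notin> F \<Longrightarrow> gap w I' J' < height (real_of_int (height_offset (card A))) I' J'" by auto
qed

section \<open>Support functionals of flags\<close>

locale root_system_A =
  fixes n :: nat and e :: "nat \<Rightarrow> 'a::euclidean_space"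
  assumes n_pos: "n \<ge> 1" and basis: "bij_betw e {1..n+1} Basis"
begin

definition A :: "nat set" where "A = {1..n+1}"

abbreviation "N \<equiv> root_lattice e n"
abbreviation "\<Phi> \<equiv> roots e n"

lemma finite_A [simp]: "finite A" and card_A: "card A = n + 1" and one_in_A: "1 \<in> A"
  by (auto simp: A_def)

lemma basis_A: "bij_betw e A Basis"
  using basis by (simp add: A_def)

lemma e_inner: "i \<in> A \<Longrightarrow> j \<in> A \<Longrightarrow> e i \<bullet> e j = (if i = j then 1 else 0)"
  using bij_betwE[OF basis_A] inner_Basis[of "e i" "e j"] bij_betw_imp_inj_on[OF basis_A] by (auto simp: inj_on_def)

lemma expand: "x = (\<Sum>j\<in>A. (x \<bullet> e j) *\<^sub>R e j)"
  using euclidean_representation[of x] sum.reindex_bij_betw[OF basis_A, of "\<lambda>b. (x \<bullet> b) *\<^sub>R b"] by simp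

lemma vec_eqI: "(\<And>j. j \<in> A \<Longrightarrow> x \<bullet> e j = y \<bullet> e j) \<Longrightarrow> x = y"
  using expand[of x] expand[of y] by simp

lemma sum_scaled_inner:
  assumes "I \<subseteq> A" "j \<in> A"
  shows "(\<Sum>i\<in>I. c i *\<^sub>R e i) \<bullet> e j = (if j \<in> I then c j else 0)"
proof -
  have "(\<Sum>i\<in>I. c i *\<^sub>R e i) \<bullet> e j = (\<Sum>i\<in>I. if j = i then c i else 0)"
    unfolding inner_sum_left using assms by (intro sum.cong) (auto simp: e_inner subset_iff)
  then show ?thesis using finite_subset[OF assms(1) finite_A] by simp
qed

lemma sum_inner: "I \<subseteq> A \<Longrightarrow> j \<in> A \<Longrightarrow> (\<Sum>i\<in>I. e i) \<bullet> e j = (if j \<in> I then 1 else 0)"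
  using sum_scaled_inner[of I j "\<lambda>_. 1"] by simp

lemma finite_roots: "finite \<Phi>"
proof -
  have "\<Phi> \<subseteq> (\<lambda>(i, j). e i - e j) ` (A \<times> A)" by (auto simp: roots_def A_def)
  then show ?thesis by (rule finite_subset) simp
qed

lemma rootI: "i \<in> A \<Longrightarrow> j \<in> A \<Longrightarrow> i \<noteq> j \<Longrightarrow> e i - e j \<in> \<Phi>"
  unfolding roots_def A_def by blast

lemma rootE:
  assumes "v \<in> \<Phi>"
  obtains i j where "i \<in> A" "j \<in> A" "i \<noteq> j" "v = e i - e j"
  using assms unfolding roots_def A_def by blast

lemma roots_lattice: "\<Phi> \<subseteq> N"
proof
  fix v assume v: "v \<in> \<Phi>"
  have "v = (\<Sum>u\<in>\<Phi>. of_int (if u = v then 1 else 0) *\<^sub>R u)"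
    using v finite_roots by (simp add: if_distrib[of of_int] if_distrib[of "\<lambda>x. x *\<^sub>R _"] cong: if_cong)
  then show "v \<in> N" unfolding root_lattice_def by (intro image_eqI[of _ _ "\<lambda>u. if u = v then 1 else 0"]) auto
qed

lemma lattice_add: "x \<in> N \<Longrightarrow> y \<in> N \<Longrightarrow> x + y \<in> N"
proof -
  assume "x \<in> N" "y \<in> N"
  then obtain c d :: "'a \<Rightarrow> int" where "x = (\<Sum>v\<in>\<Phi>. of_int (c v) *\<^sub>R v)" "y = (\<Sum>v\<in>\<Phi>. of_int (d v) *\<^sub>R v)"
    unfolding root_lattice_def by blast
  then have "x + y = (\<Sum>v\<in>\<Phi>. of_int (c v + d v) *\<^sub>R v)" by (simp add: scaleR_add_left sum.distrib)
  then show ?thesis unfolding root_lattice_def by (intro image_eqI[of _ _ "\<lambda>v. c v + d v"]) auto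
qed

lemma lattice_zero: "0 \<in> N"
  unfolding root_lattice_def by (intro image_eqI[of _ _ "\<lambda>_. 0"]) auto

lemma lattice_sum: "(\<And>i. i \<in> I \<Longrightarrow> f i \<in> N) \<Longrightarrow> (\<Sum>i\<in>I. f i) \<in> N"
  by (induction I rule: infinite_finite_induct) (auto intro: lattice_add lattice_zero)

lemma span_lattice: "span N = span \<Phi>"
proof
  have "N \<subseteq> span \<Phi>" unfolding root_lattice_def by (auto intro: span_sum span_scale span_base)
  then show "span N \<subseteq> span \<Phi>" by (metis span_mono span_span)
  show "span \<Phi> \<subseteq> span N" by (rule span_mono[OF roots_lattice])
qed

lemma span_lattice_iff: "x \<in> span N \<longleftrightarrow> (\<Sum>j\<in>A. x \<bullet> e j) = 0"
proof
  have "subspace {x. (\<Sum>j\<in>A. x \<bullet> e j) = 0}"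
    by (auto simp: subspace_def inner_add_left sum.distrib sum_distrib_left[symmetric])
  moreover have "\<Phi> \<subseteq> {x. (\<Sum>j\<in>A. x \<bullet> e j) = 0}"
  proof
    fix v assume "v \<in> \<Phi>"
    then obtain i j where "i \<in> A" "j \<in> A" "v = e i - e j" by (rule rootE)
    then show "v \<in> {x. (\<Sum>j\<in>A. x \<bullet> e j) = 0}"
      by (auto simp: inner_diff_left sum_subtractf e_inner)
  qed
  ultimately have "span \<Phi> \<subseteq> {x. (\<Sum>j\<in>A. x \<bullet> e j) = 0}" by (rule span_minimal[rotated])
  then show "x \<in> span N \<Longrightarrow> (\<Sum>j\<in>A. x \<bullet> e j) = 0" unfolding span_lattice by blast
  assume z: "(\<Sum>j\<in>A. x \<bullet> e j) = 0"
  have "x = (\<Sum>j\<in>A. (x \<bullet> e j) *\<^sub>R (e j - e 1))"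
    unfolding scaleR_diff_right sum_subtractf scaleR_sum_left[symmetric] z using expand[of x] by simp
  moreover have "e j - e 1 \<in> span \<Phi>" if "j \<in> A" for j
    using that rootI[of j 1] one_in_A by (cases "j = 1") (auto intro: span_base span_zero)
  then have "(\<Sum>j\<in>A. (x \<bullet> e j) *\<^sub>R (e j - e 1)) \<in> span \<Phi>" by (intro span_sum span_scale)
  ultimately show "x \<in> span N" unfolding span_lattice by simp
qed

text \<open>
The orthogonal projection to the span of the roots of the vector with coordinates \<open>w\<close>.
\<close>

definition weight :: "(nat \<Rightarrow> real) \<Rightarrow> 'a" where
  "weight w = (\<Sum>j\<in>A. (w j - sum w A / real (card A)) *\<^sub>R e j)"

lemma weight_span: "weight w \<in> span N"
  unfolding span_lattice_iff weight_def
  by (simp add: sum_scaled_inner sum_subtractf card_A)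

lemma weight_inner:
  assumes "x \<in> span N"
  shows "weight w \<bullet> x = (\<Sum>j\<in>A. w j * (x \<bullet> e j))"
proof -
  have "weight w \<bullet> x = (\<Sum>j\<in>A. (w j - sum w A / real (card A)) * (x \<bullet> e j))"
    unfolding weight_def inner_sum_left by (simp add: inner_commute)
  also have "\<dots> = (\<Sum>j\<in>A. w j * (x \<bullet> e j)) - sum w A / real (card A) * (\<Sum>j\<in>A. x \<bullet> e j)"
    by (simp add: left_diff_distrib sum_subtractf sum_distrib_left)
  finally show ?thesis using assms unfolding span_lattice_iff by simp
qed

lemma weight_dual_lattice: "weight (\<lambda>j. real_of_int (w j)) \<in> dual_lattice N"
proof -
  let ?m = "weight (\<lambda>j. real_of_int (w j))"
  have "?m \<bullet> v \<in> \<int>" if v: "v \<in> N" for v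
  proof -
    have "?m \<bullet> u \<in> \<int>" if u: "u \<in> \<Phi>" for u
    proof -
      obtain i j where ij: "i \<in> A" "j \<in> A" "u = e i - e j" by (rule rootE[OF u])
      have "?m \<bullet> u = (\<Sum>k\<in>A. real_of_int (w k) * (u \<bullet> e k))"
        using u roots_lattice by (intro weight_inner) (auto intro: span_base)
      also have "\<dots> = (\<Sum>k\<in>A. real_of_int (w k * ((if i = k then 1 else 0) - (if j = k then 1 else 0))))"
        using ij by (intro sum.cong) (auto simp: inner_diff_left e_inner)
      finally show ?thesis by (simp only: of_int_sum[symmetric] Ints_of_int)
    qed
    moreover obtain c :: "'a \<Rightarrow> int" where "v = (\<Sum>u\<in>\<Phi>. of_int (c u) *\<^sub>R u)" using v unfolding root_lattice_def by blast
    ultimately show ?thesis by (auto simp: inner_sum_right intro!: Ints_sum Ints_mult)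
  qed
  then show ?thesis unfolding dual_lattice_def using weight_span by blast
qed

text \<open>
The sum of the roots in the face \<open>(I, J)\<close>, a multiple of its barycentre that lies in the lattice.
\<close>

definition bary :: "nat set \<times> nat set \<Rightarrow> 'a" where
  "bary = (\<lambda>(I, J). real (card J) *\<^sub>R (\<Sum>i\<in>I. e i) - real (card I) *\<^sub>R (\<Sum>j\<in>J. e j))"

lemma bary_inner:
  assumes "I \<subseteq> A" "J \<subseteq> A" "j \<in> A"
  shows "bary (I, J) \<bullet> e j = real (card J) * (if j \<in> I then 1 else 0) - real (card I) * (if j \<in> J then 1 else 0)"
  unfolding bary_def using assms by (simp add: inner_diff_left sum_inner)

lemma bary_roots:
  "bary (I, J) = (\<Sum>i\<in>I. \<Sum>j\<in>J. e i - e j)"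
  by (simp add: bary_def sum_subtractf sum_constant_scaleR scaleR_sum_right)

lemma bary_lattice:
  assumes "I \<subseteq> A" "J \<subseteq> A" "I \<inter> J = {}"
  shows "bary (I, J) \<in> N"
proof -
  have "e i - e j \<in> N" if "i \<in> I" "j \<in> J" for i j
    using rootI[of i j] that assms roots_lattice by blast
  then show ?thesis unfolding bary_roots by (intro lattice_sum)
qed

lemma weight_bary:
  assumes "I \<subseteq> A" "J \<subseteq> A" "I \<inter> J = {}"
  shows "weight w \<bullet> bary (I, J) = gap w I J"
proof -
  have s: "(\<Sum>j\<in>A. w j * (if j \<in> T then 1 else 0)) = sum w T" if "T \<subseteq> A" for T
    using that by (intro sum.mono_neutral_cong_right) auto
  have "weight w \<bullet> bary (I, J) = (\<Sum>j\<in>A. w j * (bary (I, J) \<bullet> e j))"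
    by (intro weight_inner span_base bary_lattice assms)
  also have "\<dots> = (\<Sum>j\<in>A. real (card J) * (w j * (if j \<in> I then 1 else 0)) - real (card I) * (w j * (if j \<in> J then 1 else 0)))"
    using assms by (intro sum.cong refl) (simp add: bary_inner algebra_simps)
  also have "\<dots> = gap w I J"
    unfolding sum_subtractf sum_distrib_left[symmetric] s[OF assms(1)] s[OF assms(2)] gap_def by simp
  finally show ?thesis .
qed

lemma flag_pair_lattice:
  assumes "flag A F I J" "p \<in> F"
  shows "bary p \<in> N"
proof -
  obtain I' J' where p: "p = (I', J')" by (cases p)
  show ?thesis
    unfolding p using flag_pair[OF assms(1) assms(2)[unfolded p]] flag_top[OF assms(1)]
    by (intro bary_lattice) auto
qed

text \<open>
The generators of two consecutive faces differ by a sum of differences \<open>e z - e j\<close> (or \<open>e i - e z\<close>)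
that involve the new index \<open>z\<close>. Modulo the previous differences these summands are equal, so each of
them lies in the span.
\<close>

lemma flag_spans:
  assumes "flag A F I J" "i \<in> I \<union> J" "j \<in> I \<union> J"
  shows "e i - e j \<in> span (bary ` F)"
  using assms
proof (induction arbitrary: i j rule: flag.induct)
  case (start a b)
  have "e a - e b \<in> span (bary ` {({a}, {b})})" by (intro span_base) (simp add: bary_def)
  moreover from span_neg[OF this] have "e b - e a \<in> span (bary ` {({a}, {b})})" by simp
  ultimately show ?case using start.prems by (auto simp: span_zero)
next
  case (step F I J K L)
  note top = flag_top[OF step.hyps(1)]
  have fin: "finite I" "finite J" and ne: "I \<noteq> {}" "J \<noteq> {}" using flag_pair[OF step.hyps(1) top(1)] by auto
  let ?S = "span (bary ` insert (K, L) F)"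
  have sub: "span (bary ` F) \<subseteq> ?S" by (intro span_mono) auto
  have old: "e i - e j \<in> ?S" if "i \<in> I \<union> J" "j \<in> I \<union> J" for i j using step.IH[OF that] sub by blast
  have bKL: "bary (K, L) \<in> ?S" by (intro span_base) simp
  have bIJ: "bary (I, J) \<in> ?S" using top(1) by (intro span_base) auto
  obtain z where z: "z \<in> A" "z \<notin> I \<union> J" "K = insert z I \<and> L = J \<or> K = I \<and> L = insert z J"
    using step.hyps(2) unfolding pair_extends_def by blast
  obtain i0 j0 where ij0: "i0 \<in> I" "j0 \<in> J" using ne by blast
  have new: "\<exists>x\<in>I \<union> J. e z - e x \<in> ?S"
    using z(3)
  proof
    assume KL: "K = insert z I \<and> L = J"
    have "bary (K, L) = bary (I, J) + (\<Sum>j\<in>J. e z - e j)"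
      using KL z(2) fin by (simp add: bary_roots add.commute)
    then have "(\<Sum>j\<in>J. e z - e j) \<in> ?S" using span_diff[OF bKL bIJ] by simp
    moreover have "(\<Sum>j\<in>J. e z - e j) = real (card J) *\<^sub>R (e z - e j0) + (\<Sum>j\<in>J. e j0 - e j)"
      by (simp add: sum_subtractf sum_constant_scaleR algebra_simps)
    moreover have "(\<Sum>j\<in>J. e j0 - e j) \<in> ?S" using ij0 by (intro span_sum old) auto
    ultimately have "real (card J) *\<^sub>R (e z - e j0) \<in> ?S" using span_diff by fastforce
    then have "(1 / real (card J)) *\<^sub>R (real (card J) *\<^sub>R (e z - e j0)) \<in> ?S" by (rule span_scale)
    moreover have "real (card J) \<noteq> 0" using fin ne by simp
    ultimately have "e z - e j0 \<in> ?S" by simp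
    then show ?thesis using ij0 by blast
  next
    assume KL: "K = I \<and> L = insert z J"
    have "bary (K, L) = bary (I, J) + (\<Sum>i\<in>I. e i - e z)"
      using KL z(2) fin by (simp add: bary_roots sum.distrib)
    then have "(\<Sum>i\<in>I. e i - e z) \<in> ?S" using span_diff[OF bKL bIJ] by simp
    moreover have "(\<Sum>i\<in>I. e i - e z) = (\<Sum>i\<in>I. e i - e i0) - real (card I) *\<^sub>R (e z - e i0)"
      by (simp add: sum_subtractf sum_constant_scaleR algebra_simps)
    moreover have "(\<Sum>i\<in>I. e i - e i0) \<in> ?S" using ij0 by (intro span_sum old) auto
    ultimately have "real (card I) *\<^sub>R (e z - e i0) \<in> ?S" using span_diff by fastforce
    then have "(1 / real (card I)) *\<^sub>R (real (card I) *\<^sub>R (e z - e i0)) \<in> ?S" by (rule span_scale)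
    moreover have "real (card I) \<noteq> 0" using fin ne by simp
    ultimately have "e z - e i0 \<in> ?S" by simp
    then show ?thesis using ij0 by blast
  qed
  then obtain x where x: "x \<in> I \<union> J" "e z - e x \<in> ?S" by blast
  have zx: "e z - e j \<in> ?S" if "j \<in> I \<union> J" for j
    using span_add[OF x(2) old[OF x(1) that]] by simp
  have xz: "e j - e z \<in> ?S" if "j \<in> I \<union> J" for j
    using span_neg[OF zx[OF that]] by simp
  have "K \<union> L = insert z (I \<union> J)" using z(3) by auto
  then show ?case using step.prems old zx xz by (auto simp: span_zero)
qed

lemma complete_flag_span:
  assumes "complete_flag A F"
  shows "span (bary ` F) = span N"
proof
  obtain I J where F: "flag A F I J" "I \<union> J = A" using assms by (auto simp: complete_flag_def)
  have "bary ` F \<subseteq> N" using flag_pair_lattice[OF F(1)] by blast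
  then show "span (bary ` F) \<subseteq> span N" by (rule span_mono)
  have "\<Phi> \<subseteq> span (bary ` F)" using flag_spans[OF F(1)] F(2) by (auto elim!: rootE)
  then show "span N \<subseteq> span (bary ` F)" unfolding span_lattice by (metis span_mono span_span)
qed

text \<open>
The vector minus \<open>t\<close> times the generator of \<open>(I, J)\<close>, with \<open>t\<close> as large as the signs of the coordinates
allow, has a zero coordinate. Its index can be removed from its set, unless it is the only element
there; but then all coordinates vanish, because their sum is zero, and an index of the other set can
be removed.
\<close>

lemma flag_cover:
  assumes "I \<subseteq> A" "J \<subseteq> A" "I \<inter> J = {}" "I \<noteq> {}" "J \<noteq> {}"
    and "\<And>i. i \<in> I \<Longrightarrow> 0 \<le> u i" "\<And>j. j \<in> J \<Longrightarrow> u j \<le> 0" "sum u (I \<union> J) = 0"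
  shows "\<exists>F. flag A F I J \<and> (\<Sum>j\<in>I \<union> J. u j *\<^sub>R e j) \<in> Cone (bary ` F)"
  using assms
proof (induction "card I + card J" arbitrary: I J u rule: less_induct)
  case less
  have fin: "finite I" "finite J"
    using finite_subset[OF less.prems(1) finite_A] finite_subset[OF less.prems(2) finite_A] by auto
  have split: "sum f (I \<union> J) = sum f I + sum f J" for f :: "nat \<Rightarrow> 'x::comm_monoid_add"
    using fin less.prems(3) by (rule sum.union_disjoint)
  show ?case
  proof (cases "card I = 1 \<and> card J = 1")
    case True
    then obtain i j where ij: "I = {i}" "J = {j}" by (auto simp: card_1_singleton_iff)
    then have F: "flag A {({i}, {j})} I J" using less.prems flag.start[of i A j] by auto
    have "u j = - u i" "i \<noteq> j" using less.prems(3,8) ij by (auto simp: split)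
    then have "(\<Sum>j\<in>I \<union> J. u j *\<^sub>R e j) = u i *\<^sub>R bary ({i}, {j})"
      using ij by (simp add: bary_def scaleR_diff_right)
    moreover have "u i *\<^sub>R bary ({i}, {j}) \<in> Cone (bary ` {({i}, {j})})"
      using less.prems(6) ij by (intro Cone_scale Cone_base) auto
    ultimately show ?thesis using F by auto
  next
    case False
    define k l where kl: "k = real (card I)" "l = real (card J)"
    have pos: "k > 0" "l > 0" using fin less.prems by (auto simp: kl card_gt_0_iff)
    \<comment> \<open>The coordinate at \<open>x\<close> reaches zero after subtracting \<open>f x\<close> times the generator.\<close>
    define f where "f x = (if x \<in> I then u x / l else - u x / k)" for x
    have "Min (f ` (I \<union> J)) \<in> f ` (I \<union> J)" using fin less.prems by (intro Min_in) auto
    then obtain z where zz: "Min (f ` (I \<union> J)) = f z" "z \<in> I \<union> J" by (rule imageE)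
    note z = zz(2) zz(1)[symmetric]
    have min: "f z \<le> f x" if "x \<in> I \<union> J" for x
      unfolding z(2) using fin that by (intro Min_le) auto
    define t where "t = f z"
    have t0: "t \<ge> 0" using z(1) less.prems(6,7)[of z] pos by (auto simp: t_def f_def divide_simps)
    define u' where "u' x = u x - t * (if x \<in> I then l else - k)" for x
    have u'I: "0 \<le> u' x" if "x \<in> I" for x
      using min[of x] that pos by (auto simp: u'_def t_def[symmetric] f_def[of x] field_simps)
    have u'J: "u' x \<le> 0" if "x \<in> J" for x
    proof -
      have "x \<notin> I" using that less.prems(3) by auto
      then show ?thesis using min[of x] that pos by (auto simp: u'_def t_def[symmetric] f_def[of x] field_simps)
    qed
    have cI: "sum (\<lambda>x. if x \<in> I then l else - k) I = k * l" by (simp add: kl)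
    have cJ: "sum (\<lambda>x. if x \<in> I then l else - k) J = - (k * l)"
    proof -
      have "sum (\<lambda>x. if x \<in> I then l else - k) J = sum (\<lambda>x. - k) J"
        using less.prems(3) by (intro sum.cong) auto
      then show ?thesis by (simp add: kl)
    qed
    have u'0: "sum u' (I \<union> J) = 0"
      using less.prems(8) unfolding u'_def sum_subtractf sum_distrib_left[symmetric] split cI cJ by simp
    have x: "(\<Sum>j\<in>I \<union> J. u j *\<^sub>R e j) = t *\<^sub>R bary (I, J) + (\<Sum>j\<in>I \<union> J. u' j *\<^sub>R e j)"
    proof -
      have "(\<Sum>j\<in>I \<union> J. (if j \<in> I then l else - k) *\<^sub>R e j) = bary (I, J)"
      proof -
        have "(\<Sum>j\<in>J. (if j \<in> I then l else - k) *\<^sub>R e j) = (\<Sum>j\<in>J. (- k) *\<^sub>R e j)"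
          using less.prems(3) by (intro sum.cong) auto
        then show ?thesis unfolding split by (simp add: bary_def kl scaleR_sum_right sum_negf)
      qed
      then have "t *\<^sub>R bary (I, J) = (\<Sum>j\<in>I \<union> J. (t * (if j \<in> I then l else - k)) *\<^sub>R e j)"
        by (metis (no_types, lifting) scaleR_scaleR scaleR_sum_right sum.cong)
      then show ?thesis unfolding u'_def by (simp add: sum.distrib[symmetric] scaleR_add_left[symmetric])
    qed
    have zero: "u' z = 0"
      using z(1) pos less.prems(3) by (auto simp: u'_def t_def f_def)
    have "\<exists>z. u' z = 0 \<and> (z \<in> I \<and> I \<noteq> {z} \<or> z \<in> J \<and> J \<noteq> {z})"
    proof (rule ccontr)
      assume c: "\<nexists>z. u' z = 0 \<and> (z \<in> I \<and> I \<noteq> {z} \<or> z \<in> J \<and> J \<noteq> {z})"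
      from z(1) show False
      proof
        assume "z \<in> I"
        then have I: "I = {z}" using c zero by blast
        then have "sum u' J = 0" using u'0 zero unfolding split by simp
        then have "\<forall>x\<in>J. u' x = 0"
          using sum_nonneg_eq_0_iff[OF fin(2), of "\<lambda>x. - u' x"] u'J by (auto simp: sum_negf)
        then have "\<forall>x\<in>J. J = {x}" using c by blast
        then have "card J = 1" using less.prems(5) by (metis card_1_singleton_iff ex_in_conv One_nat_def)
        then show False using False I by simp
      next
        assume "z \<in> J"
        then have J: "J = {z}" using c zero by blast
        then have "sum u' I = 0" using u'0 zero unfolding split by simp
        then have "\<forall>x\<in>I. u' x = 0" using sum_nonneg_eq_0_iff[OF fin(1), of u'] u'I by auto
        then have "\<forall>x\<in>I. I = {x}" using c by blast
        then have "card I = 1" using less.prems(4) by (metis card_1_singleton_iff ex_in_conv One_nat_def)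
        then show False using False J by simp
      qed
    qed
    then obtain y where y: "u' y = 0" "y \<in> I \<and> I \<noteq> {y} \<or> y \<in> J \<and> J \<noteq> {y}" by blast
    have rest: "(\<Sum>j\<in>I \<union> J. u' j *\<^sub>R e j) = (\<Sum>j\<in>I \<union> J - {y}. u' j *\<^sub>R e j)" "sum u' (I \<union> J - {y}) = 0"
    proof -
      have "y \<in> I \<union> J" "finite (I \<union> J)" using y fin by auto
      note remove = sum.remove[OF this(2,1)]
      show "(\<Sum>j\<in>I \<union> J. u' j *\<^sub>R e j) = (\<Sum>j\<in>I \<union> J - {y}. u' j *\<^sub>R e j)"
        unfolding remove[of "\<lambda>j. u' j *\<^sub>R e j"] y(1) by simp
      show "sum u' (I \<union> J - {y}) = 0" using u'0 unfolding remove[of u'] y(1) by simp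
    qed
    have "\<exists>F K L. flag A F K L \<and> (\<Sum>j\<in>I \<union> J. u' j *\<^sub>R e j) \<in> Cone (bary ` F) \<and> pair_extends A K L I J"
      using y(2)
    proof
      assume yI: "y \<in> I \<and> I \<noteq> {y}"
      then have e: "(I - {y}) \<union> J = I \<union> J - {y}" using less.prems(3) by auto
      have "\<exists>F. flag A F (I - {y}) J \<and> (\<Sum>j\<in>(I - {y}) \<union> J. u' j *\<^sub>R e j) \<in> Cone (bary ` F)"
      proof (rule less.hyps)
        show "card (I - {y}) + card J < card I + card J" using card_Diff1_less[OF fin(1), of y] yI by simp
        show "sum u' (I - {y} \<union> J) = 0" unfolding e by (rule rest(2))
      qed (use yI less.prems u'I u'J in auto)
      moreover have "pair_extends A (I - {y}) J I J"
        unfolding pair_extends_def using yI less.prems(1,3) by (intro bexI[of _ y]) auto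
      ultimately show ?thesis unfolding rest(1) e by blast
    next
      assume yJ: "y \<in> J \<and> J \<noteq> {y}"
      then have e: "I \<union> (J - {y}) = I \<union> J - {y}" using less.prems(3) by auto
      have "\<exists>F. flag A F I (J - {y}) \<and> (\<Sum>j\<in>I \<union> (J - {y}). u' j *\<^sub>R e j) \<in> Cone (bary ` F)"
      proof (rule less.hyps)
        show "card I + card (J - {y}) < card I + card J" using card_Diff1_less[OF fin(2), of y] yJ by simp
        show "sum u' (I \<union> (J - {y})) = 0" unfolding e by (rule rest(2))
      qed (use yJ less.prems u'I u'J in auto)
      moreover have "pair_extends A I (J - {y}) I J"
        unfolding pair_extends_def using yJ less.prems(2,3) by (intro bexI[of _ y]) auto
      ultimately show ?thesis unfolding rest(1) e by blast
    qed
    then obtain F K L where F: "flag A F K L" "(\<Sum>j\<in>I \<union> J. u' j *\<^sub>R e j) \<in> Cone (bary ` F)" "pair_extends A K L I J"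
      by blast
    let ?F = "insert (I, J) F"
    have fF: "finite (bary ` ?F)" using flag_finite[OF F(1)] by simp
    have "(\<Sum>j\<in>I \<union> J. u' j *\<^sub>R e j) \<in> Cone (bary ` ?F)"
      using F(2) Cone_mono[of "bary ` F" "bary ` ?F"] by auto
    moreover have "t *\<^sub>R bary (I, J) \<in> Cone (bary ` ?F)"
      using t0 fF by (intro Cone_scale Cone_base) auto
    ultimately have "(\<Sum>j\<in>I \<union> J. u j *\<^sub>R e j) \<in> Cone (bary ` ?F)"
      unfolding x using Cone_add[OF fF] by blast
    then show ?thesis using flag.step[OF F(1,3)] by blast
  qed
qed

lemma complete_flag_cover:
  assumes x: "x \<in> span N"
  shows "\<exists>F. complete_flag A F \<and> x \<in> Cone (bary ` F)"
proof -
  define u where "u j = x \<bullet> e j" for j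
  have s: "sum u A = 0" using x by (simp add: span_lattice_iff u_def)
  have xe: "x = (\<Sum>j\<in>A. u j *\<^sub>R e j)" unfolding u_def by (rule expand)
  have "\<exists>I J. I \<union> J = A \<and> I \<inter> J = {} \<and> I \<noteq> {} \<and> J \<noteq> {} \<and> (\<forall>i\<in>I. 0 \<le> u i) \<and> (\<forall>j\<in>J. u j \<le> 0)"
  proof (cases "\<exists>j\<in>A. u j < 0")
    case True
    have "\<exists>j\<in>A. 0 \<le> u j"
    proof (rule ccontr)
      assume "\<not> (\<exists>j\<in>A. 0 \<le> u j)"
      then have "sum u A < sum (\<lambda>_. 0) A" using one_in_A by (intro sum_strict_mono) (auto simp: not_le)
      then show False using s by simp
    qed
    then show ?thesis using True
      by (intro exI[of _ "{j\<in>A. 0 \<le> u j}"] exI[of _ "{j\<in>A. u j < 0}"]) auto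
  next
    case False
    then have "\<forall>j\<in>A. u j = 0" using sum_nonneg_eq_0_iff[of A u] s by (auto simp: not_less)
    moreover have "2 \<in> A" using n_pos by (simp add: A_def)
    then have "A - {1} \<noteq> {}" by auto
    ultimately show ?thesis using one_in_A by (intro exI[of _ "{1}"] exI[of _ "A - {1}"]) auto
  qed
  then obtain I J where IJ: "I \<union> J = A" "I \<inter> J = {}" "I \<noteq> {}" "J \<noteq> {}" "\<forall>i\<in>I. 0 \<le> u i" "\<forall>j\<in>J. u j \<le> 0" by blast
  have "\<exists>F. flag A F I J \<and> (\<Sum>j\<in>I \<union> J. u j *\<^sub>R e j) \<in> Cone (bary ` F)"
    by (rule flag_cover) (use IJ s in auto)
  then show ?thesis using IJ(1) xe unfolding complete_flag_def by metis
qed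

text \<open>
The linear extension of the heights over the cone of \<open>F\<close>.
\<close>

definition supports :: "'a \<Rightarrow> (nat set \<times> nat set) set \<Rightarrow> bool" where
  "supports m F \<longleftrightarrow> m \<in> dual_lattice N \<and>
     (\<forall>(I, J)\<in>F. m \<bullet> bary (I, J) = height (real_of_int (height_offset (card A))) I J)"

lemma supportsD: "supports m F \<Longrightarrow> (I, J) \<in> F \<Longrightarrow> m \<bullet> bary (I, J) = height (real_of_int (height_offset (card A))) I J"
  unfolding supports_def by blast

lemma bary_imageE:
  assumes "b \<in> bary ` F"
  obtains I J where "(I, J) \<in> F" "b = bary (I, J)"
  using assms by (metis imageE surj_pair)

definition support_points :: "'a set" where
  "support_points = {m. \<exists>F. complete_flag A F \<and> supports m F}"

text \<open>
The flag is unique, see \<open>flag_of_eq\<close>.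
\<close>

definition flag_of :: "'a \<Rightarrow> (nat set \<times> nat set) set" where
  "flag_of m = (SOME F. complete_flag A F \<and> supports m F)"

lemma complete_flag_pair:
  assumes "complete_flag A F" "(I, J) \<in> F"
  shows "I \<subseteq> A" "J \<subseteq> A" "I \<inter> J = {}" "I \<noteq> {}" "J \<noteq> {}" "bary (I, J) \<in> N"
proof -
  obtain K L where F: "flag A F K L" using assms(1) by (auto simp: complete_flag_def)
  show "I \<subseteq> A" "J \<subseteq> A" "I \<inter> J = {}" "I \<noteq> {}" "J \<noteq> {}"
    using flag_pair[OF F assms(2)] flag_top[OF F] by auto
  show "bary (I, J) \<in> N" by (rule flag_pair_lattice[OF F assms(2)])
qed

lemma flag_weight:
  fixes h :: "nat set \<times> nat set \<Rightarrow> int"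
  assumes "complete_flag A F"
  shows "\<exists>m\<in>dual_lattice N. \<forall>(I, J)\<in>F. m \<bullet> bary (I, J) = real (card I * card J) * real_of_int (h (I, J))"
proof -
  obtain K L where F: "flag A F K L" using assms(1) by (auto simp: complete_flag_def)
  obtain w where w: "\<forall>(I, J)\<in>F. gap w I J = int (card I * card J) * h (I, J)"
    using flag_interpolation[OF F] by blast
  have "weight (\<lambda>j. real_of_int (w j)) \<bullet> bary (I, J) = real (card I * card J) * real_of_int (h (I, J))"
    if p: "(I, J) \<in> F" for I J
  proof -
    have "gap (\<lambda>j. real_of_int (w j)) I J = real_of_int (gap w I J)" by (simp add: gap_def)
    also have "\<dots> = real (card I * card J) * real_of_int (h (I, J))" using w p by auto
    finally show ?thesis using weight_bary complete_flag_pair(1-3)[OF assms p] by simp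
  qed
  then show ?thesis using weight_dual_lattice by blast
qed

lemma supports_exists: "complete_flag A F \<Longrightarrow> \<exists>m. supports m F"
  using flag_weight[of F "\<lambda>(I, J). height_offset (card A) - int (card I * card J)"]
  unfolding supports_def height_def by auto

lemma inner_bary: "m \<bullet> bary (I, J) = gap (\<lambda>j. m \<bullet> e j) I J"
  unfolding gap_def bary_def by (simp add: inner_diff_right inner_sum_right)

lemma supports_le:
  assumes F: "complete_flag A F" "supports m F" and IJ: "I \<subseteq> A" "J \<subseteq> A" "I \<inter> J = {}" "I \<noteq> {}" "J \<noteq> {}"
  shows "m \<bullet> bary (I, J) \<le> height (real_of_int (height_offset (card A))) I J"
    and "(I, J) \<notin> F \<Longrightarrow> m \<bullet> bary (I, J) < height (real_of_int (height_offset (card A))) I J"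
proof -
  have eq: "gap (\<lambda>j. m \<bullet> e j) I' J' = height (real_of_int (height_offset (card A))) I' J'" if "(I', J') \<in> F" for I' J'
    using supportsD[OF F(2) that] unfolding inner_bary .
  show "m \<bullet> bary (I, J) \<le> height (real_of_int (height_offset (card A))) I J"
    "(I, J) \<notin> F \<Longrightarrow> m \<bullet> bary (I, J) < height (real_of_int (height_offset (card A))) I J"
    unfolding inner_bary using complete_flag_gap[OF F(1) _ eq IJ(1,2,4,5)] by auto
qed

text \<open>
A functional attains the heights only on its own flag.
\<close>

lemma supports_unique_flag:
  assumes "complete_flag A F" "supports m F" "complete_flag A F'" "supports m F'"
  shows "F = F'"
proof -
  have "F \<subseteq> F'" if F: "complete_flag A F" "supports m F" "complete_flag A F'" "supports m F'" for F F'
  proof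
    fix p assume p: "p \<in> F"
    obtain I J where IJ: "p = (I, J)" by (cases p)
    have "m \<bullet> bary (I, J) = height (real_of_int (height_offset (card A))) I J"
      using supportsD[OF F(2)] p IJ by simp
    then show "p \<in> F'" using supports_le(2)[OF F(3,4) complete_flag_pair(1-5)[OF F(1)]] p IJ by fastforce
  qed
  then show ?thesis using assms by blast
qed

lemma flag_of: "m \<in> support_points \<Longrightarrow> complete_flag A (flag_of m) \<and> supports m (flag_of m)"
  unfolding support_points_def flag_of_def mem_Collect_eq by (rule someI_ex)

lemma flag_of_eq: "complete_flag A F \<Longrightarrow> supports m F \<Longrightarrow> flag_of m = F"
  using supports_unique_flag flag_of unfolding support_points_def by blast

lemma supports_unique_point:
  assumes F: "complete_flag A F" "supports m F" "supports m' F"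
  shows "m = m'"
proof -
  have "orthogonal (m - m') b" if "b \<in> bary ` F" for b
    using that supportsD[OF F(2)] supportsD[OF F(3)]
    by (auto simp: orthogonal_def inner_diff_left elim!: bary_imageE)
  moreover have "m - m' \<in> span (bary ` F)"
    unfolding complete_flag_span[OF F(1)] using F(2,3)
    by (auto simp: supports_def dual_lattice_def intro!: span_diff)
  ultimately have "orthogonal (m - m') (m - m')" using orthogonal_to_span by blast
  then show ?thesis by (simp add: orthogonal_def)
qed

lemma finite_complete_flags: "finite {F. complete_flag A F}"
proof -
  have "{F. complete_flag A F} \<subseteq> Pow (Pow A \<times> Pow A)"
    by (auto dest: complete_flag_pair(1,2))
  then show ?thesis by (rule finite_subset) auto
qed

lemma finite_support_points: "finite support_points"
proof (rule inj_on_finite)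
  show "inj_on flag_of support_points"
  proof (rule inj_onI)
    fix m m' assume "m \<in> support_points" "m' \<in> support_points" "flag_of m = flag_of m'"
    then show "m = m'" using supports_unique_point flag_of by metis
  qed
  show "flag_of ` support_points \<subseteq> {F. complete_flag A F}" using flag_of by auto
qed (rule finite_complete_flags)

sublocale simplicial_normal_fan N support_points "\<lambda>m. bary ` flag_of m"
proof
  show "finite support_points" by (rule finite_support_points)
  have "0 \<in> span N" by (rule span_zero)
  then obtain F0 where "complete_flag A F0" using complete_flag_cover by blast
  then show "support_points \<noteq> {}" using supports_exists unfolding support_points_def by blast
  show "support_points \<subseteq> dual_lattice N" by (auto simp: support_points_def supports_def)
  fix m assume m: "m \<in> support_points"
  let ?F = "flag_of m"
  have F: "complete_flag A ?F" "supports m ?F" using flag_of[OF m] by auto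
  show fin: "finite (bary ` ?F)"
    using F(1) flag_finite unfolding complete_flag_def by blast
  show "bary ` ?F \<subseteq> N" using complete_flag_pair(6)[OF F(1)] by auto
  show "span (bary ` ?F) = span N" by (rule complete_flag_span[OF F(1)])
  show "\<exists>d\<in>dual_lattice N. 0 < d \<bullet> b \<and> (\<forall>b'\<in>bary ` ?F - {b}. d \<bullet> b' = 0)" if b: "b \<in> bary ` ?F" for b
  proof -
    obtain I J where IJ: "(I, J) \<in> ?F" "b = bary (I, J)" by (rule bary_imageE[OF b])
    obtain d where d: "d \<in> dual_lattice N"
      "\<And>I' J'. (I', J') \<in> ?F \<Longrightarrow> d \<bullet> bary (I', J') = real (card I' * card J') * real_of_int (if (I', J') = (I, J) then 1 else 0)"
      using flag_weight[OF F(1), of "\<lambda>p. if p = (I, J) then 1 else 0"] by auto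
    have "finite I" "finite J"
      using finite_subset[OF _ finite_A] complete_flag_pair(1,2)[OF F(1) IJ(1)] by auto
    then have "0 < d \<bullet> b"
      using d(2)[OF IJ(1)] complete_flag_pair(4,5)[OF F(1) IJ(1)] unfolding IJ(2) by (simp add: card_gt_0_iff)
    moreover have "d \<bullet> b' = 0" if b': "b' \<in> bary ` ?F - {b}" for b'
    proof -
      have "b' \<in> bary ` ?F" using b' by simp
      then obtain I' J' where p: "(I', J') \<in> ?F" "b' = bary (I', J')" by (rule bary_imageE)
      then have "(I', J') \<noteq> (I, J)" using b' IJ(2) by auto
      then have "real_of_int (if (I', J') = (I, J) then 1 else 0) = 0" by simp
      then show ?thesis unfolding p(2) d(2)[OF p(1)] by simp
    qed
    ultimately show ?thesis using d(1) by blast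
  qed
  show "Cone (bary ` ?F) = {x \<in> span N. \<forall>m'\<in>support_points. m' \<bullet> x \<le> m \<bullet> x}"
  proof
    show "Cone (bary ` ?F) \<subseteq> {x \<in> span N. \<forall>m'\<in>support_points. m' \<bullet> x \<le> m \<bullet> x}"
    proof
      fix x assume x: "x \<in> Cone (bary ` ?F)"
      have "m' \<bullet> x \<le> m \<bullet> x" if m': "m' \<in> support_points" for m'
      proof -
        have "0 \<le> (m - m') \<bullet> b" if bF: "b \<in> bary ` ?F" for b
        proof -
          obtain I J where IJ: "(I, J) \<in> ?F" "b = bary (I, J)" by (rule bary_imageE[OF bF])
          have "m \<bullet> b = height (real_of_int (height_offset (card A))) I J" using supportsD[OF F(2)] IJ by simp
          then show ?thesis
            using supports_le(1)[of "flag_of m'" m', OF _ _ complete_flag_pair(1-5)[OF F(1) IJ(1)]] flag_of[OF m'] IJ(2)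
            by (simp add: inner_diff_left)
        qed
        then show ?thesis using Cone_inner_nonneg[of "bary ` ?F" "m - m'" x] x by (simp add: inner_diff_left)
      qed
      moreover have "x \<in> span N" using x Cone_span complete_flag_span[OF F(1)] by blast
      ultimately show "x \<in> {x \<in> span N. \<forall>m'\<in>support_points. m' \<bullet> x \<le> m \<bullet> x}" by blast
    qed
    show "{x \<in> span N. \<forall>m'\<in>support_points. m' \<bullet> x \<le> m \<bullet> x} \<subseteq> Cone (bary ` ?F)"
    proof
      fix x assume "x \<in> {x \<in> span N. \<forall>m'\<in>support_points. m' \<bullet> x \<le> m \<bullet> x}"
      then have x: "x \<in> span N" "\<And>m'. m' \<in> support_points \<Longrightarrow> m' \<bullet> x \<le> m \<bullet> x" by auto
      \<comment> \<open>Write \<open>x\<close> in the generators of some flag \<open>F'\<close>. As \<open>m\<close> stays below the functional of \<open>F'\<close> at the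
        generators and is maximal at \<open>x\<close>, only generators from the flag of \<open>m\<close> can have a positive
        coefficient.\<close>
      obtain F' where F': "complete_flag A F'" "x \<in> Cone (bary ` F')" using complete_flag_cover[OF x(1)] by blast
      obtain m' where m': "supports m' F'" using supports_exists[OF F'(1)] by blast
      then have mx: "m' \<bullet> x \<le> m \<bullet> x" using x(2) F'(1) unfolding support_points_def by blast
      have fin': "finite (bary ` F')" using F'(1) flag_finite unfolding complete_flag_def by blast
      obtain c where c: "\<And>b. b \<in> bary ` F' \<Longrightarrow> 0 \<le> c b" "x = (\<Sum>b\<in>bary ` F'. c b *\<^sub>R b)"
        by (rule ConeE[OF fin' F'(2)]) (rule that)
      have b: "0 \<le> (m' - m) \<bullet> b" "(m' - m) \<bullet> b = 0 \<Longrightarrow> b \<in> bary ` ?F" if bF: "b \<in> bary ` F'" for b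
      proof -
        obtain I J where IJ: "(I, J) \<in> F'" "b = bary (I, J)" by (rule bary_imageE[OF bF])
        have h: "m' \<bullet> b = height (real_of_int (height_offset (card A))) I J" using supportsD[OF m'] IJ by simp
        note le = supports_le[OF F complete_flag_pair(1-5)[OF F'(1) IJ(1)]]
        show "0 \<le> (m' - m) \<bullet> b" using h le(1) IJ(2) by (simp add: inner_diff_left)
        show "b \<in> bary ` ?F" if "(m' - m) \<bullet> b = 0"
          using h le(2) that IJ(2) by (fastforce simp: inner_diff_left)
      qed
      have "(\<Sum>b\<in>bary ` F'. c b * ((m' - m) \<bullet> b)) = (m' - m) \<bullet> x"
        unfolding c(2) by (simp add: inner_sum_right)
      also have "\<dots> \<le> 0" using mx by (simp add: inner_diff_left)
      finally have "(\<Sum>b\<in>bary ` F'. c b * ((m' - m) \<bullet> b)) \<le> 0" .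
      moreover have nn: "\<And>b. b \<in> bary ` F' \<Longrightarrow> 0 \<le> c b * ((m' - m) \<bullet> b)" using c(1) b(1) by simp
      ultimately have "(\<Sum>b\<in>bary ` F'. c b * ((m' - m) \<bullet> b)) = 0"
        using sum_nonneg[of "bary ` F'", OF nn] by (simp only: order_antisym)
      then have z: "\<forall>b\<in>bary ` F'. c b * ((m' - m) \<bullet> b) = 0"
        using sum_nonneg_eq_0_iff[OF fin' nn] by simp
      have "c b *\<^sub>R b \<in> Cone (bary ` ?F)" if "b \<in> bary ` F'" for b
      proof (cases "c b = 0")
        case False
        then have "b \<in> bary ` ?F" using z that b(2) by auto
        then show ?thesis using Cone_scale[OF fin Cone_base c(1)[OF that]] by blast
      qed (simp add: zero_in_Cone)
      moreover have "(\<Sum>b\<in>T. c b *\<^sub>R b) \<in> Cone (bary ` ?F)" if "finite T" "\<And>b. b \<in> T \<Longrightarrow> c b *\<^sub>R b \<in> Cone (bary ` ?F)" for T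
        using that by (induction T rule: finite_induct) (auto intro: zero_in_Cone Cone_add[OF fin])
      ultimately show "x \<in> Cone (bary ` ?F)" unfolding c(2) using fin' by blast
    qed
  qed
qed

end

section \<open>Staircase paths and flags\<close>

lemma Cone_rescale:
  assumes T: "finite T" and c: "\<And>t. t \<in> T \<Longrightarrow> 0 < c t"
  shows "Cone ((\<lambda>t. c t *\<^sub>R f t) ` T) = Cone (f ` T)"
proof
  show "Cone ((\<lambda>t. c t *\<^sub>R f t) ` T) \<subseteq> Cone (f ` T)"
    using T c by (intro Cone_minimal)
      (auto intro!: Cone_scale Cone_add zero_in_Cone intro: Cone_base less_imp_le)
  show "Cone (f ` T) \<subseteq> Cone ((\<lambda>t. c t *\<^sub>R f t) ` T)"
  proof (rule Cone_minimal)
    show "f ` T \<subseteq> Cone ((\<lambda>t. c t *\<^sub>R f t) ` T)"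
    proof
      fix x assume "x \<in> f ` T"
      then obtain t where t: "t \<in> T" "x = f t" by auto
      have "(1 / c t) *\<^sub>R (c t *\<^sub>R f t) \<in> Cone ((\<lambda>t. c t *\<^sub>R f t) ` T)"
        using T t(1) c[OF t(1)] by (intro Cone_scale Cone_base) auto
      then show "x \<in> Cone ((\<lambda>t. c t *\<^sub>R f t) ` T)" using t c[OF t(1)] by simp
    qed
  qed (use T in \<open>auto intro: Cone_scale Cone_add zero_in_Cone\<close>)
qed

lemma flag_card_Un: "flag A F I J \<Longrightarrow> card (I \<union> J) = card I + card J"
  using flag_invariants[of A F I J] by (simp add: card_Un_disjoint)

definition path_step :: "nat \<times> nat \<Rightarrow> nat \<times> nat \<Rightarrow> bool" where
  "path_step p q \<longleftrightarrow> fst q = fst p + 1 \<and> snd q = snd p \<or> fst q = fst p \<and> snd q = snd p + 1"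

text \<open>
The functions \<open>\<alpha>\<close> and \<open>\<beta>\<close> list the elements of \<open>I\<close> and \<open>J\<close> in the order in which they enter the flag, and \<open>c r\<close>
gives the sizes of the two sets at step \<open>r\<close>.
\<close>

definition enumerates ::
  "(nat \<Rightarrow> nat) \<Rightarrow> (nat \<Rightarrow> nat) \<Rightarrow> (nat \<Rightarrow> nat \<times> nat) \<Rightarrow> (nat set \<times> nat set) set \<Rightarrow> nat set \<Rightarrow> nat set \<Rightarrow> bool" where
  "enumerates \<alpha> \<beta> c F I J \<longleftrightarrow> (let s = card I + card J - 1 in
     bij_betw \<alpha> {1..card I} I \<and> bij_betw \<beta> {1..card J} J \<and>
     c 1 = (1, 1) \<and> c s = (card I, card J) \<and>
     (\<forall>r\<in>{2..s}. path_step (c (r - 1)) (c r)) \<and>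
     (\<forall>r\<in>{1..s}. fst (c r) \<le> card I \<and> snd (c r) \<le> card J) \<and>
     F = (\<lambda>r. (\<alpha> ` {1..fst (c r)}, \<beta> ` {1..snd (c r)})) ` {1..s})"

lemma bij_betw_extend:
  assumes "bij_betw f {1..k} I" "z \<notin> I"
  shows "bij_betw (f(Suc k := z)) {1..Suc k} (insert z I)"
proof -
  have "bij_betw (f(Suc k := z)) {1..k} I" using assms(1) by (rule bij_betw_cong[THEN iffD1, rotated]) auto
  then have "bij_betw (f(Suc k := z)) (insert (Suc k) {1..k}) (insert z I)"
    using notIn_Un_bij_betw[of "Suc k" "{1..k}" "f(Suc k := z)" I] assms(2) by simp
  moreover have "insert (Suc k) {1..k} = {1..Suc k}" by auto
  ultimately show ?thesis by simp
qed

lemma enumerates_extend: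
  assumes e: "enumerates \<alpha> \<beta> c F I J" and fin: "finite I" "finite J" "I \<noteq> {}" "J \<noteq> {}"
    and z: "z \<notin> I" "z \<notin> J" and KL: "K = insert z I \<and> L = J \<or> K = I \<and> L = insert z J"
  shows "\<exists>\<alpha> \<beta> c. enumerates \<alpha> \<beta> c (insert (K, L) F) K L"
proof -
  define k l where kl: "k = card I" "l = card J"
  define s where "s = k + l - 1"
  have pos: "k \<ge> 1" "l \<ge> 1" using fin by (auto simp: kl Suc_le_eq card_gt_0_iff)
  have s: "s \<ge> 1" "Suc s = k + l" using pos by (auto simp: s_def)
  have a: "bij_betw \<alpha> {1..k} I" and b: "bij_betw \<beta> {1..l} J" and c1: "c 1 = (1, 1)" and cs: "c s = (k, l)"
    and st: "\<And>r. r \<in> {2..s} \<Longrightarrow> path_step (c (r - 1)) (c r)"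
    and le: "\<And>r. r \<in> {1..s} \<Longrightarrow> fst (c r) \<le> k" "\<And>r. r \<in> {1..s} \<Longrightarrow> snd (c r) \<le> l"
    and F: "F = (\<lambda>r. (\<alpha> ` {1..fst (c r)}, \<beta> ` {1..snd (c r)})) ` {1..s}"
    using e unfolding enumerates_def Let_def kl[symmetric] s_def[symmetric] by auto
  have S: "{1..Suc s} = insert (Suc s) {1..s}" by auto
  have "\<exists>\<alpha>' \<beta>'. bij_betw \<alpha>' {1..card K} K \<and> bij_betw \<beta>' {1..card L} L \<and>
    (\<forall>x\<le>k. \<alpha>' ` {1..x} = \<alpha> ` {1..x}) \<and> (\<forall>x\<le>l. \<beta>' ` {1..x} = \<beta> ` {1..x})"
    using KL
  proof
    assume KL: "K = insert z I \<and> L = J"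
    have "bij_betw (\<alpha>(Suc k := z)) {1..card K} K" using bij_betw_extend[OF a z(1)] KL fin(1) z(1) by (simp add: kl)
    moreover have "(\<alpha>(Suc k := z)) ` {1..x} = \<alpha> ` {1..x}" if "x \<le> k" for x
      using that by (intro image_cong) auto
    ultimately show ?thesis using b KL by (intro exI[of _ "\<alpha>(Suc k := z)"] exI[of _ \<beta>]) (simp add: kl)
  next
    assume KL: "K = I \<and> L = insert z J"
    have "bij_betw (\<beta>(Suc l := z)) {1..card L} L" using bij_betw_extend[OF b z(2)] KL fin(2) z(2) by (simp add: kl)
    moreover have "(\<beta>(Suc l := z)) ` {1..x} = \<beta> ` {1..x}" if "x \<le> l" for x
      using that by (intro image_cong) auto
    ultimately show ?thesis using a KL by (intro exI[of _ \<alpha>] exI[of _ "\<beta>(Suc l := z)"]) (simp add: kl)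
  qed
  then obtain \<alpha>' \<beta>' where ab0: "bij_betw \<alpha>' {1..card K} K" "bij_betw \<beta>' {1..card L} L"
    "\<forall>x\<le>k. \<alpha>' ` {1..x} = \<alpha> ` {1..x}" "\<forall>x\<le>l. \<beta>' ` {1..x} = \<beta> ` {1..x}"
    by (elim exE conjE) (rule that)
  note ab = ab0(1,2) ab0(3,4)[rule_format]
  define c' where "c' = c(Suc s := (card K, card L))"
  have c': "c' r = c r" if "r \<in> {1..s}" for r using that by (simp add: c'_def)
  have cS: "c' (Suc s) = (card K, card L)" by (simp add: c'_def)
  have card: "card K = Suc k \<and> card L = l \<or> card K = k \<and> card L = Suc l"
    using KL fin z by (auto simp: kl)
  then have s': "card K + card L - 1 = Suc s" using s by auto
  have "bij_betw \<alpha>' {1..card K} K \<and> bij_betw \<beta>' {1..card L} L" using ab by simp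
  moreover have "c' 1 = (1, 1)" using c'[of 1] s c1 by simp
  moreover have "\<forall>r\<in>{2..Suc s}. path_step (c' (r - 1)) (c' r)"
  proof
    fix r assume r: "r \<in> {2..Suc s}"
    show "path_step (c' (r - 1)) (c' r)"
    proof (cases "r = Suc s")
      case True
      have "path_step (c' s) (c' (Suc s))" using c'[of s] s(1) cs cS card by (auto simp: path_step_def)
      then show ?thesis using True by simp
    next
      case False
      then have r': "r \<in> {1..s}" "r - 1 \<in> {1..s}" "r \<in> {2..s}" using r by auto
      show ?thesis unfolding c'[OF r'(1)] c'[OF r'(2)] by (rule st[OF r'(3)])
    qed
  qed
  moreover have "\<forall>r\<in>{1..Suc s}. fst (c' r) \<le> card K \<and> snd (c' r) \<le> card L"
  proof
    fix r assume r: "r \<in> {1..Suc s}"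
    show "fst (c' r) \<le> card K \<and> snd (c' r) \<le> card L"
    proof (cases "r = Suc s")
      case False
      then have "r \<in> {1..s}" using r by simp
      then show ?thesis using c'[of r] le[of r] card by auto
    qed (simp add: cS)
  qed
  moreover have "insert (K, L) F = (\<lambda>r. (\<alpha>' ` {1..fst (c' r)}, \<beta>' ` {1..snd (c' r)})) ` {1..Suc s}"
  proof -
    have "(\<lambda>r. (\<alpha>' ` {1..fst (c' r)}, \<beta>' ` {1..snd (c' r)})) ` {1..s} = F"
      unfolding F by (intro image_cong refl) (simp only: c' ab(3)[OF le(1)] ab(4)[OF le(2)])
    moreover have "(\<alpha>' ` {1..fst (c' (Suc s))}, \<beta>' ` {1..snd (c' (Suc s))}) = (K, L)"
      using ab(1,2) by (simp add: cS bij_betw_def)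
    ultimately show ?thesis unfolding S by simp
  qed
  ultimately have "enumerates \<alpha>' \<beta>' c' (insert (K, L) F) K L"
    unfolding enumerates_def s' Let_def using cS by blast
  then show ?thesis by blast
qed

lemma flag_enumeration: "flag A F I J \<Longrightarrow> \<exists>\<alpha> \<beta> c. enumerates \<alpha> \<beta> c F I J"
proof (induction rule: flag.induct)
  case (start i j)
  have "enumerates (\<lambda>_. i) (\<lambda>_. j) (\<lambda>_. (1, 1)) {({i}, {j})} {i} {j}"
    by (auto simp: enumerates_def Let_def bij_betw_def)
  then show ?case by blast
next
  case (step F I J K L)
  obtain \<alpha> \<beta> c where e: "enumerates \<alpha> \<beta> c F I J" using step.IH by blast
  have i: "finite I" "finite J" "I \<noteq> {}" "J \<noteq> {}" using flag_invariants[OF step.hyps(1)] by simp_all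
  obtain z where z: "z \<notin> I" "z \<notin> J" "K = insert z I \<and> L = J \<or> K = I \<and> L = insert z J"
    using step.hyps(2) unfolding pair_extends_def by blast
  show ?case by (rule enumerates_extend[OF e i z])
qed

lemma minimal_path_bounds:
  assumes C: "C \<in> minimal_paths n i" and n: "n \<ge> 1" and r: "r \<in> {1..n}"
  shows "1 \<le> fst (C r)" "fst (C r) \<le> i" "i + 1 \<le> snd (C r)" "snd (C r) \<le> n + 1"
proof -
  have C1: "C 1 = (i, i + 1)" "C n = (1, n + 1)" using C by (auto simp: minimal_paths_def)
  have st: "fst (C r) + 1 = fst (C (r - 1)) \<and> snd (C r) = snd (C (r - 1)) \<or>
      fst (C r) = fst (C (r - 1)) \<and> snd (C r) = snd (C (r - 1)) + 1" if "r \<in> {2..n}" for r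
    using C that unfolding minimal_paths_def by blast
  have up: "fst (C r) \<le> i \<and> i + 1 \<le> snd (C r)" if "1 \<le> r" "r \<le> n" for r
    using that
  proof (induction r rule: dec_induct)
    case base
    then show ?case using C1(1) by simp
  next
    case (step r)
    then show ?case using st[of "Suc r"] by auto
  qed
  have down: "1 \<le> fst (C r) \<and> snd (C r) \<le> n + 1" if "r \<le> n" "1 \<le> r" for r
    using that
  proof (induction r rule: inc_induct)
    case base
    then show ?case using C1(2) by simp
  next
    case (step r)
    then show ?case using st[of "Suc r"] by auto
  qed
  show "1 \<le> fst (C r)" "fst (C r) \<le> i" "i + 1 \<le> snd (C r)" "snd (C r) \<le> n + 1"
    using up[of r] down[of r] r by auto
qed

context root_system_A begin

text \<open>
As \<open>C\<close> runs through its steps, the intervals grow by one index, downwards from \<open>i\<close> or upwards from \<open>i + 1\<close>.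
\<close>

definition path_flag :: "nat \<Rightarrow> (nat \<Rightarrow> nat \<times> nat) \<Rightarrow> (nat set \<times> nat set) set" where
  "path_flag i C = (\<lambda>r. ({fst (C r)..i}, {i+1..snd (C r)})) ` {1..n}"

lemma path_flag_complete:
  assumes C: "C \<in> minimal_paths n i" and i: "i \<in> {1..n}"
  shows "complete_flag A (path_flag i C)"
proof -
  have C1: "C 1 = (i, i + 1)" "C n = (1, n + 1)" using C by (auto simp: minimal_paths_def)
  have st: "fst (C r) + 1 = fst (C (r - 1)) \<and> snd (C r) = snd (C (r - 1)) \<or>
      fst (C r) = fst (C (r - 1)) \<and> snd (C r) = snd (C (r - 1)) + 1" if "r \<in> {2..n}" for r
    using C that unfolding minimal_paths_def by blast
  have "flag A ((\<lambda>r. ({fst (C r)..i}, {i+1..snd (C r)})) ` {1..r}) {fst (C r)..i} {i+1..snd (C r)}"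
    if "1 \<le> r" "r \<le> n" for r
    using that
  proof (induction r rule: dec_induct)
    case base
    show ?case using C1 i flag.start[of i A "i + 1"] by (simp add: A_def)
  next
    case (step r)
    have b: "1 \<le> fst (C r)" "fst (C r) \<le> i" "i + 1 \<le> snd (C r)" "snd (C r) \<le> n + 1"
      using minimal_path_bounds[OF C n_pos, of r] step.hyps step.prems by auto
    have b': "1 \<le> fst (C (Suc r))" "snd (C (Suc r)) \<le> n + 1"
      using minimal_path_bounds[OF C n_pos, of "Suc r"] step.prems by auto
    have "fst (C (Suc r)) + 1 = fst (C r) \<and> snd (C (Suc r)) = snd (C r) \<or>
      fst (C (Suc r)) = fst (C r) \<and> snd (C (Suc r)) = snd (C r) + 1"
      using st[of "Suc r"] step.hyps step.prems by simp
    then have "pair_extends A {fst (C r)..i} {i+1..snd (C r)} {fst (C (Suc r))..i} {i+1..snd (C (Suc r))}"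
    proof
      assume s: "fst (C (Suc r)) + 1 = fst (C r) \<and> snd (C (Suc r)) = snd (C r)"
      then have "{fst (C (Suc r))..i} = insert (fst (C (Suc r))) {fst (C r)..i}" using b by auto
      then show ?thesis unfolding pair_extends_def
        using s b b' i by (intro bexI[of _ "fst (C (Suc r))"]) (auto simp: A_def)
    next
      assume s: "fst (C (Suc r)) = fst (C r) \<and> snd (C (Suc r)) = snd (C r) + 1"
      then have "{i+1..snd (C (Suc r))} = insert (snd (C (Suc r))) {i+1..snd (C r)}" using b by auto
      then show ?thesis unfolding pair_extends_def
        using s b b' i by (intro bexI[of _ "snd (C (Suc r))"]) (auto simp: A_def)
    qed
    moreover have "flag A ((\<lambda>r. ({fst (C r)..i}, {i+1..snd (C r)})) ` {1..r}) {fst (C r)..i} {i+1..snd (C r)}"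
      using step by simp
    moreover have "{1..Suc r} = insert (Suc r) {1..r}" by auto
    ultimately show ?case using flag.step by simp
  qed
  from this[of n] have "flag A (path_flag i C) {1..i} {i+1..n+1}" using n_pos C1 by (simp add: path_flag_def)
  moreover have "{1..i} \<union> {i+1..n+1} = A" using i by (auto simp: A_def)
  ultimately show ?thesis unfolding complete_flag_def by blast
qed

lemma path_cone:
  assumes C: "C \<in> minimal_paths n i"
  shows "Cone (path_generators e n i C) = Cone (bary ` path_flag i C)"
proof -
  let ?I = "\<lambda>r. {fst (C r)..i}" and ?J = "\<lambda>r. {i+1..snd (C r)}"
  let ?c = "\<lambda>r. inverse (real (gcd (card (?I r)) (card (?J r))))"
  have "path_generators e n i C = (\<lambda>r. ?c r *\<^sub>R bary (?I r, ?J r)) ` {1..n}"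
    unfolding path_generators_def s_vec_def bary_def by auto
  moreover have "0 < ?c r" if "r \<in> {1..n}" for r
  proof -
    have "card (?I r) \<noteq> 0" using minimal_path_bounds(2)[OF C n_pos that] by simp
    then have "gcd (card (?I r)) (card (?J r)) > 0" by (simp only: gcd_pos_nat) simp
    then show ?thesis by simp
  qed
  then have "Cone ((\<lambda>r. ?c r *\<^sub>R bary (?I r, ?J r)) ` {1..n}) = Cone ((\<lambda>r. bary (?I r, ?J r)) ` {1..n})"
    by (intro Cone_rescale) auto
  moreover have "bary ` path_flag i C = (\<lambda>r. bary (?I r, ?J r)) ` {1..n}"
    unfolding path_flag_def image_image ..
  ultimately show ?thesis by simp
qed

lemma maximal_cones_flags: "maximal_cones cones = {Cone (bary ` F) | F. complete_flag A F}"
proof -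
  have "\<exists>F. Cone (bary ` flag_of m) = Cone (bary ` F) \<and> complete_flag A F" if "m \<in> support_points" for m
    using flag_of[OF that] by blast
  moreover have "\<exists>m. Cone (bary ` F) = Cone (bary ` flag_of m) \<and> m \<in> support_points" if F: "complete_flag A F" for F
  proof -
    obtain m where m: "supports m F" using supports_exists[OF F] by blast
    then show ?thesis using flag_of_eq[OF F m] F unfolding support_points_def by (intro exI[of _ m]) auto
  qed
  ultimately show ?thesis unfolding maximal_cones_eq by (intro equalityI subsetI; clarsimp)
qed

lemma cones_flags: "\<sigma> \<in> cones \<longleftrightarrow> (\<exists>F S. complete_flag A F \<and> S \<subseteq> bary ` F \<and> \<sigma> = Cone S)"
proof
  assume "\<sigma> \<in> cones"
  then obtain m S where "m \<in> support_points" "S \<subseteq> bary ` flag_of m" "\<sigma> = Cone S" unfolding cones_iff by blast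
  then show "\<exists>F S. complete_flag A F \<and> S \<subseteq> bary ` F \<and> \<sigma> = Cone S" using flag_of by blast
next
  assume "\<exists>F S. complete_flag A F \<and> S \<subseteq> bary ` F \<and> \<sigma> = Cone S"
  then obtain F S where F: "complete_flag A F" "S \<subseteq> bary ` F" "\<sigma> = Cone S" by blast
  obtain m where m: "supports m F" using supports_exists[OF F(1)] by blast
  then have "m \<in> support_points" "flag_of m = F" using flag_of_eq F(1) unfolding support_points_def by auto
  then show "\<sigma> \<in> cones" unfolding cones_iff using F(2,3) by blast
qed

abbreviation "G \<equiv> root_automorphisms \<Phi>"

lemma autD:
  assumes "g \<in> G"
  shows "bij_betw g (span \<Phi>) (span \<Phi>)" "x \<in> span \<Phi> \<Longrightarrow> y \<in> span \<Phi> \<Longrightarrow> g (x + y) = g x + g y"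
    "x \<in> span \<Phi> \<Longrightarrow> g (c *\<^sub>R x) = c *\<^sub>R g x" "g ` \<Phi> = \<Phi>"
  using assms unfolding root_automorphisms_def by blast+

lemma aut_span: "g \<in> G \<Longrightarrow> x \<in> span \<Phi> \<Longrightarrow> g x \<in> span \<Phi>"
  using autD(1) bij_betwE by blast

lemma aut_zero: "g \<in> G \<Longrightarrow> g 0 = 0"
  using autD(3)[of g 0 0] span_zero[of \<Phi>] by simp

lemma aut_sum:
  assumes g: "g \<in> G" and T: "finite T" "T \<subseteq> span \<Phi>"
  shows "g (\<Sum>v\<in>T. v) = (\<Sum>v\<in>T. g v)"
  using T
proof (induction T rule: finite_induct)
  case (insert v T)
  then show ?case using autD(2)[OF g, of v "\<Sum>v\<in>T. v"] span_sum[of T "\<lambda>v. v" \<Phi>] by (simp add: subset_iff)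
qed (simp add: aut_zero[OF g])

lemma aut_Cone:
  fixes S :: "'a set"
  assumes g: "g \<in> G" and S: "finite S" "S \<subseteq> span \<Phi>"
  shows "g ` Cone S = Cone (g ` S)"
proof
  have "Cone S \<subseteq> {x \<in> span \<Phi>. g x \<in> Cone (g ` S)}"
    using S autD(2,3)[OF g] aut_zero[OF g]
    by (intro Cone_minimal)
      (auto intro: Cone_base Cone_add Cone_scale zero_in_Cone span_add span_scale span_zero)
  then show "g ` Cone S \<subseteq> Cone (g ` S)" by blast
  have sp: "Cone S \<subseteq> span \<Phi>" using Cone_span[of S] S(2) by (metis span_mono span_span subset_trans)
  show "Cone (g ` S) \<subseteq> g ` Cone S"
  proof (rule Cone_minimal)
    show "g ` S \<subseteq> g ` Cone S" using Cone_base by blast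
    show "0 \<in> g ` Cone S" using zero_in_Cone aut_zero[OF g] by (metis imageI)
    show "x + y \<in> g ` Cone S" if xy: "x \<in> g ` Cone S" "y \<in> g ` Cone S" for x y
    proof -
      obtain a b where ab: "a \<in> Cone S" "b \<in> Cone S" "x = g a" "y = g b" using xy by blast
      have "a \<in> span \<Phi>" "b \<in> span \<Phi>" using ab sp by blast+
      then have "x + y = g (a + b)" using autD(2)[OF g] ab by simp
      then show ?thesis using Cone_add[OF S(1) ab(1,2)] by blast
    qed
    show "r *\<^sub>R x \<in> g ` Cone S" if rx: "0 \<le> r" "x \<in> g ` Cone S" for r x
    proof -
      obtain a where a: "a \<in> Cone S" "x = g a" using rx(2) by blast
      then have "a \<in> span \<Phi>" using sp by blast
      then have "r *\<^sub>R x = g (r *\<^sub>R a)" using autD(3)[OF g] a by simp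
      then show ?thesis using Cone_scale[OF S(1) a(1) rx(1)] by blast
    qed
  qed
qed

lemma aut_inverse:
  assumes g: "g \<in> G"
  obtains g' where "g' \<in> G" "\<And>x. x \<in> span \<Phi> \<Longrightarrow> g' (g x) = x" "\<And>x. x \<in> span \<Phi> \<Longrightarrow> g (g' x) = x"
proof -
  let ?g' = "inv_into (span \<Phi>) g"
  note b = autD(1)[OF g]
  have l: "?g' (g x) = x" if "x \<in> span \<Phi>" for x using bij_betw_inv_into_left[OF b that] .
  have r: "g (?g' x) = x" if "x \<in> span \<Phi>" for x using bij_betw_inv_into_right[OF b that] .
  have b': "bij_betw ?g' (span \<Phi>) (span \<Phi>)" by (rule bij_betw_inv_into[OF b])
  have s: "?g' x \<in> span \<Phi>" if "x \<in> span \<Phi>" for x using bij_betwE[OF b'] that by blast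
  have "?g' (x + y) = ?g' x + ?g' y" if "x \<in> span \<Phi>" "y \<in> span \<Phi>" for x y
  proof -
    have "g (?g' x + ?g' y) = x + y" using autD(2)[OF g s[OF that(1)] s[OF that(2)]] r that by simp
    then show ?thesis using l[OF span_add[OF s[OF that(1)] s[OF that(2)]]] by simp
  qed
  moreover have "?g' (c *\<^sub>R x) = c *\<^sub>R ?g' x" if "x \<in> span \<Phi>" for c x
  proof -
    have "g (c *\<^sub>R ?g' x) = c *\<^sub>R x" using autD(3)[OF g s[OF that]] r that by simp
    then show ?thesis using l[OF span_scale[OF s[OF that]], of c] by simp
  qed
  moreover have "?g' ` \<Phi> = \<Phi>"
  proof -
    have "?g' ` (g ` \<Phi>) = \<Phi>" by (simp add: image_image l span_base)
    then show ?thesis unfolding autD(4)[OF g] .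
  qed
  ultimately have "?g' \<in> G" unfolding root_automorphisms_def using b' by blast
  then show ?thesis using l r by (rule that)
qed

section \<open>Automorphisms of the root system\<close>

text \<open>
The roots in the face \<open>(I, J)\<close> of the root polytope.
\<close>

definition root_face :: "nat set \<Rightarrow> nat set \<Rightarrow> 'a set" where
  "root_face I J = (\<lambda>(i, j). e i - e j) ` (I \<times> J)"

text \<open>
Faces as the sets of roots where a linear functional attains the value \<open>1\<close>, its maximum on the roots. This
description is visibly preserved by automorphisms.
\<close>

definition is_root_face :: "'a set \<Rightarrow> bool" where
  "is_root_face R \<longleftrightarrow> R \<noteq> {} \<and> (\<exists>f :: 'a \<Rightarrow> real.
     (\<forall>x\<in>span \<Phi>. \<forall>y\<in>span \<Phi>. f (x + y) = f x + f y) \<and>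
     (\<forall>v\<in>\<Phi>. f v \<le> 1) \<and> R = {v\<in>\<Phi>. f v = 1})"

definition signed_pair :: "nat set \<Rightarrow> nat set \<Rightarrow> bool" where
  "signed_pair I J \<longleftrightarrow> I \<subseteq> A \<and> J \<subseteq> A \<and> I \<inter> J = {} \<and> I \<noteq> {} \<and> J \<noteq> {}"

lemma e_diff_eq:
  assumes "i \<in> A" "j \<in> A" "i \<noteq> j" "k \<in> A" "l \<in> A" "e i - e j = e k - e l"
  shows "i = k" "j = l"
proof -
  have "(e i - e j) \<bullet> e i = (e k - e l) \<bullet> e i" "(e i - e j) \<bullet> e j = (e k - e l) \<bullet> e j" using assms(6) by simp_all
  then show "i = k" "j = l" using assms(1-5) by (auto simp: inner_diff_left e_inner split: if_splits)
qed

lemma root_face_roots: "signed_pair I J \<Longrightarrow> root_face I J \<subseteq> \<Phi>"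
  unfolding signed_pair_def root_face_def by (auto intro!: rootI)

lemma root_face_mono:
  assumes "signed_pair I J" "signed_pair K L" "root_face I J \<subseteq> root_face K L"
  shows "I \<subseteq> K" "J \<subseteq> L"
proof -
  have "i \<in> K \<and> j \<in> L" if ij: "i \<in> I" "j \<in> J" for i j
  proof -
    have "e i - e j \<in> root_face K L" using assms(3) ij by (auto simp: root_face_def)
    then obtain k l where kl: "k \<in> K" "l \<in> L" "e i - e j = e k - e l" by (auto simp: root_face_def)
    have A: "i \<in> A" "j \<in> A" "i \<noteq> j" "k \<in> A" "l \<in> A" using assms(1,2) ij kl unfolding signed_pair_def by auto
    show ?thesis using e_diff_eq[OF A kl(3)] kl by simp
  qed
  then show "I \<subseteq> K" "J \<subseteq> L" using assms(1) unfolding signed_pair_def by auto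
qed

lemma root_face_inj:
  assumes "signed_pair I J" "signed_pair K L" "root_face I J = root_face K L"
  shows "I = K" "J = L"
  using root_face_mono[OF assms(1,2)] root_face_mono[OF assms(2,1)] assms(3) by auto

text \<open>
The functional has the coordinates \<open>1\<close> on \<open>I\<close>, \<open>0\<close> on \<open>J\<close> and \<open>1/2\<close> elsewhere.
\<close>

lemma signed_pair_face:
  assumes "signed_pair I J"
  shows "is_root_face (root_face I J)"
proof -
  define w where "w j = (if j \<in> I then 1 else if j \<in> J then 0 else 1 / 2 :: real)" for j
  define f where "f x = (\<Sum>j\<in>A. w j * (x \<bullet> e j))" for x
  have IJ: "I \<subseteq> A" "J \<subseteq> A" "I \<inter> J = {}" "I \<noteq> {}" "J \<noteq> {}" using assms by (auto simp: signed_pair_def)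
  have fe: "f (e i - e j) = w i - w j" if "i \<in> A" "j \<in> A" for i j
  proof -
    have "f (e i - e j) = (\<Sum>k\<in>A. (if i = k then w k else 0) - (if j = k then w k else 0))"
      unfolding f_def using that by (intro sum.cong) (auto simp: inner_diff_left e_inner)
    then show ?thesis using that by (simp add: sum_subtractf)
  qed
  have "f (x + y) = f x + f y" for x y
    by (simp add: f_def inner_add_left algebra_simps sum.distrib)
  moreover have "f v \<le> 1" if v: "v \<in> \<Phi>" for v
    by (rule rootE[OF v]) (simp add: fe w_def)
  moreover have "root_face I J = {v\<in>\<Phi>. f v = 1}"
  proof
    show "root_face I J \<subseteq> {v\<in>\<Phi>. f v = 1}"
    proof
      fix v assume "v \<in> root_face I J"
      then obtain i j where ij: "i \<in> I" "j \<in> J" "v = e i - e j" by (auto simp: root_face_def)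
      then have "i \<in> A" "j \<in> A" "i \<noteq> j" "j \<notin> I" using IJ by auto
      then show "v \<in> {v\<in>\<Phi>. f v = 1}" using ij rootI fe by (simp add: w_def)
    qed
    show "{v\<in>\<Phi>. f v = 1} \<subseteq> root_face I J"
    proof
      fix v assume "v \<in> {v\<in>\<Phi>. f v = 1}"
      then have v: "v \<in> \<Phi>" "f v = 1" by auto
      obtain i j where ij: "i \<in> A" "j \<in> A" "v = e i - e j" by (rule rootE[OF v(1)])
      have "w i - w j = 1" using v(2) fe ij by simp
      then have "i \<in> I" "j \<in> J" by (auto simp: w_def split: if_splits)
      then show "v \<in> root_face I J" using ij by (auto simp: root_face_def)
    qed
  qed
  moreover have "root_face I J \<noteq> {}" using IJ by (auto simp: root_face_def)
  ultimately show ?thesis unfolding is_root_face_def by blast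
qed

text \<open>
The coordinates \<open>w\<close> of the functional spread over an interval of length \<open>1\<close>; the roots with value \<open>1\<close> lead
from its lower to its upper end.
\<close>

lemma face_signed_pair:
  assumes "is_root_face R"
  obtains I J where "signed_pair I J" "R = root_face I J"
proof -
  obtain f :: "'a \<Rightarrow> real" where f: "\<And>x y. x \<in> span \<Phi> \<Longrightarrow> y \<in> span \<Phi> \<Longrightarrow> f (x + y) = f x + f y"
    "\<And>v. v \<in> \<Phi> \<Longrightarrow> f v \<le> 1" "R = {v\<in>\<Phi>. f v = 1}" and ne: "R \<noteq> {}"
    using assms unfolding is_root_face_def by blast
  define w where "w i = f (e i - e 1)" for i
  have sp: "e i - e j \<in> span \<Phi>" if "i \<in> A" "j \<in> A" for i j
    using rootI[OF that] by (cases "i = j") (auto intro: span_base span_zero)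
  have fe: "f (e i - e j) = w i - w j" if "i \<in> A" "j \<in> A" for i j
  proof -
    have "f ((e i - e j) + (e j - e 1)) = f (e i - e j) + f (e j - e 1)"
      by (intro f(1) sp that one_in_A)
    then show ?thesis by (simp add: w_def)
  qed
  obtain v where "v \<in> \<Phi>" "f v = 1" using ne f(3) by auto
  then obtain a b where ab: "a \<in> A" "b \<in> A" "w a - w b = 1" using fe by (auto elim!: rootE)
  have le: "w i - w j \<le> 1" if "i \<in> A" "j \<in> A" for i j
    using f(2)[OF rootI[OF that]] fe[OF that] by (cases "i = j") auto
  define I where "I = {i\<in>A. w i = w a}"
  define J where "J = {j\<in>A. w j = w b}"
  have p: "signed_pair I J" using ab unfolding signed_pair_def I_def J_def by auto
  have "R = root_face I J"
  proof
    show "R \<subseteq> root_face I J"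
    proof
      fix v assume "v \<in> R"
      then have v: "v \<in> \<Phi>" "f v = 1" using f(3) by auto
      obtain i j where ij: "i \<in> A" "j \<in> A" "v = e i - e j" by (rule rootE[OF v(1)])
      have "w i - w j = 1" using v(2) fe ij by simp
      then have "w i = w a" "w j = w b" using le[OF ij(1) ab(2)] le[OF ab(1) ij(2)] ab(3) by linarith+
      then show "v \<in> root_face I J" using ij by (auto simp: root_face_def I_def J_def)
    qed
    show "root_face I J \<subseteq> R"
    proof
      fix v assume v: "v \<in> root_face I J"
      then obtain i j where ij: "i \<in> A" "j \<in> A" "w i = w a" "w j = w b" "v = e i - e j"
        by (auto simp: root_face_def I_def J_def)
      then show "v \<in> R" using root_face_roots[OF p] v f(3) fe ab(3) by auto
    qed
  qed
  then show ?thesis using that p by blast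
qed

lemma aut_face:
  assumes g: "g \<in> G" and R: "is_root_face R"
  shows "is_root_face (g ` R)"
proof -
  obtain g' where g': "g' \<in> G" "\<And>x. x \<in> span \<Phi> \<Longrightarrow> g' (g x) = x" "\<And>x. x \<in> span \<Phi> \<Longrightarrow> g (g' x) = x"
    by (rule aut_inverse[OF g]) (rule that)
  obtain f :: "'a \<Rightarrow> real" where f: "\<And>x y. x \<in> span \<Phi> \<Longrightarrow> y \<in> span \<Phi> \<Longrightarrow> f (x + y) = f x + f y"
    "\<And>v. v \<in> \<Phi> \<Longrightarrow> f v \<le> 1" "R = {v\<in>\<Phi>. f v = 1}" and ne: "R \<noteq> {}"
    using R unfolding is_root_face_def by blast
  have "f (g' (x + y)) = f (g' x) + f (g' y)" if "x \<in> span \<Phi>" "y \<in> span \<Phi>" for x y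
    using that f(1) autD(2)[OF g'(1)] aut_span[OF g'(1)] by simp
  moreover have "f (g' v) \<le> 1" if "v \<in> \<Phi>" for v using autD(4)[OF g'(1)] f(2) that by blast
  moreover have "g ` R = {v\<in>\<Phi>. f (g' v) = 1}"
  proof
    show "g ` R \<subseteq> {v\<in>\<Phi>. f (g' v) = 1}" using f(3) autD(4)[OF g] g'(2) span_base by fastforce
    show "{v\<in>\<Phi>. f (g' v) = 1} \<subseteq> g ` R"
    proof
      fix v assume v: "v \<in> {v\<in>\<Phi>. f (g' v) = 1}"
      then have "g' v \<in> R" using f(3) autD(4)[OF g'(1)] by blast
      moreover have "v = g (g' v)" using v g'(3) span_base by force
      ultimately show "v \<in> g ` R" by blast
    qed
  qed
  moreover have "g ` R \<noteq> {}" using ne by simp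
  ultimately show ?thesis unfolding is_root_face_def by (intro conjI exI[of _ "\<lambda>x. f (g' x)"]) auto
qed

lemma bary_sum_face:
  assumes "signed_pair I J"
  shows "bary (I, J) = (\<Sum>v\<in>root_face I J. v)"
proof -
  have "inj_on (\<lambda>(i, j). e i - e j) (I \<times> J)"
  proof (rule inj_onI, clarify)
    fix i j k l assume a: "i \<in> I" "j \<in> J" "k \<in> I" "l \<in> J" "e i - e j = e k - e l"
    have A: "i \<in> A" "j \<in> A" "i \<noteq> j" "k \<in> A" "l \<in> A" using assms a unfolding signed_pair_def by auto
    show "i = k \<and> j = l" using e_diff_eq[OF A a(5)] by simp
  qed
  then have "(\<Sum>v\<in>root_face I J. v) = (\<Sum>(i, j)\<in>I \<times> J. e i - e j)"
    unfolding root_face_def by (subst sum.reindex) (auto simp: case_prod_beta)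
  then show ?thesis by (simp add: bary_roots sum.cartesian_product)
qed

lemma aut_bary:
  assumes g: "g \<in> G" and p: "signed_pair I J" "signed_pair K L" and e: "g ` root_face I J = root_face K L"
  shows "g (bary (I, J)) = bary (K, L)"
proof -
  have s: "root_face I J \<subseteq> span \<Phi>" using root_face_roots[OF p(1)] span_superset by blast
  have fin: "finite (root_face I J)" by (rule finite_subset[OF root_face_roots[OF p(1)] finite_roots])
  have "inj_on g (root_face I J)" using autD(1)[OF g] s by (meson bij_betw_def inj_on_subset)
  then have "(\<Sum>v\<in>g ` root_face I J. v) = (\<Sum>v\<in>root_face I J. g v)" by (simp add: sum.reindex)
  then show ?thesis unfolding bary_sum_face[OF p(1)] bary_sum_face[OF p(2)] e[symmetric] aut_sum[OF g fin s] by simp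
qed

lemma flag_signed_pair: "flag A F I J \<Longrightarrow> (K, L) \<in> F \<Longrightarrow> signed_pair K L"
  using flag_pair[of A F I J K L] flag_top[of A F I J] unfolding signed_pair_def by blast

lemma pair_extends_between:
  assumes "pair_extends A I J K L" "I \<subseteq> P" "J \<subseteq> Q" "P \<subseteq> K" "Q \<subseteq> L" "(P, Q) \<noteq> (I, J)"
  shows "P = K" "Q = L"
  using assms unfolding pair_extends_def by auto

lemma pair_extends_exists:
  assumes "signed_pair K L" "I \<subseteq> K" "J \<subseteq> L" "(I, J) \<noteq> (K, L)"
  obtains P Q where "pair_extends A I J P Q" "P \<subseteq> K" "Q \<subseteq> L"
proof -
  obtain z where z: "z \<in> K \<and> z \<notin> I \<or> z \<in> L \<and> z \<notin> J" using assms(2-4) by blast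
  have KL: "K \<subseteq> A" "L \<subseteq> A" "K \<inter> L = {}" using assms(1) by (auto simp: signed_pair_def)
  from z show ?thesis
  proof
    assume z: "z \<in> K \<and> z \<notin> I"
    then have "pair_extends A I J (insert z I) J"
      unfolding pair_extends_def using KL assms(3) by (intro bexI[of _ z]) auto
    then show ?thesis using that z assms(2,3) by blast
  next
    assume z: "z \<in> L \<and> z \<notin> J"
    then have "pair_extends A I J I (insert z J)"
      unfolding pair_extends_def using KL assms(2) by (intro bexI[of _ z]) auto
    then show ?thesis using that z assms(2,3) by blast
  qed
qed

lemma pair_extends_card: "pair_extends A I J K L \<Longrightarrow> finite I \<Longrightarrow> finite J \<Longrightarrow> card K + card L = Suc (card I + card J)"
  unfolding pair_extends_def by auto

lemma pair_extends_face:
  assumes "pair_extends A I J K L" shows "root_face I J \<subseteq> root_face K L"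
proof -
  have "I \<subseteq> K" "J \<subseteq> L" using assms unfolding pair_extends_def by auto
  then show ?thesis unfolding root_face_def by (intro image_mono Sigma_mono) auto
qed

lemma pair_extends_signed: "pair_extends A I J K L \<Longrightarrow> signed_pair I J \<Longrightarrow> signed_pair K L"
  unfolding pair_extends_def signed_pair_def by auto

text \<open>
An automorphism preserves the inclusions between faces, and with its inverse also the property that
there is no face strictly in between. So the image of a flag again grows by one index at each step.
\<close>

lemma aut_flag:
  assumes g: "g \<in> G" and F: "flag A F I J"
  shows "\<exists>F' I' J'. flag A F' I' J' \<and> g ` root_face I J = root_face I' J' \<and>
    (\<lambda>(K, L). g ` root_face K L) ` F = (\<lambda>(K, L). root_face K L) ` F' \<and> card I' + card J' = card I + card J"
proof -
  obtain g' where g': "g' \<in> G" "\<And>x. x \<in> span \<Phi> \<Longrightarrow> g' (g x) = x" "\<And>x. x \<in> span \<Phi> \<Longrightarrow> g (g' x) = x"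
    by (rule aut_inverse[OF g]) (rule that)
  have im: "g' ` (g ` R) = R" "g ` (g' ` R) = R" if "R \<subseteq> \<Phi>" for R
  proof -
    have "\<And>x. x \<in> R \<Longrightarrow> g' (g x) = x" "\<And>x. x \<in> R \<Longrightarrow> g (g' x) = x" using g'(2,3) that span_base by blast+
    then show "g' ` (g ` R) = R" "g ` (g' ` R) = R" by (auto simp: image_image)
  qed
  show ?thesis
    using F
  proof (induction rule: flag.induct)
    case (start i j)
    have p: "signed_pair {i} {j}" using start by (auto simp: signed_pair_def)
    obtain I' J' where IJ: "signed_pair I' J'" "g ` root_face {i} {j} = root_face I' J'"
      by (rule face_signed_pair[OF aut_face[OF g signed_pair_face[OF p]]])
    have "root_face {i} {j} = {e i - e j}" by (simp add: root_face_def)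
    then have s: "root_face I' J' = {g (e i - e j)}" using IJ(2) by simp
    obtain a b where ab: "a \<in> I'" "b \<in> J'" using IJ(1) unfolding signed_pair_def by blast
    have pab: "signed_pair {a} {b}" using IJ(1) ab unfolding signed_pair_def by blast
    have "root_face {a} {b} \<subseteq> root_face I' J'" using ab by (auto simp: root_face_def)
    then have "root_face {a} {b} = root_face I' J'" unfolding s by (auto simp: root_face_def)
    then have e: "I' = {a}" "J' = {b}" using root_face_inj[OF pab IJ(1)] by auto
    have "flag A {({a}, {b})} {a} {b}" using pab by (intro flag.start) (auto simp: signed_pair_def)
    then show ?case using IJ(2) unfolding e by (intro exI[of _ "{({a}, {b})}"] exI[of _ "{a}"] exI[of _ "{b}"]) simp
  next
    case (step F I J K L)
    obtain F' I' J' where IH: "flag A F' I' J'" "g ` root_face I J = root_face I' J'"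
      "(\<lambda>(K, L). g ` root_face K L) ` F = (\<lambda>(K, L). root_face K L) ` F'" "card I' + card J' = card I + card J"
      using step.IH by (elim exE conjE) (rule that)
    have p: "signed_pair I J" by (rule flag_signed_pair[OF step.hyps(1) flag_top(1)[OF step.hyps(1)]])
    have p': "signed_pair I' J'" by (rule flag_signed_pair[OF IH(1) flag_top(1)[OF IH(1)]])
    have pKL: "signed_pair K L" by (rule pair_extends_signed[OF step.hyps(2) p])
    have fin: "finite I" "finite J" "finite I'" "finite J'"
      using flag_invariants[OF step.hyps(1)] flag_invariants[OF IH(1)] by simp_all
    obtain K' L' where KL: "signed_pair K' L'" "g ` root_face K L = root_face K' L'"
      by (rule face_signed_pair[OF aut_face[OF g signed_pair_face[OF pKL]]])
    have "root_face I J \<subseteq> root_face K L" by (rule pair_extends_face[OF step.hyps(2)])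
    then have "root_face I' J' \<subseteq> root_face K' L'" unfolding IH(2)[symmetric] KL(2)[symmetric] by (rule image_mono)
    then have sub: "I' \<subseteq> K'" "J' \<subseteq> L'" using root_face_mono[OF p' KL(1)] by auto
    have "(I', J') \<noteq> (K', L')"
    proof
      assume "(I', J') = (K', L')"
      then have "g ` root_face I J = g ` root_face K L" using IH(2) KL(2) by simp
      then have "root_face I J = root_face K L" using im(1)[OF root_face_roots[OF p]] im(1)[OF root_face_roots[OF pKL]] by metis
      then have "I = K" "J = L" using root_face_inj[OF p pKL] by auto
      then show False using step.hyps(2) unfolding pair_extends_def by auto
    qed
    then obtain P Q where PQ: "pair_extends A I' J' P Q" "P \<subseteq> K'" "Q \<subseteq> L'"
      by (rule pair_extends_exists[OF KL(1) sub]) (rule that)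
    have pPQ: "signed_pair P Q" by (rule pair_extends_signed[OF PQ(1) p'])
    \<comment> \<open>Pulled back by \<open>g\<close>, the face of \<open>(P, Q)\<close> lies strictly above that of \<open>(I, J)\<close> and inside that of
      \<open>(K, L)\<close>, hence equals the latter.\<close>
    obtain P' Q' where PQ': "signed_pair P' Q'" "g' ` root_face P Q = root_face P' Q'"
      by (rule face_signed_pair[OF aut_face[OF g'(1) signed_pair_face[OF pPQ]]])
    have "root_face I J \<subseteq> root_face P' Q'"
      using image_mono[OF pair_extends_face[OF PQ(1)], of g'] im(1)[OF root_face_roots[OF p]]
      unfolding PQ'(2) IH(2)[symmetric] by simp
    then have s1: "I \<subseteq> P'" "J \<subseteq> Q'" using root_face_mono[OF p PQ'(1)] by auto
    have "root_face P Q \<subseteq> root_face K' L'" unfolding root_face_def using PQ(2,3) by (intro image_mono Sigma_mono) auto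
    from image_mono[OF this, of g'] have "root_face P' Q' \<subseteq> root_face K L"
      unfolding PQ'(2) KL(2)[symmetric] im(1)[OF root_face_roots[OF pKL]] .
    then have s2: "P' \<subseteq> K" "Q' \<subseteq> L" using root_face_mono[OF PQ'(1) pKL] by auto
    have gPQ: "g ` root_face P' Q' = root_face P Q"
      unfolding PQ'(2)[symmetric] by (rule im(2)[OF root_face_roots[OF pPQ]])
    have "(P', Q') \<noteq> (I, J)"
    proof
      assume "(P', Q') = (I, J)"
      then have "root_face P Q = root_face I' J'" using gPQ IH(2) by simp
      then have "P = I'" "Q = J'" using root_face_inj[OF pPQ p'] by auto
      then show False using PQ(1) unfolding pair_extends_def by auto
    qed
    then have "P' = K" "Q' = L" using pair_extends_between[OF step.hyps(2) s1 s2] by auto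
    then have gKL: "g ` root_face K L = root_face P Q" using gPQ by simp
    have "flag A (insert (P, Q) F') P Q" by (rule flag.step[OF IH(1) PQ(1)])
    moreover have "(\<lambda>(K, L). g ` root_face K L) ` insert (K, L) F = (\<lambda>(K, L). root_face K L) ` insert (P, Q) F'"
      unfolding image_insert IH(3) by (simp add: gKL)
    moreover have "card P + card Q = card K + card L"
      using pair_extends_card[OF step.hyps(2) fin(1,2)] pair_extends_card[OF PQ(1) fin(3,4)] IH(4) by simp
    ultimately show ?case using gKL by blast
  qed
qed

lemma aut_complete_flag:
  assumes g: "g \<in> G" and F: "complete_flag A F"
  obtains F' where "complete_flag A F'" "g ` bary ` F = bary ` F'"
proof -
  obtain I J where IJ: "flag A F I J" "I \<union> J = A" using F by (auto simp: complete_flag_def)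
  obtain F' I' J' where F': "flag A F' I' J'" 
    "(\<lambda>(K, L). g ` root_face K L) ` F = (\<lambda>(K, L). root_face K L) ` F'" "card I' + card J' = card I + card J"
    using aut_flag[OF g IJ(1)] by (elim exE conjE) (rule that)
  have "card (I' \<union> J') = card A" using flag_card_Un[OF F'(1)] flag_card_Un[OF IJ(1)] F'(3) IJ(2) by simp
  then have "I' \<union> J' = A" using card_subset_eq[of A "I' \<union> J'"] flag_top(2,3)[OF F'(1)] by simp
  then have "complete_flag A F'" using F'(1) by (auto simp: complete_flag_def)
  moreover have "g ` bary ` F = bary ` F'"
  proof
    have eq: "g (bary p) = bary p'" if "p \<in> F" "p' \<in> F'" "(case p of (K, L) \<Rightarrow> g ` root_face K L) = (case p' of (K, L) \<Rightarrow> root_face K L)" for p p'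
    proof -
      obtain K L K' L' where KL: "p = (K, L)" "p' = (K', L')" by (cases p; cases p')
      show ?thesis
        using aut_bary[OF g flag_signed_pair[OF IJ(1)] flag_signed_pair[OF F'(1)], of K L K' L'] that unfolding KL by simp
    qed
    show "g ` bary ` F \<subseteq> bary ` F'"
    proof
      fix x assume "x \<in> g ` bary ` F"
      then obtain p where p: "p \<in> F" "x = g (bary p)" by blast
      have "(case p of (K, L) \<Rightarrow> g ` root_face K L) \<in> (\<lambda>(K, L). root_face K L) ` F'"
        unfolding F'(2)[symmetric] using p(1) by (rule imageI)
      then obtain p' where "p' \<in> F'" "(case p of (K, L) \<Rightarrow> g ` root_face K L) = (case p' of (K, L) \<Rightarrow> root_face K L)"
        by (rule imageE)
      then show "x \<in> bary ` F'" using eq[OF p(1)] p(2) by simp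
    qed
    show "bary ` F' \<subseteq> g ` bary ` F"
    proof
      fix x assume "x \<in> bary ` F'"
      then obtain p' where p': "p' \<in> F'" "x = bary p'" by blast
      have "(case p' of (K, L) \<Rightarrow> root_face K L) \<in> (\<lambda>(K, L). g ` root_face K L) ` F"
        unfolding F'(2) using p'(1) by (rule imageI)
      then obtain p where p: "(case p' of (K, L) \<Rightarrow> root_face K L) = (case p of (K, L) \<Rightarrow> g ` root_face K L)" "p \<in> F"
        by (rule imageE)
      then show "x \<in> g ` bary ` F" using eq[OF p(2) p'(1) p(1)[symmetric]] p'(2) by (metis imageI)
    qed
  qed
  ultimately show ?thesis by (rule that)
qed

lemma flag_bary_span: "complete_flag A F \<Longrightarrow> bary ` F \<subseteq> span \<Phi>"
  unfolding span_lattice[symmetric] by (auto intro: span_base complete_flag_pair(6))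

lemma finite_flag_bary: "complete_flag A F \<Longrightarrow> finite (bary ` F)"
  using flag_finite unfolding complete_flag_def by blast

lemma aut_cones:
  assumes g: "g \<in> G" and s: "\<sigma> \<in> cones"
  shows "g ` \<sigma> \<in> cones"
proof -
  obtain F S where F: "complete_flag A F" "S \<subseteq> bary ` F" "\<sigma> = Cone S" using s unfolding cones_flags by blast
  obtain F' where F': "complete_flag A F'" "g ` bary ` F = bary ` F'" by (rule aut_complete_flag[OF g F(1)])
  have "g ` \<sigma> = Cone (g ` S)"
    unfolding F(3) using F(2) flag_bary_span[OF F(1)] finite_subset[OF F(2) finite_flag_bary[OF F(1)]]
    by (intro aut_Cone[OF g]) auto
  moreover have "g ` S \<subseteq> bary ` F'" using F(2) F'(2) by blast
  ultimately show ?thesis unfolding cones_flags using F'(1) by blast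
qed

lemma invariant_cones: "invariant_fan G cones"
  unfolding invariant_fan_def
proof
  fix g assume g: "g \<in> G"
  obtain g' where g': "g' \<in> G" "\<And>x. x \<in> span \<Phi> \<Longrightarrow> g' (g x) = x" "\<And>x. x \<in> span \<Phi> \<Longrightarrow> g (g' x) = x"
    by (rule aut_inverse[OF g]) (rule that)
  show "(\<lambda>\<sigma>. g ` \<sigma>) ` cones = cones"
  proof
    show "(\<lambda>\<sigma>. g ` \<sigma>) ` cones \<subseteq> cones" using aut_cones[OF g] by blast
    show "cones \<subseteq> (\<lambda>\<sigma>. g ` \<sigma>) ` cones"
    proof
      fix \<sigma> assume s: "\<sigma> \<in> cones"
      then have "\<sigma> \<subseteq> span \<Phi>"
        using complete_cones unfolding complete_fan_def span_lattice by blast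
      then have "g ` (g' ` \<sigma>) = \<sigma>" unfolding image_image using g'(3) by force
      then show "\<sigma> \<in> (\<lambda>\<sigma>. g ` \<sigma>) ` cones" using aut_cones[OF g'(1) s] by blast
    qed
  qed
qed

section \<open>Orbits of maximal cones\<close>

definition perm_map :: "(nat \<Rightarrow> nat) \<Rightarrow> 'a \<Rightarrow> 'a" where
  "perm_map \<pi> x = (\<Sum>j\<in>A. (x \<bullet> e j) *\<^sub>R e (\<pi> j))"

lemma linear_perm_map: "linear (perm_map \<pi>)"
  by (rule linearI) (simp_all add: perm_map_def inner_add_left scaleR_add_left sum.distrib scaleR_sum_right)

lemma perm_map_e: "j \<in> A \<Longrightarrow> perm_map \<pi> (e j) = e (\<pi> j)"
proof -
  assume j: "j \<in> A"
  have "perm_map \<pi> (e j) = (\<Sum>k\<in>A. if k = j then e (\<pi> k) else 0)"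
    unfolding perm_map_def using j by (intro sum.cong) (auto simp: e_inner)
  then show ?thesis using j by simp
qed

lemma perm_map_inner:
  assumes \<pi>: "bij_betw \<pi> A A" and j: "j \<in> A"
  shows "perm_map \<pi> x \<bullet> e (\<pi> j) = x \<bullet> e j"
proof -
  have "perm_map \<pi> x \<bullet> e (\<pi> j) = (\<Sum>k\<in>A. if k = j then x \<bullet> e k else 0)"
    unfolding perm_map_def inner_sum_left using \<pi> j
    by (intro sum.cong) (auto simp: e_inner bij_betw_apply[OF \<pi>] bij_betw_def inj_on_def)
  then show ?thesis using j by simp
qed

text \<open>
Permutations of the basis vectors permute the roots.
\<close>

lemma perm_map_aut:
  assumes \<pi>: "bij_betw \<pi> A A"
  shows "perm_map \<pi> \<in> G"
proof -
  have im: "perm_map \<pi> ` \<Phi> = \<Phi>"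
  proof
    show "perm_map \<pi> ` \<Phi> \<subseteq> \<Phi>"
    proof
      fix v assume "v \<in> perm_map \<pi> ` \<Phi>"
      then obtain u where u: "u \<in> \<Phi>" "v = perm_map \<pi> u" by blast
      obtain i j where ij: "i \<in> A" "j \<in> A" "i \<noteq> j" "u = e i - e j" by (rule rootE[OF u(1)])
      then have "v = e (\<pi> i) - e (\<pi> j)" using u(2) by (simp add: linear_diff[OF linear_perm_map] perm_map_e)
      moreover have "\<pi> i \<in> A" "\<pi> j \<in> A" "\<pi> i \<noteq> \<pi> j"
        using \<pi> ij bij_betw_apply[OF \<pi>] by (auto simp: bij_betw_def inj_on_def)
      ultimately show "v \<in> \<Phi>" using rootI by simp
    qed
    show "\<Phi> \<subseteq> perm_map \<pi> ` \<Phi>"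
    proof
      fix v assume v: "v \<in> \<Phi>"
      obtain i j where ij: "i \<in> A" "j \<in> A" "i \<noteq> j" "v = e i - e j" by (rule rootE[OF v])
      obtain i' j' where "i' \<in> A" "j' \<in> A" "i = \<pi> i'" "j = \<pi> j'" using \<pi> ij unfolding bij_betw_def by blast
      then have "v = perm_map \<pi> (e i' - e j')" "e i' - e j' \<in> \<Phi>"
        using ij by (auto simp: linear_diff[OF linear_perm_map] perm_map_e intro!: rootI)
      then show "v \<in> perm_map \<pi> ` \<Phi>" by blast
    qed
  qed
  have "inj (perm_map \<pi>)"
  proof (rule injI)
    fix x y assume "perm_map \<pi> x = perm_map \<pi> y"
    then show "x = y" using perm_map_inner[OF \<pi>] by (intro vec_eqI) metis
  qed
  then have "inj_on (perm_map \<pi>) (span \<Phi>)" by (rule inj_on_subset) simp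
  moreover have "perm_map \<pi> ` span \<Phi> = span \<Phi>" using linear_span_image[OF linear_perm_map, of \<pi> \<Phi>] im by simp
  ultimately show ?thesis
    unfolding root_automorphisms_def bij_betw_def
    using im linear_add[OF linear_perm_map] linear_scale[OF linear_perm_map] by blast
qed

lemma perm_map_bary:
  assumes \<pi>: "bij_betw \<pi> A A" and IJ: "I \<subseteq> A" "J \<subseteq> A"
  shows "perm_map \<pi> (bary (I, J)) = bary (\<pi> ` I, \<pi> ` J)"
proof -
  have inj: "inj_on \<pi> T" if "T \<subseteq> A" for T using \<pi> that by (meson bij_betw_def inj_on_subset)
  have s: "perm_map \<pi> (\<Sum>i\<in>T. e i) = (\<Sum>i\<in>\<pi> ` T. e i)" if "T \<subseteq> A" for T
    using that by (simp add: linear_sum[OF linear_perm_map] sum.reindex[OF inj[OF that]] perm_map_e subset_iff)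
  show ?thesis
    unfolding bary_def
    by (simp add: linear_diff[OF linear_perm_map] linear_scale[OF linear_perm_map] s[OF IJ(1)] s[OF IJ(2)]
        card_image[OF inj[OF IJ(1)]] card_image[OF inj[OF IJ(2)]])
qed

lemma uminus_comp_aut:
  assumes g: "g \<in> G"
  shows "(\<lambda>x. - g x) \<in> G"
proof -
  have im: "uminus ` \<Phi> = \<Phi>"
  proof -
    have "- v \<in> \<Phi>" if v: "v \<in> \<Phi>" for v by (rule rootE[OF v]) (use rootI in auto)
    then show ?thesis by (force simp: image_iff)
  qed
  have "bij_betw uminus (span \<Phi>) (span \<Phi>)"
    by (rule bij_betwI[of _ _ _ uminus]) (auto intro: span_neg)
  from bij_betw_trans[OF autD(1)[OF g] this] have "bij_betw (\<lambda>x. - g x) (span \<Phi>) (span \<Phi>)" by (simp add: comp_def)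
  moreover have "(\<lambda>x. - g x) ` \<Phi> = \<Phi>" using im autD(4)[OF g] by (metis image_image)
  ultimately show ?thesis
    unfolding root_automorphisms_def using autD(2,3)[OF g] by simp
qed

text \<open>
The elements of \<open>I\<close>, in the order of their appearance, correspond to \<open>k, k - 1, \<dots>, 1\<close>, and those of \<open>J\<close> to
\<open>k + 1, \<dots>, n + 1\<close>.
\<close>

lemma complete_flag_path:
  assumes F: "flag A F I J" "I \<union> J = A"
  shows "\<exists>C\<in>minimal_paths n (card I). \<exists>\<pi>. bij_betw \<pi> A A \<and> (\<lambda>(K, L). (\<pi> ` K, \<pi> ` L)) ` path_flag (card I) C = F"
proof -
  obtain \<alpha> \<beta> c where en: "enumerates \<alpha> \<beta> c F I J" using flag_enumeration[OF F(1)] by blast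
  define k l where kl: "k = card I" "l = card J"
  note i = flag_invariants[OF F(1)]
  have "card (I \<union> J) = k + l" unfolding kl by (rule flag_card_Un[OF F(1)])
  then have n: "k + l = n + 1" using F(2) card_A by simp
  then have n': "k + l - 1 = n" by simp
  have pos: "k \<ge> 1" "l \<ge> 1" using i by (auto simp: kl Suc_le_eq card_gt_0_iff)
  have a: "bij_betw \<alpha> {1..k} I" and b: "bij_betw \<beta> {1..l} J" and c1: "c 1 = (1, 1)" and cn: "c n = (k, l)"
    and st: "\<And>r. r \<in> {2..n} \<Longrightarrow> path_step (c (r - 1)) (c r)"
    and le: "\<And>r. r \<in> {1..n} \<Longrightarrow> fst (c r) \<le> k" "\<And>r. r \<in> {1..n} \<Longrightarrow> snd (c r) \<le> l"
    and Fe: "F = (\<lambda>r. (\<alpha> ` {1..fst (c r)}, \<beta> ` {1..snd (c r)})) ` {1..n}"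
    using en unfolding enumerates_def Let_def kl[symmetric] n' by auto
  define C where "C = (\<lambda>r\<in>{1..n}. (k + 1 - fst (c r), k + snd (c r)))"
  have C: "C r = (k + 1 - fst (c r), k + snd (c r))" if "r \<in> {1..n}" for r using that by (simp add: C_def)
  have Cm: "C \<in> minimal_paths n k"
    unfolding minimal_paths_def
  proof (intro CollectI conjI ballI)
    show "C \<in> extensional {1..n}" by (simp add: C_def)
    show "C 1 = (k, k + 1)" "C n = (1, n + 1)" using C[of 1] C[of n] c1 cn n n_pos by auto
    fix r assume r: "r \<in> {2..n}"
    then have r': "r \<in> {1..n}" "r - 1 \<in> {1..n}" by auto
    show "fst (C r) + 1 = fst (C (r - 1)) \<and> snd (C r) = snd (C (r - 1)) \<or>
      fst (C r) = fst (C (r - 1)) \<and> snd (C r) = snd (C (r - 1)) + 1"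
      using st[OF r]
    proof (unfold path_step_def, elim disjE conjE)
      assume "fst (c r) = fst (c (r - 1)) + 1" "snd (c r) = snd (c (r - 1))"
      then show ?thesis using le(1)[OF r'(1)] unfolding C[OF r'(1)] C[OF r'(2)] fst_conv snd_conv by linarith
    next
      assume "fst (c r) = fst (c (r - 1))" "snd (c r) = snd (c (r - 1)) + 1"
      then show ?thesis unfolding C[OF r'(1)] C[OF r'(2)] fst_conv snd_conv by linarith
    qed
  qed
  define \<pi> where "\<pi> x = (if x \<le> k then \<alpha> (k + 1 - x) else \<beta> (x - k))" for x
  have reflect: "bij_betw (\<lambda>x. k + 1 - x) {1..k} {1..k}"
    by (rule bij_betwI[of _ _ _ "\<lambda>x. k + 1 - x"]) auto
  have shift: "bij_betw (\<lambda>x. x - k) {k+1..k+l} {1..l}"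
    by (rule bij_betwI[of _ _ _ "\<lambda>x. x + k"]) auto
  have "bij_betw \<pi> {1..k} I"
    using bij_betw_trans[OF reflect a] by (rule bij_betw_cong[THEN iffD1, rotated]) (auto simp: \<pi>_def)
  moreover have "bij_betw \<pi> {k+1..k+l} J"
    using bij_betw_trans[OF shift b] by (rule bij_betw_cong[THEN iffD1, rotated]) (auto simp: \<pi>_def)
  moreover have "I \<inter> J = {}" using i by simp
  ultimately have "bij_betw \<pi> ({1..k} \<union> {k+1..k+l}) (I \<union> J)" by (intro bij_betw_combine)
  moreover have "{1..k} \<union> {k+1..k+l} = A" using n by (auto simp: A_def)
  ultimately have "bij_betw \<pi> A A" using F(2) by simp
  moreover have "(\<lambda>(K, L). (\<pi> ` K, \<pi> ` L)) ` path_flag k C = F"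
    unfolding Fe path_flag_def image_image
  proof (rule image_cong[OF refl])
    fix r assume r: "r \<in> {1..n}"
    have "\<pi> ` {k + 1 - fst (c r)..k} = \<alpha> ` {1..fst (c r)}"
    proof -
      have "(\<lambda>x. k + 1 - x) ` {k + 1 - fst (c r)..k} = {1..fst (c r)}"
      proof
        show "(\<lambda>x. k + 1 - x) ` {k + 1 - fst (c r)..k} \<subseteq> {1..fst (c r)}" by auto
        show "{1..fst (c r)} \<subseteq> (\<lambda>x. k + 1 - x) ` {k + 1 - fst (c r)..k}"
        proof
          fix y assume y: "y \<in> {1..fst (c r)}"
          then have "y = k + 1 - (k + 1 - y)" "k + 1 - y \<in> {k + 1 - fst (c r)..k}" using le(1)[OF r] by auto
          then show "y \<in> (\<lambda>x. k + 1 - x) ` {k + 1 - fst (c r)..k}" by blast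
        qed
      qed
      moreover have "\<pi> ` {k + 1 - fst (c r)..k} = \<alpha> ` (\<lambda>x. k + 1 - x) ` {k + 1 - fst (c r)..k}"
        unfolding image_image by (intro image_cong refl) (simp add: \<pi>_def)
      ultimately show ?thesis by simp
    qed
    moreover have "\<pi> ` {k+1..k + snd (c r)} = \<beta> ` {1..snd (c r)}"
    proof -
      have "(\<lambda>x. x - k) ` {k+1..k + snd (c r)} = {1..snd (c r)}"
      proof
        show "(\<lambda>x. x - k) ` {k+1..k + snd (c r)} \<subseteq> {1..snd (c r)}" by auto
        show "{1..snd (c r)} \<subseteq> (\<lambda>x. x - k) ` {k+1..k + snd (c r)}"
        proof
          fix y assume "y \<in> {1..snd (c r)}"
          then have "y = (k + y) - k" "k + y \<in> {k+1..k + snd (c r)}" by auto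
          then show "y \<in> (\<lambda>x. x - k) ` {k+1..k + snd (c r)}" by blast
        qed
      qed
      moreover have "\<pi> ` {k+1..k + snd (c r)} = \<beta> ` (\<lambda>x. x - k) ` {k+1..k + snd (c r)}"
        unfolding image_image by (intro image_cong refl) (simp add: \<pi>_def)
      ultimately show ?thesis by simp
    qed
    ultimately show "(case ({fst (C r)..k}, {k + 1..snd (C r)}) of (K, L) \<Rightarrow> (\<pi> ` K, \<pi> ` L)) =
        (\<alpha> ` {1..fst (c r)}, \<beta> ` {1..snd (c r)})"
      unfolding C[OF r] split_conv fst_conv snd_conv by (simp only:)
  qed
  ultimately show ?thesis using Cm unfolding kl by (intro bexI[of _ C] exI[of _ \<pi>] conjI)
qed

lemma complete_flag_orbit:
  assumes F: "flag A F I J" "I \<union> J = A"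
  shows "\<exists>C\<in>minimal_paths n (card I). \<exists>g\<in>G. g ` Cone (path_generators e n (card I) C) = Cone (bary ` F)"
proof -
  obtain C \<pi> where C: "C \<in> minimal_paths n (card I)" and \<pi>: "bij_betw \<pi> A A"
    and F': "(\<lambda>(K, L). (\<pi> ` K, \<pi> ` L)) ` path_flag (card I) C = F"
    using complete_flag_path[OF F] by blast
  note i = flag_invariants[OF F(1)]
  have "card I + card J = n + 1" using flag_card_Un[OF F(1)] F(2) card_A by simp
  moreover have "card I \<ge> 1" "card J \<ge> 1" using i by (auto simp: Suc_le_eq card_gt_0_iff)
  ultimately have "card I \<in> {1..n}" by auto
  then have P: "complete_flag A (path_flag (card I) C)" by (rule path_flag_complete[OF C])
  have "perm_map \<pi> ` bary ` path_flag (card I) C = bary ` F"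
    unfolding F'[symmetric] image_image
  proof (rule image_cong[OF refl])
    fix p assume p: "p \<in> path_flag (card I) C"
    obtain K L where KL: "p = (K, L)" by (cases p)
    show "perm_map \<pi> (bary p) = bary (case p of (K, L) \<Rightarrow> (\<pi> ` K, \<pi> ` L))"
      using perm_map_bary[OF \<pi> complete_flag_pair(1,2)[OF P p[unfolded KL]]] by (simp add: KL)
  qed
  then have "perm_map \<pi> ` Cone (path_generators e n (card I) C) = Cone (bary ` F)"
    unfolding path_cone[OF C] aut_Cone[OF perm_map_aut[OF \<pi>] finite_flag_bary[OF P] flag_bary_span[OF P]] by simp
  then show ?thesis using C perm_map_aut[OF \<pi>] by blast
qed

lemma bary_swap: "bary (prod.swap p) = - bary p"
  by (cases p) (simp add: bary_def)

text \<open>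
Since \<open>|I| + |J| = n + 1\<close>, one of the two sets has at most \<open>\<lceil>n / 2\<rceil>\<close> elements. If this is \<open>J\<close>, then \<open>- id\<close>
exchanges the two sets.
\<close>

lemma orbit_representatives_paths:
  "orbit_representatives G cones {Cone (path_generators e n i C) | i C.
     i \<in> {1..nat \<lceil>real n / 2\<rceil>} \<and> C \<in> minimal_paths n i}" (is "orbit_representatives G cones ?R")
  unfolding orbit_representatives_def
proof (intro conjI ballI)
  have half: "nat \<lceil>real n / 2\<rceil> \<le> n" using n_pos by (simp add: nat_le_iff ceiling_le_iff)
  show "?R \<subseteq> maximal_cones cones"
  proof
    fix \<sigma> assume "\<sigma> \<in> ?R"
    then obtain i C where iC: "i \<in> {1..nat \<lceil>real n / 2\<rceil>}" "C \<in> minimal_paths n i" "\<sigma> = Cone (path_generators e n i C)"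
      by blast
    then have "i \<in> {1..n}" using half by (meson atLeastAtMost_iff order_trans)
    then show "\<sigma> \<in> maximal_cones cones"
      unfolding maximal_cones_flags iC(3) path_cone[OF iC(2)] using path_flag_complete[OF iC(2)] by blast
  qed
  fix \<sigma> assume "\<sigma> \<in> maximal_cones cones"
  then obtain F where F: "complete_flag A F" "\<sigma> = Cone (bary ` F)" unfolding maximal_cones_flags by blast
  obtain I J where IJ: "flag A F I J" "I \<union> J = A" using F(1) by (auto simp: complete_flag_def)
  note i = flag_invariants[OF IJ(1)]
  have pos: "card I \<ge> 1" "card J \<ge> 1" using i by (auto simp: Suc_le_eq card_gt_0_iff)
  have sum: "card I + card J = n + 1" using flag_card_Un[OF IJ(1)] IJ(2) card_A by simp
  show "\<exists>\<rho>\<in>?R. \<exists>g\<in>G. g ` \<rho> = \<sigma>"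
  proof (cases "card I \<le> nat \<lceil>real n / 2\<rceil>")
    case True
    obtain C g where "C \<in> minimal_paths n (card I)" "g \<in> G" "g ` Cone (path_generators e n (card I) C) = \<sigma>"
      using complete_flag_orbit[OF IJ] unfolding F(2) by blast
    moreover have "card I \<in> {1..nat \<lceil>real n / 2\<rceil>}" using True pos by simp
    ultimately show ?thesis by blast
  next
    case False
    then have "card J \<le> nat \<lceil>real n / 2\<rceil>" using sum by linarith
    then have J: "card J \<in> {1..nat \<lceil>real n / 2\<rceil>}" using pos by simp
    have "J \<union> I = A" using IJ(2) by blast
    then obtain C g where C: "C \<in> minimal_paths n (card J)" "g \<in> G"
      "g ` Cone (path_generators e n (card J) C) = Cone (bary ` prod.swap ` F)"
      using complete_flag_orbit[OF flag_swap[OF IJ(1)]] by blast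
    have id: "(\<lambda>x. x) \<in> G" unfolding root_automorphisms_def by (auto simp: bij_betw_def)
    have neg: "(\<lambda>x. - x) \<in> G" by (rule uminus_comp_aut[OF id])
    have s: "bary ` prod.swap ` F = (\<lambda>x. - x) ` bary ` F" unfolding image_image by (simp add: bary_swap)
    have "Cone (bary ` prod.swap ` F) = (\<lambda>x. - x) ` \<sigma>"
      unfolding s F(2) by (rule aut_Cone[OF neg finite_flag_bary[OF F(1)] flag_bary_span[OF F(1)], symmetric])
    then have "(\<lambda>x. - g x) ` Cone (path_generators e n (card J) C) = (\<lambda>x. - x) ` (\<lambda>x. - x) ` \<sigma>"
      using C(3) by (metis image_image)
    then have "(\<lambda>x. - g x) ` Cone (path_generators e n (card J) C) = \<sigma>" by (simp add: image_image)
    then show ?thesis using uminus_comp_aut[OF C(2)] C(1) J by blast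
  qed
qed

end

theorem proposition7p1:
  fixes n :: nat and e :: "nat \<Rightarrow> 'a::euclidean_space"
  assumes "n \<ge> 1" and "bij_betw e {1..n+1} Basis"
  shows "\<exists>\<Sigma>. fan (root_lattice e n) \<Sigma> \<and>
    simplicial \<Sigma> \<and>
    invariant_fan (root_automorphisms (roots e n)) \<Sigma> \<and>
    projective_fan (root_lattice e n) \<Sigma> \<and>
    orbit_representatives (root_automorphisms (roots e n)) \<Sigma>
      {Cone (path_generators e n i C) | i C.
         i \<in> {1..nat \<lceil>real n / 2\<rceil>} \<and> C \<in> minimal_paths n i}"
proof -
  interpret root_system_A n e using assms by unfold_locales
  show ?thesis
    using fan_cones simplicial_cones invariant_cones projective_cones orbit_representatives_paths by blast
qed

end
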